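(* Let $\rho$ be the projection letting the $x$-variables commute. For every set superpartition $I$ whose fermionic blocks have pairwise different sizes, we have (1) $\rho(m_I)=(-1)^{\varepsilon(I)}(\Lambda(I)^s)^!\,m_{\Lambda(I)}$; (2) $\rho(p_I)=(-1)^{\varepsilon(I)}p_{\Lambda(I)}$; (3) $\rho(e_I)=(-1)^{\varepsilon(I)}\Lambda(I)!\,e_{\Lambda(I)}$; (4) $\rho(h_I)=(-1)^{\varepsilon(I)}\Lambda(I)!\,h_{\Lambda(I)}$. Furthermore, if $J$ is a set superpartition having two distinct fermionic blocks of the same size, then $\rho(b_J)=0$, where $b$ is any of $m,p,e,h$.
   Context: Combinatorial objects. $[n]=\{1,\dots,n\}$, $[n]_0=[n]\cup\{0\}$, and $A^+=A\setminus\{0\}$. For $0\le m\le n+1$, a partial set supercomposition of bidegree $(n,m)$ is a tuple $K=(K_1,\dots,K_q)$ of nonempty subsets of $[n]_0$ (blocks) such that $K_1^+\cup\dots\cup K_q^+=[n]$, $K_i\cap K_j\subseteq\{0\}$ for $i\ne j$, $0\in K_i$ exactly for $i\le m$ (the fermionic blocks), and the nonfermionic blocks are ordered by increasing minimum. $s\mathcal C_{n,m}$ is the set of these. A set superpartition is a partial set supercomposition $I=(I_1,\dots,I_k)$ with $I_i\ne I_j$ and $\min(I_i\setminus I_j)<\min(I_j\setminus I_i)$ for all $i<j$, where $\min(\emptyset):=0$. For $K,L\in s\mathcal C_{n,m}$ write $K\sqsubseteq L$ if, for every $i\in[m]$, the $i$th fermionic block of $L$ is the union of the $i$th fermionic block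 of $K$ with some (possibly no) nonfermionic blocks of $K$, and each nonfermionic block of $L$ is a union of nonfermionic blocks of $K$; this is a meet-semilattice order with meet $\sqcap$. For a tuple of sets $N=(N_1,\dots,N_r)$, $N!=|N_1|!\cdots|N_r|!$ (the element $0$ is counted). Noncommuting functions. Let $\mathcal A$ be the $\mathbb Q$-algebra of formal power series of bounded degree in variables $x_1,x_2,\dots$ and $\theta_1,\theta_2,\dots$ subject only to $x_i\theta_j=\theta_jx_i$ and $\theta_i\theta_j=-\theta_j\theta_i$ (so $\theta_i^2=0$ and the $x_i$ do not commute with each other). For $K\in s\mathcal C_{n,m}$, each function below is a sum over words $\theta_{a_1}\cdots\theta_{a_m}x_{b_1}\cdots x_{b_n}$ with positive integer indices: - $m_K$ is the sum of all words in $M(K)$, the set of words with, for $i\in[m]$, $a_i=b_j$ iff $j\in K_i^+$, and, for $i,j\in[n]$, $b_i=b_j$ iff $i,j$ lie in the same block of $K$. - $p_K$ is the sum of all words such that $a_i=b_j$ whenever $i\in[m]$, $j\in K_i^+$, and $b_i=b_j$ whenever $i,j\in[n]$ lie in the same block of $K$. - $e_K$ is the sum of all words such that $a_i\ne b_j$ whenever $i\in[m]$, $j\in K_i^+$, and $b_i\neq b_j$ whenever $i\ne j$ in $[n]$ lie in the same block of $K$. - $h_K=\sum_u c_u\,u$, over all words $u$ with $a_1,\dots,a_m$ pairwise distinct and $\{a_1,\dots,a_m\}\setminus\{b_1,\dots,b_n\}$ having at most one element, where $c_u=(K\sqcap L)!$ and $L$ is the unique element of $s\mathcal C_{n,m}$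 with $u\in M(L)$. Commuting side. $\rho$ is the natural projection from $\mathcal A$ to the algebra of bounded-degree series obtained by additionally imposing $x_ix_j=x_jx_i$. A superpartition of bidegree $(n,m)$ is $\Lambda=(\Lambda_1,\dots,\Lambda_m;\Lambda_{m+1},\dots,\Lambda_k)$ of nonnegative integers with sum $n$, with $\Lambda^a=(\Lambda_1>\dots>\Lambda_m\ge0)$ strictly decreasing and $\Lambda^s=(\Lambda_{m+1}\ge\dots\ge\Lambda_k\geq 1)$ a usual partition. $\Lambda!=\Lambda_1!\cdots\Lambda_k!$, and for a partition $\lambda$ with $r_i$ parts equal to $i$, $\lambda^!=\prod_{i\ge1}r_i!$. The functions in commuting variables are: - $m_\Lambda$: the sum, without repetition, of all distinct terms $\theta_{i_1}\cdots\theta_{i_m}x_{i_1}^{\Lambda_1}\cdots x_{i_k}^{\Lambda_k}$ with $i_1,\dots,i_k$ pairwise distinct positive integers; - $p_\Lambda=\tilde p_{\Lambda_1}\cdots\tilde p_{\Lambda_m}p_{\Lambda_{m+1}}\cdots p_{\Lambda_k}$ with $\tilde p_k=\sum_i\theta_ix_i^k$ ($k\ge0$), $p_r=\sum_ix_i^r$ ($r\ge1$); - $e_\Lambda=\tilde e_{\Lambda_1}\cdots\tilde e_{\Lambda_m}e_{\Lambda_{m+1}}\cdots e_{\Lambda_k}$ with $\tilde e_k=m_{(0;1^k)}$, $e_r=m_{(\emptyset;1^r)}$; - $h_\Lambda=\tilde h_{\Lambda_1}\cdots\tilde h_{\Lambda_m}h_{\Lambda_{m+1}}\cdots h_{\Lambda_k}$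 with $\tilde h_k=\sum(\Omega_1+1)m_\Omega$ over superpartitions $\Omega$ of bidegree $(k,1)$, and $h_r=\sum m_\Omega$ over superpartitions $\Omega$ of bidegree $(r,0)$. For a set superpartition $I=(I_1,\dots,I_k)$ of fermionic degree $m$ whose fermionic blocks have pairwise different sizes, $\Lambda(I)$ is the superpartition whose fermionic part $\Lambda(I)^a$ is the decreasing rearrangement of $(|I_1|-1,\dots,|I_m|-1)$ and whose part $\Lambda(I)^s$ is the decreasing rearrangement of $(|I_{m+1}|,\dots,|I_k|)$; $\varepsilon(I)$ is the minimal number of transpositions needed to obtain $\Lambda(I)^a$ from $(|I_1|-1,\dots,|I_m|-1)$. *)

theory Defs
  imports Complex_Main "HOL-Library.Multiset"
begin

section \<open>Power series in anticommuting and further variables\<close>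

text \<open>
  A series is given by its coefficients: \<open>f S w\<close> is the coefficient of
  \<open>\<theta>\<^sub>S w\<close>, where \<open>\<theta>\<^sub>S\<close> is the product of the variables \<open>\<theta>\<^sub>i\<close> with \<open>i \<in> S\<close> in increasing
  order of the indices, and where \<open>w\<close> is a monomial in the \<open>x\<close>-variables: a list of indices
  if the \<open>x\<close>-variables do not commute, and a multiset of indices if they do. These products
  are the normal forms of the monomials modulo \<open>x\<^sub>i\<theta>\<^sub>j = \<theta>\<^sub>jx\<^sub>i\<close> and
  \<open>\<theta>\<^sub>i\<theta>\<^sub>j = -\<theta>\<^sub>j\<theta>\<^sub>i\<close>. No bound is put on the degree in the type; the series of bounded degree form a
  subalgebra, and all series below are homogeneous.
\<close>

type_synonym 'w series = "nat set \<Rightarrow> 'w \<Rightarrow> rat"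
type_synonym ncseries = "nat list series"
type_synonym cseries = "nat multiset series"

definition monomial :: "nat set \<Rightarrow> 'w \<Rightarrow> 'w series" where
  "monomial S w = (\<lambda>T v. if T = S \<and> v = w then 1 else 0)"

definition zero_series :: "'w series" where
  "zero_series = (\<lambda>S w. 0)"

definition scale :: "rat \<Rightarrow> 'w series \<Rightarrow> 'w series" where
  "scale c f = (\<lambda>S w. c * f S w)"

text \<open>
  The coefficientwise sum of a family in which every monomial occurs finitely often.
\<close>

definition series_sum :: "('i \<Rightarrow> 'w series) \<Rightarrow> 'i set \<Rightarrow> 'w series" where
  "series_sum F X = (\<lambda>S w. \<Sum>i\<in>{i \<in> X. F i S w \<noteq> 0}. F i S w)"

text \<open>
  For disjoint finite \<open>T\<close> and \<open>U\<close> we have \<open>\<theta>\<^sub>T\<theta>\<^sub>U = (-1)\<^sup>k \<theta>\<^bsub>T \<union> U\<^esub>\<close>, where \<open>k\<close> is the number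
  of inversions; for non-disjoint ones the product is zero. The first argument of the product
  of series is the product of \<open>x\<close>-monomials. At an infinite \<open>S\<close> the coefficient is zero
  because \<open>Pow S\<close> is infinite.
\<close>

definition inversions :: "nat set \<Rightarrow> nat set \<Rightarrow> nat" where
  "inversions T U = card {(t, u). t \<in> T \<and> u \<in> U \<and> u < t}"

definition series_mult :: "('w \<Rightarrow> 'w \<Rightarrow> 'w) \<Rightarrow> 'w series \<Rightarrow> 'w series \<Rightarrow> 'w series" where
  "series_mult mul f g = (\<lambda>S w. \<Sum>T\<in>Pow S. \<Sum>(u, v)\<in>{(u, v). mul u v = w}.
     (-1) ^ inversions T (S - T) * f T u * g (S - T) v)"

definition nc_mult :: "ncseries \<Rightarrow> ncseries \<Rightarrow> ncseries" where
  "nc_mult = series_mult (@)"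

definition c_mult :: "cseries \<Rightarrow> cseries \<Rightarrow> cseries" where
  "c_mult = series_mult (+)"

definition nc_prod :: "ncseries list \<Rightarrow> ncseries" where
  "nc_prod fs = foldr nc_mult fs (monomial {} [])"

definition c_prod :: "cseries list \<Rightarrow> cseries" where
  "c_prod fs = foldr c_mult fs (monomial {} {#})"

definition nc_theta :: "nat \<Rightarrow> ncseries" where "nc_theta i = monomial {i} []"
definition nc_x :: "nat \<Rightarrow> ncseries" where "nc_x i = monomial {} [i]"
definition c_theta :: "nat \<Rightarrow> cseries" where "c_theta i = monomial {i} {#}"
definition c_x :: "nat \<Rightarrow> cseries" where "c_x i = monomial {} {#i#}"
definition c_x_power :: "nat \<Rightarrow> nat \<Rightarrow> cseries" where
  "c_x_power i k = c_prod (replicate k (c_x i))"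

text \<open>
  The projection sends \<open>\<theta>\<^sub>S w\<close> to \<open>\<theta>\<^sub>S\<close> times the commutative image of \<open>w\<close>.
\<close>

definition rho :: "ncseries \<Rightarrow> cseries" where
  "rho f = (\<lambda>S M. \<Sum>w\<in>{w. mset w = M}. f S w)"

subsection \<open>The defining relations\<close>

lemma finite_append_eq: "finite {(u, v). u @ v = w}"
proof (rule finite_subset)
  show "{(u, v). u @ v = w} \<subseteq> (\<lambda>k. (take k w, drop k w)) ` {..length w}"
  proof clarify
    fix u v
    show "(u, v) \<in> (\<lambda>k. (take k (u @ v), drop k (u @ v))) ` {..length (u @ v)}"
      by (rule image_eqI[of _ _ "length u"]) simp_all
  qed
qed simp

lemma finite_plus_eq: "finite {(u, v). u + v = (M :: nat multiset)}"
proof (rule finite_subset)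
  let ?A = "{xs. set xs \<subseteq> set_mset M \<and> length xs \<le> size M}"
  show "{(u, v). u + v = M} \<subseteq> (mset ` ?A) \<times> (mset ` ?A)"
  proof
    fix z assume "z \<in> {(u, v). u + v = M}"
    then obtain u v where z: "z = (u, v)" and M: "M = u + v" by auto
    obtain xs ys where "mset xs = u" "mset ys = v" by (meson ex_mset)
    then have "u = mset xs" "v = mset ys" "xs \<in> ?A" "ys \<in> ?A"
      using M by (auto simp flip: size_mset)
    then show "z \<in> (mset ` ?A) \<times> (mset ` ?A)" unfolding z by blast
  qed
  show "finite ((mset ` ?A) \<times> (mset ` ?A))"
    by (intro finite_cartesian_product finite_imageI finite_lists_length_le) simp_all
qed

lemma series_mult_monomial:
  assumes fin: "\<And>w. finite {(u, v). mul u v = w}" and "finite S" "finite T"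
  shows "series_mult mul (monomial S a) (monomial T b) =
    (if S \<inter> T = {} then scale ((-1) ^ inversions S T) (monomial (S \<union> T) (mul a b)) else zero_series)"
proof (intro ext)
  fix U w
  let ?D = "{(u, v). mul u v = w}"
  define P where "P \<longleftrightarrow> S \<subseteq> U \<and> U - S = T \<and> mul a b = w"
  have inner: "(\<Sum>(u, v)\<in>?D. (-1) ^ inversions V (U - V) * monomial S a V u * monomial T b (U - V) v)
      = (if V = S then (if U - S = T \<and> mul a b = w then (-1) ^ inversions S T else 0) else 0)" for V
  proof -
    have "(\<Sum>(u, v)\<in>?D. (-1) ^ inversions V (U - V) * monomial S a V u * monomial T b (U - V) v)
      = (\<Sum>x\<in>?D. if x = (a, b) then (if V = S \<and> U - S = T then (-1) ^ inversions S T else 0) else (0::rat))"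
      by (intro sum.cong) (auto simp: monomial_def split: if_splits)
    also have "\<dots> = (if V = S then (if U - S = T \<and> mul a b = w then (-1) ^ inversions S T else 0) else 0)"
      using fin[of w] by (subst sum.delta) auto
    finally show ?thesis .
  qed
  have "series_mult mul (monomial S a) (monomial T b) U w =
      (\<Sum>V\<in>Pow U. if V = S then (if U - S = T \<and> mul a b = w then (-1) ^ inversions S T else 0) else 0)"
    unfolding series_mult_def by (simp only: inner)
  also have "\<dots> = (if P then (-1) ^ inversions S T else 0)"
  proof (cases "finite U")
    case True
    then show ?thesis by (subst sum.delta) (auto simp: P_def)
  next
    case False
    then have "\<not> P"
      using assms(2,3) unfolding P_def by (metis finite_Diff2)
    with False show ?thesis by (simp add: finite_Pow_iff)
  qed
  also have "\<dots> = (if S \<inter> T = {} then scale ((-1) ^ inversions S T) (monomial (S \<union> T) (mul a b))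
      else zero_series) U w"
  proof (cases "S \<inter> T = {}")
    case True
    then have "P \<longleftrightarrow> U = S \<union> T \<and> w = mul a b" unfolding P_def by auto
    then show ?thesis using True by (simp add: scale_def monomial_def)
  next
    case False
    then have "\<not> P" unfolding P_def by auto
    then show ?thesis using False by (simp add: zero_series_def)
  qed
  finally show "series_mult mul (monomial S a) (monomial T b) U w =
    (if S \<inter> T = {} then scale ((-1) ^ inversions S T) (monomial (S \<union> T) (mul a b)) else zero_series) U w" .
qed

lemma inversions_simps [simp]:
  "inversions {} T = 0" "inversions S {} = 0" "inversions {i} {j} = (if j < i then 1 else 0)"
proof -
  have "{(t, u). t \<in> {i} \<and> u \<in> {j} \<and> u < t} = (if j < i then {(i, j)} else {})" by auto
  then show "inversions {i} {j} = (if j < i then 1 else 0)"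
    unfolding inversions_def by (simp only:) simp
qed (simp_all add: inversions_def)

lemma nc_theta_anticommute: "nc_mult (nc_theta i) (nc_theta j) = scale (-1) (nc_mult (nc_theta j) (nc_theta i))"
  unfolding nc_mult_def nc_theta_def
  by (auto simp: series_mult_monomial finite_append_eq scale_def zero_series_def fun_eq_iff insert_commute)

lemma nc_x_theta_commute: "nc_mult (nc_x i) (nc_theta j) = nc_mult (nc_theta j) (nc_x i)"
  unfolding nc_mult_def nc_theta_def nc_x_def
  by (simp add: series_mult_monomial finite_append_eq)

lemma c_theta_anticommute: "c_mult (c_theta i) (c_theta j) = scale (-1) (c_mult (c_theta j) (c_theta i))"
  unfolding c_mult_def c_theta_def
  by (auto simp: series_mult_monomial finite_plus_eq scale_def zero_series_def fun_eq_iff insert_commute)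

lemma c_x_theta_commute: "c_mult (c_x i) (c_theta j) = c_mult (c_theta j) (c_x i)"
  unfolding c_mult_def c_theta_def c_x_def
  by (simp add: series_mult_monomial finite_plus_eq)

lemma c_x_commute: "c_mult (c_x i) (c_x j) = c_mult (c_x j) (c_x i)"
  unfolding c_mult_def c_x_def
  by (simp add: series_mult_monomial finite_plus_eq add_mset_commute)

lemma finite_mset_eq: "finite {w. mset w = M}"
proof (rule finite_subset)
  show "{w. mset w = M} \<subseteq> {w. set w \<subseteq> set_mset M \<and> length w = size M}" by auto
qed (simp add: finite_lists_length_eq)

lemma rho_monomial: "rho (monomial S w) = monomial S (mset w)"
proof (intro ext)
  fix T M
  have "rho (monomial S w) T M = (\<Sum>v\<in>{v. mset v = M}. if v = w then (if T = S then 1 else 0) else 0)"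
    unfolding rho_def monomial_def by (intro sum.cong) auto
  also have "\<dots> = monomial S (mset w) T M"
    by (subst sum.delta) (auto simp: finite_mset_eq monomial_def)
  finally show "rho (monomial S w) T M = monomial S (mset w) T M" .
qed

lemma rho_mult: "rho (nc_mult f g) = c_mult (rho f) (rho g)"
proof (intro ext)
  fix S M
  let ?s = "\<lambda>T. (-1) ^ inversions T (S - T) :: rat"
  have *: "(\<Sum>w\<in>{w. mset w = M}. \<Sum>(u, v)\<in>{(u, v). u @ v = w}. ?s T * f T u * g (S - T) v)
     = (\<Sum>(p, q)\<in>{(p, q). p + q = M}. ?s T * rho f T p * rho g (S - T) q)" for T
  proof -
    have "(\<Sum>w\<in>{w. mset w = M}. \<Sum>(u, v)\<in>{(u, v). u @ v = w}. ?s T * f T u * g (S - T) v)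
       = (\<Sum>(w, u, v)\<in>(SIGMA w:{w. mset w = M}. {(u, v). u @ v = w}). ?s T * f T u * g (S - T) v)"
      by (subst sum.Sigma) (auto simp: finite_mset_eq finite_append_eq)
    also have "\<dots> = (\<Sum>((p, q), u, v)\<in>(SIGMA (p, q):{(p, q). p + q = M}. {u. mset u = p} \<times> {v. mset v = q}).
        ?s T * f T u * g (S - T) v)"
      by (rule sum.reindex_bij_witness[where
            i = "\<lambda>(_, u, v). (u @ v, u, v)" and j = "\<lambda>(_, u, v). ((mset u, mset v), u, v)"]) auto
    also have "\<dots> = (\<Sum>x\<in>{(p, q). p + q = M}. \<Sum>(u, v)\<in>{u. mset u = fst x} \<times> {v. mset v = snd x}.
        ?s T * f T u * g (S - T) v)"
      by (subst sum.Sigma) (auto simp: finite_mset_eq finite_plus_eq[unfolded case_prod_unfold] case_prod_unfold)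
    also have "\<dots> = (\<Sum>(p, q)\<in>{(p, q). p + q = M}. ?s T * rho f T p * rho g (S - T) q)"
    proof (intro sum.cong refl, clarify)
      fix p q
      have "rho f T p * rho g (S - T) q
          = (\<Sum>u\<in>{u. mset u = p}. \<Sum>v\<in>{v. mset v = q}. f T u * g (S - T) v)"
        unfolding rho_def by (rule sum_product)
      then have "?s T * rho f T p * rho g (S - T) q
          = (\<Sum>u\<in>{u. mset u = p}. \<Sum>v\<in>{v. mset v = q}. ?s T * f T u * g (S - T) v)"
        by (simp only: mult.assoc sum_distrib_left)
      then show "(\<Sum>(u, v)\<in>{u. mset u = fst (p, q)} \<times> {v. mset v = snd (p, q)}. ?s T * f T u * g (S - T) v)
          = ?s T * rho f T p * rho g (S - T) q"
        by (simp only: fst_conv snd_conv sum.cartesian_product)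
    qed
    finally show ?thesis .
  qed
  have "rho (nc_mult f g) S M = (\<Sum>T\<in>Pow S. \<Sum>w\<in>{w. mset w = M}.
      \<Sum>(u, v)\<in>{(u, v). u @ v = w}. ?s T * f T u * g (S - T) v)"
    unfolding rho_def nc_mult_def series_mult_def by (rule sum.swap)
  also have "\<dots> = c_mult (rho f) (rho g) S M"
    unfolding c_mult_def series_mult_def by (simp only: *)
  finally show "rho (nc_mult f g) S M = c_mult (rho f) (rho g) S M" .
qed

section \<open>Partial set supercompositions and set superpartitions\<close>

text \<open>
  Tuples are lists, so the block \<open>K\<^sub>i\<close> is \<open>K ! (i - 1)\<close>, and the fermionic blocks are
  \<open>K ! i\<close> for \<open>i < m\<close>, that is, the members of \<open>take m K\<close>.
\<close>

definition set_supercomps :: "nat \<Rightarrow> nat \<Rightarrow> nat set list set" where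
  "set_supercomps n m = {K. m \<le> n + 1 \<and> m \<le> length K \<and>
     (\<forall>B\<in>set K. B \<noteq> {} \<and> B \<subseteq> {0..n}) \<and>
     (\<Union>B\<in>set K. B - {0}) = {1..n} \<and>
     (\<forall>i<length K. \<forall>j<length K. i \<noteq> j \<longrightarrow> K ! i \<inter> K ! j \<subseteq> {0}) \<and>
     (\<forall>i<length K. 0 \<in> K ! i \<longleftrightarrow> i < m) \<and>
     (\<forall>i j. m \<le> i \<and> i < j \<and> j < length K \<longrightarrow> Min (K ! i) < Min (K ! j))}"

definition min0 :: "nat set \<Rightarrow> nat" where
  "min0 A = (if A = {} then 0 else Min A)"

definition set_superparts :: "nat \<Rightarrow> nat \<Rightarrow> nat set list set" where
  "set_superparts n m = {I \<in> set_supercomps n m. \<forall>i j. i < j \<and> j < length I \<longrightarrow>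
     I ! i \<noteq> I ! j \<and> min0 (I ! i - I ! j) < min0 (I ! j - I ! i)}"

definition refines :: "nat \<Rightarrow> nat set list \<Rightarrow> nat set list \<Rightarrow> bool" where
  "refines m K L \<longleftrightarrow>
     (\<forall>i<m. \<exists>N\<subseteq>set (drop m K). L ! i = K ! i \<union> \<Union>N) \<and>
     (\<forall>B\<in>set (drop m L). \<exists>N\<subseteq>set (drop m K). B = \<Union>N)"

definition meet :: "nat \<Rightarrow> nat \<Rightarrow> nat set list \<Rightarrow> nat set list \<Rightarrow> nat set list" where
  "meet n m K L = (THE N. N \<in> set_supercomps n m \<and> refines m N K \<and> refines m N L \<and>
     (\<forall>N'\<in>set_supercomps n m. refines m N' K \<and> refines m N' L \<longrightarrow> refines m N' N))"

definition tuple_fact :: "nat set list \<Rightarrow> rat" where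
  "tuple_fact N = (\<Prod>B\<leftarrow>N. fact (card B))"

section \<open>The functions in noncommuting variables\<close>

text \<open>
  The pair \<open>(a, b)\<close> stands for the word \<open>\<theta>\<^bsub>a\<^sub>1\<^esub>\<dots>\<theta>\<^bsub>a\<^sub>m\<^esub>x\<^bsub>b\<^sub>1\<^esub>\<dots>x\<^bsub>b\<^sub>n\<^esub>\<close>; again \<open>a\<^sub>i\<close> is
  \<open>a ! (i - 1)\<close> and \<open>b\<^sub>j\<close> is \<open>b ! (j - 1)\<close>. Elements \<open>j\<close> of blocks are not shifted.
\<close>

type_synonym word = "nat list \<times> nat list"

definition words :: "nat \<Rightarrow> nat \<Rightarrow> word set" where
  "words n m = {(a, b). length a = m \<and> length b = n \<and> (\<forall>i\<in>set a \<union> set b. 1 \<le> i)}"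

definition word_val :: "word \<Rightarrow> ncseries" where
  "word_val = (\<lambda>(a, b). nc_prod (map nc_theta a @ map nc_x b))"

definition same_block :: "nat set list \<Rightarrow> nat \<Rightarrow> nat \<Rightarrow> bool" where
  "same_block K i j \<longleftrightarrow> (\<exists>B\<in>set K. i \<in> B \<and> j \<in> B)"

definition m_words :: "nat \<Rightarrow> nat \<Rightarrow> nat set list \<Rightarrow> word set" where
  "m_words n m K = {(a, b) \<in> words n m.
     (\<forall>i<m. \<forall>j\<in>{1..n}. a ! i = b ! (j - 1) \<longleftrightarrow> j \<in> K ! i - {0}) \<and>
     (\<forall>i\<in>{1..n}. \<forall>j\<in>{1..n}. b ! (i - 1) = b ! (j - 1) \<longleftrightarrow> same_block K i j)}"

definition p_words :: "nat \<Rightarrow> nat \<Rightarrow> nat set list \<Rightarrow> word set" where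
  "p_words n m K = {(a, b) \<in> words n m.
     (\<forall>i<m. \<forall>j\<in>K ! i - {0}. a ! i = b ! (j - 1)) \<and>
     (\<forall>i\<in>{1..n}. \<forall>j\<in>{1..n}. same_block K i j \<longrightarrow> b ! (i - 1) = b ! (j - 1))}"

definition e_words :: "nat \<Rightarrow> nat \<Rightarrow> nat set list \<Rightarrow> word set" where
  "e_words n m K = {(a, b) \<in> words n m.
     (\<forall>i<m. \<forall>j\<in>K ! i - {0}. a ! i \<noteq> b ! (j - 1)) \<and>
     (\<forall>i\<in>{1..n}. \<forall>j\<in>{1..n}. i \<noteq> j \<and> same_block K i j \<longrightarrow> b ! (i - 1) \<noteq> b ! (j - 1))}"

definition h_words :: "nat \<Rightarrow> nat \<Rightarrow> word set" where
  "h_words n m = {(a, b) \<in> words n m. distinct a \<and> card (set a - set b) \<le> 1}"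

definition word_type :: "nat \<Rightarrow> nat \<Rightarrow> word \<Rightarrow> nat set list" where
  "word_type n m u = (THE L. L \<in> set_supercomps n m \<and> u \<in> m_words n m L)"

definition nc_m :: "nat \<Rightarrow> nat \<Rightarrow> nat set list \<Rightarrow> ncseries" where
  "nc_m n m K = series_sum word_val (m_words n m K)"

definition nc_p :: "nat \<Rightarrow> nat \<Rightarrow> nat set list \<Rightarrow> ncseries" where
  "nc_p n m K = series_sum word_val (p_words n m K)"

definition nc_e :: "nat \<Rightarrow> nat \<Rightarrow> nat set list \<Rightarrow> ncseries" where
  "nc_e n m K = series_sum word_val (e_words n m K)"

definition nc_h :: "nat \<Rightarrow> nat \<Rightarrow> nat set list \<Rightarrow> ncseries" where
  "nc_h n m K = series_sum
     (\<lambda>u. scale (tuple_fact (meet n m K (word_type n m u))) (word_val u)) (h_words n m)"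

section \<open>The functions in commuting variables\<close>

text \<open>A superpartition \<open>\<Lambda>\<close> is the pair \<open>(\<Lambda>\<^sup>a, \<Lambda>\<^sup>s)\<close>.\<close>

type_synonym superpart = "nat list \<times> nat list"

definition superparts :: "nat \<Rightarrow> nat \<Rightarrow> superpart set" where
  "superparts n m = {(la, ls). length la = m \<and> sum_list la + sum_list ls = n \<and>
     sorted_wrt (>) la \<and> sorted_wrt (\<ge>) ls \<and> (\<forall>k\<in>set ls. 1 \<le> k)}"

definition superpart_fact :: "superpart \<Rightarrow> rat" where
  "superpart_fact = (\<lambda>(la, ls). \<Prod>k\<leftarrow>la @ ls. fact k)"

definition mult_fact :: "nat list \<Rightarrow> rat" where
  "mult_fact ls = (\<Prod>k\<in>set ls. fact (count_list ls k))"

text \<open>\<open>m_terms\<close> is a set of series, so equal terms count once in \<open>c_m\<close>.\<close>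

definition m_terms :: "superpart \<Rightarrow> cseries set" where
  "m_terms = (\<lambda>(la, ls).
     {c_prod (map c_theta (take (length la) is) @ map2 c_x_power is (la @ ls)) | is.
        length is = length (la @ ls) \<and> distinct is \<and> (\<forall>i\<in>set is. 1 \<le> i)})"

definition c_m :: "superpart \<Rightarrow> cseries" where
  "c_m \<Lambda> = series_sum (\<lambda>t. t) (m_terms \<Lambda>)"

text \<open>The subscripts \<open>a\<close> and \<open>s\<close> mark the fermionic (tilde) and the ordinary generators.\<close>

definition p_a :: "nat \<Rightarrow> cseries" where
  "p_a k = series_sum (\<lambda>i. c_mult (c_theta i) (c_x_power i k)) {1..}"

definition p_s :: "nat \<Rightarrow> cseries" where
  "p_s r = series_sum (\<lambda>i. c_x_power i r) {1..}"

definition e_a :: "nat \<Rightarrow> cseries" where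
  "e_a k = c_m ([0], replicate k 1)"

definition e_s :: "nat \<Rightarrow> cseries" where
  "e_s r = c_m ([], replicate r 1)"

definition h_a :: "nat \<Rightarrow> cseries" where
  "h_a k = series_sum (\<lambda>\<Omega>. scale (of_nat (hd (fst \<Omega>) + 1)) (c_m \<Omega>)) (superparts k 1)"

definition h_s :: "nat \<Rightarrow> cseries" where
  "h_s r = series_sum c_m (superparts r 0)"

definition c_p :: "superpart \<Rightarrow> cseries" where
  "c_p = (\<lambda>(la, ls). c_prod (map p_a la @ map p_s ls))"

definition c_e :: "superpart \<Rightarrow> cseries" where
  "c_e = (\<lambda>(la, ls). c_prod (map e_a la @ map e_s ls))"

definition c_h :: "superpart \<Rightarrow> cseries" where
  "c_h = (\<lambda>(la, ls). c_prod (map h_a la @ map h_s ls))"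

section \<open>The superpartition of a set superpartition\<close>

definition ferm_sizes :: "nat \<Rightarrow> nat set list \<Rightarrow> nat list" where
  "ferm_sizes m I = map (\<lambda>B. card B - 1) (take m I)"

definition shape :: "nat \<Rightarrow> nat set list \<Rightarrow> superpart" where
  "shape m I = (rev (sort (ferm_sizes m I)), rev (sort (map card (drop m I))))"

definition transp_step :: "('a list \<times> 'a list) set" where
  "transp_step = {(xs, xs[i := xs ! j, j := xs ! i]) | xs i j. i < j \<and> j < length xs}"

definition eps :: "nat \<Rightarrow> nat set list \<Rightarrow> nat" where
  "eps m I = (LEAST k. (ferm_sizes m I, fst (shape m I)) \<in> transp_step ^^ k)"

end

theory Submission
  imports Defs "HOL-Combinatorics.Multiset_Permutations" "HOL-Library.FuncSet"
begin

text \<open>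
  The coefficient of \<open>\<theta>\<^sub>S x\<^sup>M\<close> in the projection of a sum of words is a signed sum over the orderings
  \<open>a\<close> of \<open>S\<close> of the total weight of the words \<open>(a, b)\<close> with \<open>mset b = M\<close>. For \<open>p\<close>, \<open>e\<close> and \<open>h\<close> the
  weight is a product over the blocks, in which the factor of a block depends only on the multiset
  of letters at the positions of the block (and on \<open>a\<^sub>i\<close>, for the \<open>i\<close>th fermionic block); for \<open>h\<close>
  this holds because the blocks of a meet are the intersections of the blocks. So the projection is a product of one
  series for each block. As a multiset of size \<open>k\<close> has \<open>k!\<close> divided by the product of the
  factorials of its multiplicities as number of arrangements, this series is a multiple of a
  generator. For \<open>m\<close>, a word in \<open>M(K)\<close> is an assignment of distinct values to the blocks.
  In all cases the result is symmetric in the sizes of the nonfermionic blocks and alternating in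
  those of the fermionic ones. Hence it vanishes if two of the latter agree, and sorting them by
  \<open>k\<close> transpositions costs the sign \<open>(-1)\<^sup>k\<close>.
\<close>

section \<open>Signs of lists\<close>

text \<open>The positions of different blocks interleave, so a noncommuting function is not a
  product of one series per block, and \<open>rho_mult\<close> cannot be applied block by block.
  Only after \<open>rho\<close> does the place of a block become irrelevant; this is why everything
  is computed on coefficients. The factorials come from counting the arrangements of the letters of
  a block with k positions. For p the letters are equal: one arrangement, no factor. For e they are
  distinct: k! arrangements. For h the meet supplies the factorials of the multiplicities, which
  cancel the denominator of the multinomial coefficient and again leave k!. In a fermionic block the
  element 0 raises the factorial r! of the multiplicity of \<open>a ! i\<close> to (r+1)!, the
  origin of the coefficient \<Omega>_1 + 1 in the odd complete generators. For m there is no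
  product, since different blocks need different values. Its factor is the number of ways to
  distribute given values over nonfermionic blocks of equal size, all of which project to the same
  term.\<close>

primrec list_sign :: "nat list \<Rightarrow> rat" where
  "list_sign [] = 1"
| "list_sign (a # as) = (if a \<in> set as then 0 else (-1) ^ card {t \<in> set as. t < a} * list_sign as)"

lemma list_sign_eq_0: "\<not> distinct a \<Longrightarrow> list_sign a = 0"
  by (induction a) auto

lemma list_sign_neq_0: "distinct a \<Longrightarrow> list_sign a \<noteq> 0"
  by (induction a) auto

text \<open>\<open>list_sign a\<close> is the sign that brings the product of the \<theta>-variables
  with indices \<open>a\<close> into increasing order, and 0 if an index repeats. Exchanging two
  different neighbours adds or removes exactly the inversion between them.\<close>

lemma list_sign_swap_adjacent: "list_sign (p @ x # y # r) = - list_sign (p @ y # x # r)"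
proof (induction p)
  case Nil
  show ?case
  proof (cases "x = y \<or> x \<in> set r \<or> y \<in> set r")
    case False
    have card: "card {t \<in> set (y # r). t < x} = card {t \<in> set r. t < x} + (if y < x then 1 else 0)"
      if "y \<notin> set r" for x y r
    proof -
      have "{t \<in> set (y # r). t < x} = (if y < x then insert y {t \<in> set r. t < x} else {t \<in> set r. t < x})"
        by auto
      then show ?thesis using that by (simp only:) simp
    qed
    have "card {t \<in> set (y # r). t < x} = card {t \<in> set r. t < x} + (if y < x then 1 else 0)"
      "card {t \<in> set (x # r). t < y} = card {t \<in> set r. t < y} + (if x < y then 1 else 0)"
      using False by (simp_all only: card simp_thms de_Morgan_disj)
    then show ?thesis using False
      by (auto simp: power_add)
  qed auto
next
  case (Cons z p)
  have "insert x (insert y A) = insert y (insert x A)" for A by auto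
  with Cons show ?case by auto
qed

text \<open>Stated for any function on lists, because it is applied to \<open>list_sign\<close> and
  to coefficients as functions of the list of fermionic sizes. Moving \<open>x\<close> past
  \<open>z\<close>, exchanging across the shorter gap and moving \<open>y\<close> past
  \<open>z\<close> are three sign changes.\<close>

lemma alternating_swap:
  fixes T :: "'a list \<Rightarrow> rat"
  assumes adj: "\<And>p x y r. T (p @ x # y # r) = - T (p @ y # x # r)"
  shows "T (p @ x # q @ y # r) = - T (p @ y # q @ x # r)"
proof (induction q arbitrary: p)
  case (Cons z q)
  have "T (p @ x # (z # q) @ y # r) = - T ((p @ [z]) @ x # q @ y # r)"
    using adj[of p x z] by simp
  also have "\<dots> = T ((p @ [z]) @ y # q @ x # r)" by (simp only: Cons.IH minus_minus)
  also have "\<dots> = - T (p @ y # (z # q) @ x # r)" using adj[of p z y] by simp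
  finally show ?case .
next
  case Nil
  show ?case using adj[of p x y r] by simp
qed

lemma list_update_swap_split:
  assumes "i < j" "j < length xs"
  obtains p x q y r where "xs = p @ x # q @ y # r" "xs ! i = x" "xs ! j = y"
    "xs[i := xs ! j, j := xs ! i] = p @ y # q @ x # r"
proof -
  obtain p x s where s: "xs = p @ x # s" "length p = i"
    using assms by (metis id_take_nth_drop length_take min.absorb4 order.strict_trans)
  have "j - Suc i < length s" using assms s by simp
  then obtain q y r where r: "s = q @ y # r" "length q = j - Suc i"
    by (metis id_take_nth_drop length_take min.absorb4)
  have "j = Suc (i + (j - Suc i))" using assms by simp
  then obtain d where d: "j = Suc (i + d)" "length q = d" using r by simp
  have "xs ! i = x" "xs ! j = y" "xs[i := y, j := x] = p @ y # q @ x # r"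
    using s r(1) d by (simp_all add: nth_append list_update_append)
  with s r that[of p x q y r] show ?thesis by simp
qed

text \<open>Valid for every number \<open>k\<close> of exchanges that leads from one list to the
  other; the minimal number \<open>eps\<close> is one such \<open>k\<close>.\<close>

lemma alternating_relpow:
  fixes T :: "'a list \<Rightarrow> rat"
  assumes adj: "\<And>p x y r. T (p @ x # y # r) = - T (p @ y # x # r)"
    and "(xs, ys) \<in> transp_step ^^ k"
  shows "T xs = (-1) ^ k * T ys"
  using assms(2)
proof (induction k arbitrary: ys)
  case (Suc k)
  then obtain zs where zs: "(xs, zs) \<in> transp_step ^^ k" "(zs, ys) \<in> transp_step" by auto
  then obtain i j where ij: "i < j" "j < length zs" "ys = zs[i := zs ! j, j := zs ! i]"
    by (auto simp: transp_step_def)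
  obtain p x q y r where "zs = p @ x # q @ y # r" "ys = p @ y # q @ x # r"
    using list_update_swap_split[OF ij(1,2)] unfolding ij(3) by metis
  then have "T zs = - T ys" by (simp only: alternating_swap[of T p x q y r, OF adj])
  then show ?case using Suc.IH[OF zs(1)] by simp
qed simp

lemma alternating_eq_0:
  fixes T :: "'a list \<Rightarrow> rat"
  assumes adj: "\<And>p x y r. T (p @ x # y # r) = - T (p @ y # x # r)"
    and "i < j" "j < length xs" "xs ! i = xs ! j"
  shows "T xs = 0"
proof -
  obtain p x q r where "xs = p @ x # q @ x # r"
    using list_update_swap_split[OF assms(2,3)] assms(4) by metis
  then have "T xs = - T xs" using alternating_swap[of T p x q x r, OF adj] by (simp only:)
  then show ?thesis by simp
qed

section \<open>Sorting by transpositions\<close>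

lemma transp_step_Cons:
  assumes "(xs, ys) \<in> transp_step" shows "(x # xs, x # ys) \<in> transp_step"
proof -
  obtain i j where ij: "i < j" "j < length xs" "ys = xs[i := xs ! j, j := xs ! i]"
    using assms by (auto simp: transp_step_def)
  then have "Suc i < Suc j \<and> Suc j < length (x # xs) \<and>
      x # ys = (x # xs)[Suc i := (x # xs) ! Suc j, Suc j := (x # xs) ! Suc i]" by simp
  then show ?thesis unfolding transp_step_def by blast
qed

text \<open>Selection sort: at most one exchange brings the first target entry to the front, and the
  induction hypothesis sorts the tail.\<close>

lemma transp_steps_mset_eq:
  "mset xs = mset ys \<Longrightarrow> (xs, ys) \<in> transp_step\<^sup>*"
proof (induction ys arbitrary: xs)
  case (Cons y ys)
  have "y \<in> set xs" using Cons.prems by (metis list.set_intros(1) set_mset_mset)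
  then obtain j where j: "j < length xs" "xs ! j = y" by (auto simp: in_set_conv_nth)
  obtain zs where zs: "(xs, y # zs) \<in> transp_step\<^sup>*" "mset xs = mset (y # zs)"
  proof (cases j)
    case 0
    then show ?thesis using that[of "tl xs"] j by (cases xs) auto
  next
    case (Suc k)
    then obtain x xs' where xs: "xs = x # xs'" using j by (cases xs) auto
    have "(xs, xs[0 := xs ! j, j := xs ! 0]) \<in> transp_step"
      using j Suc unfolding transp_step_def by blast
    moreover have "xs[0 := xs ! j, j := xs ! 0] = y # xs'[k := x]"
      using j xs Suc by simp
    moreover have "mset (xs[0 := xs ! j, j := xs ! 0]) = mset xs"
      using j by (intro mset_swap) auto
    ultimately show ?thesis using that[of "xs'[k := x]"] by auto
  qed
  have "(zs, ys) \<in> transp_step\<^sup>*" using Cons.IH[of zs] Cons.prems zs(2) by simp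
  then have "(y # zs, y # ys) \<in> transp_step\<^sup>*"
    by (induction rule: rtrancl_induct) (auto intro: transp_step_Cons rtrancl.rtrancl_into_rtrancl)
  with zs(1) show ?case by simp
qed simp

text \<open>Some number of exchanges reaches the sorted list, so the \<open>LEAST\<close> is
  attained, which is the form that \<open>alternating_relpow\<close> consumes.\<close>

lemma eps_relpow: "(ferm_sizes m I, fst (shape m I)) \<in> transp_step ^^ eps m I"
proof -
  have "(ferm_sizes m I, fst (shape m I)) \<in> transp_step\<^sup>*"
    by (rule transp_steps_mset_eq) (simp add: shape_def)
  then show ?thesis unfolding eps_def by (meson LeastI_ex rtrancl_imp_relpow)
qed

text \<open>In a distinct list, exchanging two values amounts to exchanging their positions; with a
  repetition both signs are 0. This sign change drives the cancellation for h.\<close>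

lemma list_sign_map_transpose:
  assumes "u \<in> set a" "v \<in> set a" "u \<noteq> v"
  shows "list_sign (map (transpose u v) a) = - list_sign a"
proof (cases "distinct a")
  case True
  have swap: "list_sign (map (transpose x y) (p @ x # q @ y # r)) = - list_sign (p @ x # q @ y # r)"
    if "distinct (p @ x # q @ y # r)" for p x q y r
  proof -
    have id: "map (transpose x y) zs = zs" if "x \<notin> set zs" "y \<notin> set zs" for zs
      using that by (induction zs) auto
    have "map (transpose x y) (p @ x # q @ y # r) = p @ y # q @ x # r"
      using that by (simp add: id)
    then show ?thesis using alternating_swap[of list_sign p y q x r, OF list_sign_swap_adjacent] by simp
  qed
  obtain i j where ij: "i < length a" "j < length a" "a ! i = u" "a ! j = v"
    using assms by (metis in_set_conv_nth)
  then consider "i < j" | "j < i" using assms(3) by fastforce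
  then show ?thesis
  proof cases
    case 1
    then obtain p q r where "a = p @ u # q @ v # r"
      using list_update_swap_split[of i j a] ij by metis
    with swap True show ?thesis by metis
  next
    case 2
    then obtain p q r where "a = p @ v # q @ u # r"
      using list_update_swap_split[of j i a] ij by metis
    with swap True show ?thesis by (metis transpose_commute)
  qed
next
  case False
  then have "\<not> distinct (map (transpose u v) a)"
    by (simp add: distinct_map)
  with False show ?thesis by (simp add: list_sign_eq_0)
qed

section \<open>Series as signed sums over lists of indices\<close>

text \<open>Repetitions are allowed, since such lists contribute 0 to \<open>alt_sum\<close> through
  \<open>list_sign\<close>. For infinite \<open>S\<close> there are no lists at all, so the
  coefficient is 0.\<close>

definition theta_lists :: "nat set \<Rightarrow> nat \<Rightarrow> nat list set" where
  "theta_lists S m = {a. set a = S \<and> length a = m}"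

definition alt_sum :: "nat \<Rightarrow> (nat list \<Rightarrow> 'w \<Rightarrow> rat) \<Rightarrow> 'w series" where
  "alt_sum m \<Phi> = (\<lambda>S w. \<Sum>a\<in>theta_lists S m. list_sign a * \<Phi> a w)"

lemma finite_theta_lists [simp]: "finite (theta_lists S m)"
proof (cases "finite S")
  case True
  have "theta_lists S m \<subseteq> {a. set a \<subseteq> S \<and> length a = m}" by (auto simp: theta_lists_def)
  then show ?thesis using finite_lists_length_eq[OF True] finite_subset by blast
next
  case False
  then have "theta_lists S m = {}" by (auto simp: theta_lists_def)
  then show ?thesis by simp
qed

lemma alt_sum_scale: "alt_sum m (\<lambda>a w. c * \<Phi> a w) = scale c (alt_sum m \<Phi>)"
  by (simp add: alt_sum_def scale_def sum_distrib_left mult.left_commute)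

lemma alt_sum_cong:
  assumes "\<And>S a w. length a = m \<Longrightarrow> distinct a \<Longrightarrow> \<Phi> a w = \<Psi> a w"
  shows "alt_sum m \<Phi> = alt_sum m \<Psi>"
  unfolding alt_sum_def
  by (intro ext sum.cong refl) (use assms list_sign_eq_0 in \<open>auto simp: theta_lists_def\<close>)

lemma inversions_singleton: "inversions {i} T = card {t \<in> T. t < i}"
proof -
  have "{(t, u). t \<in> {i} \<and> u \<in> T \<and> u < t} = Pair i ` {t \<in> T. t < i}" by auto
  then show ?thesis unfolding inversions_def by (simp add: card_image inj_on_def)
qed

lemma series_mult_scale_right: "series_mult mul f (scale c g) = scale c (series_mult mul f g)"
  by (intro ext) (simp add: series_mult_def scale_def sum_distrib_left case_prod_unfold mult.assoc mult.left_commute)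

text \<open>Putting \<theta>_i in front costs one sign for each smaller remaining index, which is
  the recursion of \<open>list_sign\<close>. The product of x-monomials is a parameter, so that
  words and multisets are covered at once.\<close>

lemma foldr_theta:
  assumes fin: "\<And>w. finite {(u, v). mul u v = w}" and unit: "\<And>w. mul e w = w"
  shows "foldr (series_mult mul) (map (\<lambda>i. monomial {i} e) a) (monomial {} w) =
    scale (list_sign a) (monomial (set a) w)"
proof (induction a)
  case (Cons i a)
  have "foldr (series_mult mul) (map (\<lambda>i. monomial {i} e) (i # a)) (monomial {} w) =
      scale (list_sign a) (series_mult mul (monomial {i} e) (monomial (set a) w))"
    by (simp add: Cons series_mult_scale_right)
  also have "\<dots> = scale (list_sign (i # a)) (monomial (set (i # a)) w)"
    by (intro ext) (simp add: series_mult_monomial[OF fin] unit inversions_singleton scale_def zero_series_def)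
  finally show ?case .
qed (simp add: scale_def)

lemma nc_prod_x: "nc_prod (map nc_x b) = monomial {} b"
  by (induction b)
    (simp_all add: nc_prod_def nc_mult_def nc_x_def series_mult_monomial[OF finite_append_eq] scale_def)

lemma word_val_eq: "word_val (a, b) = scale (list_sign a) (monomial (set a) b)"
proof -
  have "word_val (a, b) = foldr nc_mult (map nc_theta a) (nc_prod (map nc_x b))"
    by (simp add: word_val_def nc_prod_def)
  then show ?thesis
    unfolding nc_prod_x nc_mult_def nc_theta_def[abs_def]
    by (simp add: foldr_theta[of "(@)" "[]", OF finite_append_eq])
qed

lemma c_x_power_eq: "c_x_power i k = monomial {} (replicate_mset k i)"
  by (induction k)
    (simp_all add: c_x_power_def c_prod_def c_mult_def c_x_def series_mult_monomial[OF finite_plus_eq] scale_def)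

definition powers_mset :: "nat list \<Rightarrow> nat list \<Rightarrow> nat multiset" where
  "powers_mset is es = (\<Sum>(i, e)\<leftarrow>zip is es. replicate_mset e i)"

lemma c_term_eq:
  "c_prod (map c_theta a @ map2 c_x_power is es) = scale (list_sign a) (monomial (set a) (powers_mset is es))"
proof -
  have "c_prod (map2 c_x_power is es) = monomial {} (powers_mset is es)"
  proof (induction "is" es rule: list_induct2')
    case (4 i "is" e es)
    then show ?case
      by (simp add: powers_mset_def c_prod_def c_mult_def c_x_power_eq
          series_mult_monomial[OF finite_plus_eq] scale_def)
  qed (simp_all add: powers_mset_def c_prod_def)
  moreover have "c_prod (map c_theta a @ map2 c_x_power is es) =
      foldr c_mult (map c_theta a) (c_prod (map2 c_x_power is es))"
    by (simp add: c_prod_def)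
  ultimately show ?thesis
    unfolding c_mult_def c_theta_def[abs_def]
    by (simp add: foldr_theta[of "(+)" "{#}", OF finite_plus_eq])
qed

text \<open>For a fixed normal form only the words contribute whose x-part is \<open>w\<close> and
  whose \<theta>-part orders \<open>S\<close>, so each coefficient is a finite signed sum. The
  weight \<open>c\<close> is 1 for m, p and e, and the factorial of the meet for h.\<close>

lemma rho_weighted_words:
  assumes X: "X \<subseteq> words n m"
  shows "rho (series_sum (\<lambda>u. scale (c u) (word_val u)) X) =
    alt_sum m (\<lambda>a M. \<Sum>b\<in>{b. mset b = M}. if (a, b) \<in> X then c (a, b) else 0)"
proof (intro ext)
  fix S M
  have inner: "series_sum (\<lambda>u. scale (c u) (word_val u)) X S w =
      (\<Sum>a\<in>theta_lists S m. list_sign a * (if (a, w) \<in> X then c (a, w) else 0))" for w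
  proof -
    let ?F = "\<lambda>u. scale (c u) (word_val u) S w"
    let ?A = "{a \<in> theta_lists S m. (a, w) \<in> X}"
    have "series_sum (\<lambda>u. scale (c u) (word_val u)) X S w = (\<Sum>u\<in>{u \<in> X. ?F u \<noteq> 0}. ?F u)"
      by (simp add: series_sum_def)
    also have "\<dots> = (\<Sum>u\<in>(\<lambda>a. (a, w)) ` ?A. ?F u)"
    \<comment> \<open>\<open>?A\<close> also contains lists with repetitions; their terms
      vanish.\<close>
    proof (rule sum.mono_neutral_left)
      show "{u \<in> X. ?F u \<noteq> 0} \<subseteq> (\<lambda>a. (a, w)) ` ?A"
      proof
        fix u assume u: "u \<in> {u \<in> X. ?F u \<noteq> 0}"
        obtain a b where ab: "u = (a, b)" by (cases u)
        then have "set a = S" "b = w" "(a, w) \<in> X"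
          using u by (auto simp: word_val_eq scale_def monomial_def split: if_splits)
        moreover have "length a = m" using X \<open>(a, w) \<in> X\<close> by (auto simp: words_def)
        ultimately show "u \<in> (\<lambda>a. (a, w)) ` ?A" using ab by (auto simp: theta_lists_def)
      qed
    qed auto
    also have "\<dots> = (\<Sum>a\<in>?A. ?F (a, w))"
      by (simp add: sum.reindex inj_on_def)
    also have "\<dots> = (\<Sum>a\<in>?A. list_sign a * c (a, w))"
      by (intro sum.cong) (auto simp: theta_lists_def word_val_eq scale_def monomial_def)
    also have "\<dots> = (\<Sum>a\<in>theta_lists S m. list_sign a * (if (a, w) \<in> X then c (a, w) else 0))"
      by (intro sum.mono_neutral_cong_left) auto
    finally show ?thesis .
  qed
  show "rho (series_sum (\<lambda>u. scale (c u) (word_val u)) X) S M =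
    alt_sum m (\<lambda>a M. \<Sum>b\<in>{b. mset b = M}. if (a, b) \<in> X then c (a, b) else 0) S M"
    unfolding rho_def inner alt_sum_def sum_distrib_left by (rule sum.swap)
qed

section \<open>Products of commuting series\<close>

text \<open>The Cauchy product in the commuting x-variables, to which \<open>c_mult\<close> reduces
  when no \<theta> is present.\<close>

definition conv :: "(nat multiset \<Rightarrow> rat) \<Rightarrow> (nat multiset \<Rightarrow> rat) \<Rightarrow> nat multiset \<Rightarrow> rat" where
  "conv f g = (\<lambda>M. \<Sum>(u, v)\<in>{(u, v). u + v = M}. f u * g v)"

definition conv_list :: "(nat multiset \<Rightarrow> rat) list \<Rightarrow> nat multiset \<Rightarrow> rat" where
  "conv_list fs = foldr conv fs (\<lambda>M. if M = {#} then 1 else 0)"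

text \<open>Homogeneous of degree one in \<theta>: \<open>f i\<close> is the coefficient of
  \<theta>_i. The tilde generators have this form, and the ordinary ones have the form
  \<open>even_series\<close>.\<close>

definition odd_series :: "(nat \<Rightarrow> nat multiset \<Rightarrow> rat) \<Rightarrow> cseries" where
  "odd_series f = (\<lambda>S M. if is_singleton S then f (the_elem S) M else 0)"

definition even_series :: "(nat multiset \<Rightarrow> rat) \<Rightarrow> cseries" where
  "even_series g = (\<lambda>S M. if S = {} then g M else 0)"

lemma conv_list_simps [simp]:
  "conv_list [] = (\<lambda>M. if M = {#} then 1 else 0)"
  "conv_list (f # fs) = conv f (conv_list fs)"
  by (simp_all add: conv_list_def)

text \<open>Both sides are the sum over triples with \<open>u + v + w = M\<close>. Left
  commutativity is what makes a fold independent of the order of its factors.\<close>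

lemma conv_left_commute: "conv f (conv g h) = conv g (conv f h)"
proof -
  have 3: "conv f (conv g h) M = (\<Sum>(u, v, w)\<in>{(u, v, w). u + v + w = M}. f u * g v * h w)" for f g h M
  proof -
    have "conv f (conv g h) M =
        (\<Sum>x\<in>{(u, v). u + v = M}. \<Sum>y\<in>{(v, w). v + w = snd x}. f (fst x) * g (fst y) * h (snd y))"
      by (simp add: conv_def case_prod_unfold sum_distrib_left mult.assoc)
    also have "\<dots> = (\<Sum>(x, y)\<in>(SIGMA x:{(u, v). u + v = M}. {(v, w). v + w = snd x}).
        f (fst x) * g (fst y) * h (snd y))"
      by (subst sum.Sigma) (auto simp: finite_plus_eq)
    also have "\<dots> = (\<Sum>(u, v, w)\<in>{(u, v, w). u + v + w = M}. f u * g v * h w)"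
      by (rule sum.reindex_bij_witness[where i = "\<lambda>(u, v, w). ((u, v + w), (v, w))"
            and j = "\<lambda>((u, _), (v, w)). (u, v, w)"]) (auto simp: add.assoc)
    finally show ?thesis .
  qed
  show ?thesis
  proof
    fix M
    show "conv f (conv g h) M = conv g (conv f h) M"
      unfolding 3
      by (rule sum.reindex_bij_witness[where i = "\<lambda>(u, v, w). (v, u, w)"
            and j = "\<lambda>(u, v, w). (v, u, w)"]) (auto simp: ac_simps)
  qed
qed

lemma conv_list_mset_cong:
  assumes "mset fs = mset gs" shows "conv_list fs = conv_list gs"
proof -
  have "fold conv (rev fs) = fold conv (rev gs)"
    by (rule fold_multiset_equiv) (use assms in \<open>auto simp: fun_eq_iff conv_left_commute\<close>)
  then show ?thesis by (simp add: conv_list_def foldr_conv_fold)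
qed

lemma conv_scale: "conv (\<lambda>M. c * f M) (\<lambda>M. d * g M) = (\<lambda>M. c * d * conv f g M)"
  by (simp add: conv_def case_prod_unfold sum_distrib_left ac_simps)

lemma conv_list_scale:
  "length cs = length fs \<Longrightarrow>
    conv_list (map2 (\<lambda>c f M. c * f M) cs fs) = (\<lambda>M. prod_list cs * conv_list fs M)"
proof (induction cs fs rule: list_induct2)
  case (Cons c cs f fs)
  then show ?case by (simp add: conv_scale)
qed simp

lemma c_mult_even: "c_mult (even_series g) (even_series h) = even_series (conv g h)"
proof (intro ext)
  fix S M
  show "c_mult (even_series g) (even_series h) S M = even_series (conv g h) S M"
  proof (cases "S = {}")
    case False
    then have "T \<noteq> {} \<or> S - T \<noteq> {}" if "T \<subseteq> S" for T using that by auto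
    then show ?thesis using False
      unfolding c_mult_def series_mult_def even_series_def
      by (auto intro!: sum.neutral split: if_splits)
  qed (simp add: c_mult_def series_mult_def even_series_def conv_def)
qed

lemma c_prod_even: "c_prod (map even_series gs) = even_series (conv_list gs)"
proof (induction gs)
  case (Cons g gs)
  then show ?case by (simp add: c_prod_def c_mult_even del: conv_list_simps(1))
qed (auto simp: c_prod_def monomial_def even_series_def fun_eq_iff)

text \<open>Only singletons \<open>T\<close> contribute, and the sign that remains is the head
  factor in the recursion of \<open>list_sign\<close>.\<close>

lemma c_mult_odd:
  assumes "finite S"
  shows "c_mult (odd_series f) z S M =
    (\<Sum>i\<in>S. (-1) ^ card {t \<in> S - {i}. t < i} * conv (f i) (z (S - {i})) M)"
proof -
  let ?s = "\<lambda>T. \<Sum>(u, v)\<in>{(u, v). u + v = M}. (-1) ^ inversions T (S - T) * odd_series f T u * z (S - T) v"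
  have "c_mult (odd_series f) z S M = (\<Sum>T\<in>Pow S. ?s T)"
    by (simp add: c_mult_def series_mult_def)
  also have "\<dots> = (\<Sum>T\<in>(\<lambda>i. {i}) ` S. ?s T)"
    by (rule sum.mono_neutral_right)
      (use assms in \<open>auto simp: odd_series_def is_singleton_def intro!: sum.neutral\<close>)
  also have "\<dots> = (\<Sum>i\<in>S. ?s {i})" by (simp add: sum.reindex)
  also have "\<dots> = (\<Sum>i\<in>S. (-1) ^ card {t \<in> S - {i}. t < i} * conv (f i) (z (S - {i})) M)"
    by (intro sum.cong refl)
      (simp add: inversions_singleton odd_series_def conv_def sum_distrib_left case_prod_unfold mult.assoc)
  finally show ?thesis .
qed

text \<open>Each odd factor picks an index of \<open>S\<close> and puts it in front of the list, so
  the signs of \<open>c_mult_odd\<close> accumulate to \<open>list_sign\<close>. Thus a product of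
  generators takes the same form as the projection of a sum of words in
  \<open>rho_weighted_words\<close>.\<close>

lemma c_prod_odd_even:
  "c_prod (map odd_series fs @ map even_series gs) =
    alt_sum (length fs) (\<lambda>a. conv_list (map2 (\<lambda>f i. f i) fs a @ gs))"
proof (induction fs)
  case Nil
  have "theta_lists S 0 = (if S = {} then {[]} else {})" for S by (auto simp: theta_lists_def)
  moreover have "c_prod (map odd_series [] @ map even_series gs) = even_series (conv_list gs)"
    by (simp add: c_prod_even)
  ultimately show ?case by (intro ext) (simp add: alt_sum_def even_series_def[of "conv_list gs"])
next
  case (Cons f fs)
  show ?case
  proof (intro ext)
    fix S M
    let ?z = "c_prod (map odd_series fs @ map even_series gs)"
    let ?C = "\<lambda>a. conv_list (map2 (\<lambda>f i. f i) fs a @ gs)"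
    have prod: "c_prod (map odd_series (f # fs) @ map even_series gs) = c_mult (odd_series f) ?z"
      by (simp add: c_prod_def)
    show "c_prod (map odd_series (f # fs) @ map even_series gs) S M =
      alt_sum (length (f # fs)) (\<lambda>a. conv_list (map2 (\<lambda>f i. f i) (f # fs) a @ gs)) S M"
    proof (cases "finite S")
      case True
      have "c_mult (odd_series f) ?z S M =
          (\<Sum>i\<in>S. \<Sum>a\<in>theta_lists (S - {i}) (length fs). list_sign (i # a) * conv (f i) (?C a) M)"
        unfolding c_mult_odd[OF True] Cons
      proof (intro sum.cong refl)
        fix i
        have "conv (f i) (alt_sum (length fs) ?C (S - {i})) M =
            (\<Sum>a\<in>theta_lists (S - {i}) (length fs). list_sign a * conv (f i) (?C a) M)"
        proof -
          have "conv (f i) (alt_sum (length fs) ?C (S - {i})) M = (\<Sum>x\<in>{(u, v). u + v = M}.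
              \<Sum>a\<in>theta_lists (S - {i}) (length fs). f i (fst x) * (list_sign a * ?C a (snd x)))"
            by (simp only: conv_def alt_sum_def case_prod_unfold sum_distrib_left)
          also have "\<dots> = (\<Sum>a\<in>theta_lists (S - {i}) (length fs).
              \<Sum>x\<in>{(u, v). u + v = M}. f i (fst x) * (list_sign a * ?C a (snd x)))"
            by (rule sum.swap)
          also have "\<dots> = (\<Sum>a\<in>theta_lists (S - {i}) (length fs). list_sign a * conv (f i) (?C a) M)"
            by (simp add: conv_def case_prod_unfold sum_distrib_left mult.left_commute)
          finally show ?thesis .
        qed
        then show "(-1) ^ card {t \<in> S - {i}. t < i} * conv (f i) (alt_sum (length fs) ?C (S - {i})) M =
            (\<Sum>a\<in>theta_lists (S - {i}) (length fs). list_sign (i # a) * conv (f i) (?C a) M)"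
          by (simp add: sum_distrib_left) (intro sum.cong refl, auto simp: theta_lists_def)
      qed
      also have "\<dots> = (\<Sum>(i, a)\<in>(SIGMA i:S. theta_lists (S - {i}) (length fs)).
          list_sign (i # a) * conv (f i) (?C a) M)"
        using True by (subst sum.Sigma) auto
      also have "\<dots> = (\<Sum>a\<in>(\<lambda>(i, a). i # a) ` (SIGMA i:S. theta_lists (S - {i}) (length fs)).
          list_sign a * conv_list (map2 (\<lambda>f i. f i) (f # fs) a @ gs) M)"
        by (subst sum.reindex) (auto simp: inj_on_def case_prod_unfold)
      also have "\<dots> = alt_sum (length (f # fs)) (\<lambda>a. conv_list (map2 (\<lambda>f i. f i) (f # fs) a @ gs)) S M"
        unfolding alt_sum_def
      proof (rule sum.mono_neutral_left)
        show "\<forall>a\<in>theta_lists S (length (f # fs)) - (\<lambda>(i, a). i # a) ` (SIGMA i:S. theta_lists (S - {i}) (length fs)).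
            list_sign a * conv_list (map2 (\<lambda>f i. f i) (f # fs) a @ gs) M = 0"
        proof
          fix a
          assume a: "a \<in> theta_lists S (length (f # fs)) - (\<lambda>(i, a). i # a) ` (SIGMA i:S. theta_lists (S - {i}) (length fs))"
          then obtain i a' where ia: "a = i # a'" by (cases a) (auto simp: theta_lists_def)
          \<comment> \<open>A list outside the image repeats its head, so its sign is 0.\<close>
          have "i \<in> set a'"
          proof (rule ccontr)
            assume "i \<notin> set a'"
            then have "(i, a') \<in> (SIGMA i:S. theta_lists (S - {i}) (length fs))"
              using a ia by (auto simp: theta_lists_def)
            then show False using a ia by (auto simp: image_iff)
          qed
          then show "list_sign a * conv_list (map2 (\<lambda>f i. f i) (f # fs) a @ gs) M = 0"
            using ia by simp
        qed
        show "(\<lambda>(i, a). i # a) ` (SIGMA i:S. theta_lists (S - {i}) (length fs)) \<subseteq> theta_lists S (length (f # fs))"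
        proof clarify
          fix i a assume "i \<in> S" "a \<in> theta_lists (S - {i}) (length fs)"
          then show "i # a \<in> theta_lists S (length (f # fs))"
            by (simp add: theta_lists_def insert_absorb)
        qed
      qed simp
      finally show ?thesis unfolding prod .
    next
      case False
      \<comment> \<open>At an infinite \<open>S\<close> the product is 0 too, being a sum over the
        infinite set \<open>Pow S\<close>.\<close>
      then have "theta_lists S k = {}" for k by (auto simp: theta_lists_def)
      with False show ?thesis unfolding prod
        by (simp add: c_mult_def series_mult_def alt_sum_def finite_Pow_iff)
    qed
  qed
qed

section \<open>Permuting the parts\<close>

text \<open>\<open>\<Psi>\<close> sees only the multiset of pairs of a size and an index, so an
  exchange of two sizes is undone by exchanging the corresponding entries of \<open>a\<close>. This
  exchange \<open>sw\<close> is an involution and reverses \<open>list_sign\<close>.\<close>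

lemma alt_sum_swap_adjacent:
  fixes \<Psi> :: "(nat \<times> nat) multiset \<Rightarrow> 'w \<Rightarrow> rat"
  defines "T \<equiv> \<lambda>la. alt_sum (length la) (\<lambda>a. \<Psi> (mset (zip la a)))"
  shows "T (p @ x # y # r) S w = - T (p @ y # x # r) S w"
proof -
  define sw where "sw = (\<lambda>a :: nat list. take (length p) a @ a ! Suc (length p) # a ! length p # drop (Suc (Suc (length p))) a)"
  let ?m = "length p + Suc (Suc (length r))"
  have split: "\<exists>q u v s. a = q @ u # v # s \<and> length q = length p \<and> length s = length r"
    if "length a = ?m" for a :: "nat list"
  proof -
    have "a = take (length p) a @ a ! length p # a ! Suc (length p) # drop (Suc (Suc (length p))) a"
      using that by (simp add: Cons_nth_drop_Suc)
    moreover have "length (take (length p) a) = length p" "length (drop (Suc (Suc (length p))) a) = length r"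
      using that by simp_all
    ultimately show ?thesis by metis
  qed
  have sw: "sw (q @ u # v # s) = q @ v # u # s" if "length q = length p" for q u v s
    using that by (simp add: sw_def nth_append)
  have "T (p @ x # y # r) S w = (\<Sum>a\<in>theta_lists S ?m. list_sign a * \<Psi> (mset (zip (p @ x # y # r) a)) w)"
    by (simp add: T_def alt_sum_def)
  also have "\<dots> = (\<Sum>a\<in>theta_lists S ?m. - (list_sign a * \<Psi> (mset (zip (p @ y # x # r) a)) w))"
  proof (rule sum.reindex_bij_witness[where i = sw and j = sw])
    fix a assume "a \<in> theta_lists S ?m"
    then have a: "length a = ?m" "set a = S" by (auto simp: theta_lists_def)
    then obtain q u v s where q: "a = q @ u # v # s" "length q = length p" "length s = length r"
      using split by blast
    show "sw (sw a) = a" "sw a \<in> theta_lists S ?m"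
      using a q by (auto simp: sw theta_lists_def)
    have "list_sign a = - list_sign (sw a)" using q by (simp add: sw list_sign_swap_adjacent[of q u v s])
    moreover have "mset (zip (p @ x # y # r) a) = mset (zip (p @ y # x # r) (sw a))"
      using q by (simp add: sw add_mset_commute)
    ultimately show "- (list_sign (sw a) * \<Psi> (mset (zip (p @ y # x # r) (sw a))) w) =
        list_sign a * \<Psi> (mset (zip (p @ x # y # r) a)) w" by simp
  qed (use split sw in \<open>(force simp: theta_lists_def)+\<close>)
  also have "\<dots> = - T (p @ y # x # r) S w"
    by (simp add: T_def alt_sum_def sum_negf)
  finally show ?thesis .
qed

text \<open>Applied to \<open>m_series\<close> for m and to block series for p, e and h. Equal
  cardinalities give equal entries of \<open>ferm_sizes\<close>, where an alternating function
  vanishes.\<close>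

lemma alternating_series_shape:
  fixes T :: "nat list \<Rightarrow> nat list \<Rightarrow> cseries"
  assumes adj: "\<And>p x y r ls S w. T (p @ x # y # r) ls S w = - T (p @ y # x # r) ls S w"
    and perm: "\<And>la ls ls'. mset ls = mset ls' \<Longrightarrow> T la ls = T la ls'"
    and m: "m \<le> length I"
  shows "T (ferm_sizes m I) (map card (drop m I)) =
      scale ((-1) ^ eps m I) (T (fst (shape m I)) (snd (shape m I)))"
    and "i < m \<Longrightarrow> j < m \<Longrightarrow> i \<noteq> j \<Longrightarrow> card (I ! i) = card (I ! j) \<Longrightarrow>
      T (ferm_sizes m I) (map card (drop m I)) = zero_series"
proof -
  let ?ls = "map card (drop m I)"
  have "T (ferm_sizes m I) ?ls S w = (-1) ^ eps m I * T (fst (shape m I)) ?ls S w" for S w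
    by (rule alternating_relpow[of "\<lambda>la. T la ?ls S w", OF _ eps_relpow]) (rule adj)
  moreover have "T (fst (shape m I)) ?ls = T (fst (shape m I)) (snd (shape m I))"
    by (rule perm) (simp add: shape_def)
  ultimately show "T (ferm_sizes m I) ?ls = scale ((-1) ^ eps m I) (T (fst (shape m I)) (snd (shape m I)))"
    by (simp add: scale_def fun_eq_iff)
  have *: "T (ferm_sizes m I) ?ls = zero_series"
    if "i < j" "j < m" "card (I ! i) = card (I ! j)" for i j
  proof (intro ext)
    fix S w
    have "T (ferm_sizes m I) ?ls S w = 0"
      by (rule alternating_eq_0[of "\<lambda>la. T la ?ls S w", OF adj that(1)])
        (use that m in \<open>simp_all add: ferm_sizes_def\<close>)
    then show "T (ferm_sizes m I) ?ls S w = zero_series S w" by (simp add: zero_series_def)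
  qed
  show "i < m \<Longrightarrow> j < m \<Longrightarrow> i \<noteq> j \<Longrightarrow> card (I ! i) = card (I ! j) \<Longrightarrow> T (ferm_sizes m I) ?ls = zero_series"
    using *[of i j] *[of j i] by (metis linorder_neqE_nat)
qed

section \<open>Distributing words over blocks\<close>

text \<open>Words viewed as functions on positions: unlike lists, these can be restricted to a
  block, and extensionality makes gluing the restrictions a bijection.\<close>

definition funs_onto :: "'b set \<Rightarrow> nat multiset \<Rightarrow> ('b \<Rightarrow> nat) set" where
  "funs_onto X M = {f \<in> X \<rightarrow>\<^sub>E UNIV. image_mset f (mset_set X) = M}"

text \<open>The multinomial coefficient of \<open>M\<close>, and 0 unless \<open>size M = k\<close>.
  Through the second case the factor also enforces the size of the block.\<close>

definition arrangements :: "nat \<Rightarrow> nat multiset \<Rightarrow> rat" where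
  "arrangements k M = of_nat (card {ys. length ys = k \<and> mset ys = M})"

lemma finite_funs_onto: "finite X \<Longrightarrow> finite (funs_onto X M)"
proof (rule finite_subset)
  assume "finite X"
  then show "funs_onto X M \<subseteq> X \<rightarrow>\<^sub>E set_mset M"
    by (auto simp: funs_onto_def PiE_iff extensional_def)
  show "finite (X \<rightarrow>\<^sub>E set_mset M)" using \<open>finite X\<close> by (intro finite_PiE) auto
qed

lemma image_mset_cong_set: "(\<And>x. x \<in> X \<Longrightarrow> f x = g x) \<Longrightarrow> image_mset f (mset_set X) = image_mset g (mset_set X)"
  by (cases "finite X") (auto intro!: image_mset_cong)

text \<open>A function on the union is a pair of restrictions, grouped here by their multisets of
  values. As \<open>g\<close> sees only the multiset on \<open>B\<close>, the number of functions on
  \<open>B\<close> with this multiset comes out as a factor.\<close>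

lemma sum_funs_onto_Un:
  fixes B R :: "'b set"
  assumes fin: "finite B" "finite R" and disj: "B \<inter> R = {}"
  shows "(\<Sum>f\<in>funs_onto (B \<union> R) M. g (image_mset f (mset_set B)) * k (restrict f R)) =
    conv (\<lambda>M. of_nat (card (funs_onto B M)) * g M) (\<lambda>M. \<Sum>f\<in>funs_onto R M. k f) M"
proof -
  have ms: "mset_set (B \<union> R) = mset_set B + mset_set R"
    using assms by (rule mset_set_Union)
  let ?S = "SIGMA (u, v):{(u, v). u + v = M}. funs_onto B u \<times> funs_onto R v"
  define J :: "('b \<Rightarrow> nat) \<Rightarrow> (nat multiset \<times> nat multiset) \<times> ('b \<Rightarrow> nat) \<times> ('b \<Rightarrow> nat)" where
    "J f = ((image_mset f (mset_set B), image_mset f (mset_set R)), restrict f B, restrict f R)" for f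
  define I :: "(nat multiset \<times> nat multiset) \<times> ('b \<Rightarrow> nat) \<times> ('b \<Rightarrow> nat) \<Rightarrow> 'b \<Rightarrow> nat" where
    "I x = (\<lambda>y\<in>B \<union> R. if y \<in> B then fst (snd x) y else snd (snd x) y)" for x
  have "(\<Sum>f\<in>funs_onto (B \<union> R) M. g (image_mset f (mset_set B)) * k (restrict f R)) =
      (\<Sum>((u, v), f, h)\<in>?S. g u * k h)"
  proof (rule sum.reindex_bij_witness[where j = J and i = I])
    fix f assume f: "f \<in> funs_onto (B \<union> R) M"
    show "I (J f) = f"
      using f by (auto simp: I_def J_def funs_onto_def fun_eq_iff PiE_iff extensional_def)
    have "image_mset (restrict f B) (mset_set B) = image_mset f (mset_set B)"
      "image_mset (restrict f R) (mset_set R) = image_mset f (mset_set R)"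
      by (auto intro!: image_mset_cong_set)
    then show "J f \<in> ?S" using f by (auto simp: J_def funs_onto_def ms)
    show "(\<lambda>((u, v), f, h). g u * k h) (J f) = g (image_mset f (mset_set B)) * k (restrict f R)"
      by (simp add: J_def)
  next
    fix b assume "b \<in> ?S"
    then obtain u v f h where b: "b = ((u, v), f, h)" "u + v = M" "f \<in> funs_onto B u" "h \<in> funs_onto R v"
      by auto
    have "image_mset (I b) (mset_set B) = image_mset f (mset_set B)"
      "image_mset (I b) (mset_set R) = image_mset h (mset_set R)"
      using disj by (auto simp: I_def b(1) intro!: image_mset_cong_set)
    then have im: "image_mset (I b) (mset_set B) = u" "image_mset (I b) (mset_set R) = v"
      using b by (auto simp: funs_onto_def)
    have "restrict (I b) B = f" "restrict (I b) R = h"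
      using b disj by (auto simp: I_def funs_onto_def fun_eq_iff PiE_iff extensional_def)
    with im show "J (I b) = b" by (simp add: J_def b(1))
    show "I b \<in> funs_onto (B \<union> R) M"
      using im b(2) by (simp add: funs_onto_def ms I_def)
  qed
  also have "\<dots> = (\<Sum>x\<in>{(u, v). u + v = M}. \<Sum>(f, h)\<in>funs_onto B (fst x) \<times> funs_onto R (snd x). g (fst x) * k h)"
    using finite_funs_onto fin
    by (subst sum.Sigma) (auto simp: finite_plus_eq[unfolded case_prod_unfold] case_prod_unfold)
  also have "\<dots> = conv (\<lambda>M. of_nat (card (funs_onto B M)) * g M) (\<lambda>M. \<Sum>f\<in>funs_onto R M. k f) M"
    unfolding conv_def
    by (intro sum.cong refl) (auto simp: sum.cartesian_product[symmetric] sum_distrib_left mult.assoc)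
  finally show ?thesis .
qed

lemma sum_funs_onto_blocks:
  assumes "\<forall>B\<in>set Bs. finite B" "sorted_wrt (\<lambda>A B. A \<inter> B = {}) Bs" "length hs = length Bs"
  shows "(\<Sum>f\<in>funs_onto (\<Union>(set Bs)) M. \<Prod>(B, h)\<leftarrow>zip Bs hs. h (image_mset f (mset_set B))) =
    conv_list (map2 (\<lambda>B h M. of_nat (card (funs_onto B M)) * h M) Bs hs) M"
  using assms
proof (induction Bs arbitrary: hs M)
  case Nil
  then show ?case by (auto simp: funs_onto_def)
next
  case (Cons B Bs)
  then obtain h hs' where hs: "hs = h # hs'" "length hs' = length Bs" by (cases hs) auto
  let ?R = "\<Union>(set Bs)"
  let ?k = "\<lambda>f. \<Prod>(B, h)\<leftarrow>zip Bs hs'. h (image_mset f (mset_set B))"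
  \<comment> \<open>The factors of the other blocks do not see the values on \<open>B\<close>; this
    is the form required by \<open>sum_funs_onto_Un\<close>.\<close>
  have k: "?k f = ?k (restrict f ?R)" for f
  proof -
    have "image_mset (restrict f ?R) (mset_set C) = image_mset f (mset_set C)" if "C \<in> set Bs" for C
      using that by (intro image_mset_cong_set) auto
    then show ?thesis
      by (intro arg_cong[of _ _ prod_list] map_cong refl) (auto dest: set_zip_leftD)
  qed
  have "(\<Sum>f\<in>funs_onto (\<Union>(set (B # Bs))) M. \<Prod>(B, h)\<leftarrow>zip (B # Bs) hs. h (image_mset f (mset_set B))) =
      (\<Sum>f\<in>funs_onto (B \<union> ?R) M. h (image_mset f (mset_set B)) * ?k (restrict f ?R))"
    by (simp add: hs k[symmetric])
  also have "\<dots> = conv (\<lambda>M. of_nat (card (funs_onto B M)) * h M) (\<lambda>M. \<Sum>f\<in>funs_onto ?R M. ?k f) M"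
    by (rule sum_funs_onto_Un) (use Cons.prems in auto)
  also have "(\<lambda>M. \<Sum>f\<in>funs_onto ?R M. ?k f) =
      conv_list (map2 (\<lambda>B h M. of_nat (card (funs_onto B M)) * h M) Bs hs')"
    using Cons.IH[of hs'] Cons.prems hs(2) by (intro ext) simp
  finally show ?case by (simp add: hs)
qed

lemma bij_betw_funs_onto:
  assumes "distinct xs"
  shows "bij_betw (\<lambda>f. map f xs) (funs_onto (set xs) M) {ys. length ys = length xs \<and> mset ys = M}"
proof (rule bij_betw_imageI)
  have ms: "image_mset f (mset_set (set xs)) = mset (map f xs)" for f :: "'a \<Rightarrow> nat"
    using assms by (simp add: mset_set_set)
  show "inj_on (\<lambda>f. map f xs) (funs_onto (set xs) M)"
    by (intro inj_onI) (auto simp: funs_onto_def fun_eq_iff PiE_iff extensional_def)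
  show "(\<lambda>f. map f xs) ` funs_onto (set xs) M = {ys. length ys = length xs \<and> mset ys = M}"
  proof (intro equalityI subsetI)
    fix ys assume "ys \<in> {ys. length ys = length xs \<and> mset ys = M}"
    then have ys: "length ys = length xs" "mset ys = M" by auto
    let ?f = "restrict (the \<circ> map_of (zip xs ys)) (set xs)"
    have map: "map ?f xs = ys"
      using ys(1) assms by (intro nth_equalityI) (simp_all add: map_of_zip_nth)
    then have "?f \<in> funs_onto (set xs) M" using ys(2) ms[of ?f] by (simp add: funs_onto_def)
    with map show "ys \<in> (\<lambda>f. map f xs) ` funs_onto (set xs) M" by (metis image_eqI)
  qed (auto simp: funs_onto_def ms)
qed

lemma card_funs_onto:
  assumes "finite B" shows "of_nat (card (funs_onto B M)) = arrangements (card B) M"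
proof -
  obtain xs where xs: "set xs = B" "distinct xs" using finite_distinct_list[OF assms] by blast
  then have "length xs = card B" by (metis distinct_card)
  with bij_betw_same_card[OF bij_betw_funs_onto[OF xs(2), of M]] xs(1)
  show ?thesis by (simp add: arrangements_def)
qed

text \<open>The multinomial formula with the denominator multiplied out.\<close>

lemma arrangements_eq:
  "arrangements k M * (\<Prod>v\<in>set_mset M. fact (count M v)) = (if size M = k then fact k else 0)"
proof (cases "size M = k")
  case True
  let ?P = "\<Prod>v\<in>set_mset M. fact (count M v) :: nat"
  have "{ys. length ys = k \<and> mset ys = M} = permutations_of_multiset M"
    using True by (auto simp: permutations_of_multiset_def)
  then have "card {ys. length ys = k \<and> mset ys = M} * ?P = fact k"
    using card_permutations_of_multiset[of M] True by simp
  then have "of_nat (card {ys. length ys = k \<and> mset ys = M}) * of_nat ?P = (of_nat (fact k) :: rat)"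
    by (metis of_nat_mult)
  with True show ?thesis by (simp add: arrangements_def)
next
  case False
  then have "{ys. length ys = k \<and> mset ys = M} = {}" by auto
  then have "arrangements k M = 0" unfolding arrangements_def by (simp only: card.empty of_nat_0)
  with False show ?thesis by simp
qed

definition letters :: "nat list \<Rightarrow> nat set \<Rightarrow> nat multiset" where
  "letters b B = image_mset (\<lambda>j. b ! (j - 1)) (mset_set B)"

text \<open>Blocks may be scattered, and also empty, as happens for a fermionic block that contains
  only 0. Summing over all arrangements of \<open>M\<close> leaves nothing of a block but its
  size.\<close>

lemma sum_lists_blocks:
  assumes Bs: "sorted_wrt (\<lambda>A B. A \<inter> B = {}) Bs" "\<Union>(set Bs) = {1..n}" and len: "length hs = length Bs"
  shows "(\<Sum>b\<in>{b. length b = n \<and> mset b = M}. \<Prod>(B, h)\<leftarrow>zip Bs hs. h (letters b B)) =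
    conv_list (map2 (\<lambda>B h M. arrangements (card B) M * h M) Bs hs) M"
proof -
  have sub: "B \<subseteq> {1..n}" if "B \<in> set Bs" for B using that Bs(2) by blast
  then have fin: "finite B" if "B \<in> set Bs" for B using that finite_subset[of B "{1..n}"] by auto
  let ?xs = "[1..<Suc n]"
  have set: "set ?xs = {1..n}" by auto
  have "(\<Sum>b\<in>{b. length b = n \<and> mset b = M}. \<Prod>(B, h)\<leftarrow>zip Bs hs. h (letters b B)) =
      (\<Sum>f\<in>funs_onto {1..n} M. \<Prod>(B, h)\<leftarrow>zip Bs hs. h (letters (map f ?xs) B))"
    using bij_betw_funs_onto[of ?xs M] unfolding set
    by (intro sum.reindex_bij_betw[symmetric]) (simp del: upt_Suc)
  also have "\<dots> = (\<Sum>f\<in>funs_onto (\<Union>(set Bs)) M. \<Prod>(B, h)\<leftarrow>zip Bs hs. h (image_mset f (mset_set B)))"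
    unfolding Bs(2)
  proof (intro sum.cong refl arg_cong[of _ _ prod_list] map_cong, clarify)
    fix f B h assume "(B, h) \<in> set (zip Bs hs)"
    then have "B \<subseteq> {1..n}" using sub by (auto dest: set_zip_leftD)
    have "letters (map f ?xs) B = image_mset f (mset_set B)"
      unfolding letters_def
    proof (rule image_mset_cong_set)
      fix j assume "j \<in> B"
      then have "1 \<le> j" "j \<le> n" using \<open>B \<subseteq> {1..n}\<close> by auto
      then show "map f ?xs ! (j - 1) = f j" by (simp del: upt_Suc)
    qed
    then show "h (letters (map f ?xs) B) = h (image_mset f (mset_set B))" by simp
  qed
  also have "\<dots> = conv_list (map2 (\<lambda>B h M. of_nat (card (funs_onto B M)) * h M) Bs hs) M"
    by (rule sum_funs_onto_blocks) (use fin Bs len in auto)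
  also have "map2 (\<lambda>B h M. of_nat (card (funs_onto B M)) * h M) Bs hs =
      map2 (\<lambda>B h M. arrangements (card B) M * h M) Bs hs"
    by (intro map_cong refl) (auto simp: card_funs_onto fin dest: set_zip_leftD)
  finally show ?thesis .
qed

section \<open>Monomial functions\<close>

text \<open>The nonzero exponents of the monomial \<open>M\<close>, that is, the partition it
  belongs to.\<close>

definition exponents :: "nat multiset \<Rightarrow> nat multiset" where
  "exponents M = image_mset (count M) (mset_set (set_mset M))"

lemma mult_fact_superset:
  assumes "finite A" "set ls \<subseteq> A"
  shows "mult_fact ls = (\<Prod>k\<in>A. fact (count_list ls k))"
  unfolding mult_fact_def
  by (rule prod.mono_neutral_left) (use assms in \<open>auto simp: count_list_0_iff\<close>)

text \<open>The factor is the number of parts \<open>r\<close> in the longer list, which is the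
  number of choices for the value of the first part in
  \<open>card_lists_of_exponents\<close>.\<close>

lemma mult_fact_Cons: "mult_fact (r # ls) = of_nat (Suc (count_list ls r)) * mult_fact ls"
proof -
  have "mult_fact (r # ls) = (\<Prod>k\<in>insert r (set ls). fact (count_list (r # ls) k))"
    by (simp add: mult_fact_def)
  also have "\<dots> = fact (Suc (count_list ls r)) * (\<Prod>k\<in>set ls - {r}. fact (count_list ls k))"
    by (subst prod.insert_remove) (auto intro!: prod.cong)
  also have "\<dots> = of_nat (Suc (count_list ls r)) * (\<Prod>k\<in>insert r (set ls). fact (count_list ls k))"
    by (subst prod.insert_remove) (auto simp: algebra_simps)
  also have "(\<Prod>k\<in>insert r (set ls). fact (count_list ls k)) = mult_fact ls"
    by (rule mult_fact_superset[symmetric]) auto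
  finally show ?thesis .
qed

lemma mult_fact_neq_0: "mult_fact ls \<noteq> 0"
  by (simp add: mult_fact_def)

lemma mult_fact_mset: "mset ls = mset ls' \<Longrightarrow> mult_fact ls = mult_fact ls'"
proof -
  assume eq: "mset ls = mset ls'"
  have "set ls = set ls'" by (rule mset_eq_setD[OF eq])
  moreover have "count_list ls k = count_list ls' k" for k using eq by (metis count_mset)
  ultimately show ?thesis by (simp add: mult_fact_def)
qed

section \<open>Lists of values that produce a given monomial\<close>

lemma powers_mset_Nil [simp]: "powers_mset [] es = {#}"
  and powers_mset_Cons [simp]: "powers_mset (i # is) (e # es) = replicate_mset e i + powers_mset is es"
  by (simp_all add: powers_mset_def)

lemma powers_mset_append:
  "length a = length la \<Longrightarrow> powers_mset (a @ c) (la @ ls) = powers_mset a la + powers_mset c ls"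
  by (simp add: powers_mset_def)

lemma count_powers_mset_notin: "v \<notin> set is \<Longrightarrow> count (powers_mset is es) v = 0"
proof (induction "is" es rule: list_induct2')
  case (2 x xs)
  then show ?case by (simp add: powers_mset_def)
qed auto

lemma count_powers_mset_nth:
  "length is = length es \<Longrightarrow> distinct is \<Longrightarrow> k < length is \<Longrightarrow> count (powers_mset is es) (is ! k) = es ! k"
proof (induction "is" es arbitrary: k rule: list_induct2)
  case (Cons i "is" e es)
  then show ?case by (cases k) (auto simp: count_powers_mset_notin)
qed simp

lemma set_powers_mset:
  assumes "length is = length es" "distinct is" "0 \<notin> set es"
  shows "set_mset (powers_mset is es) = set is"
proof (intro equalityI subsetI)
  fix v assume "v \<in># powers_mset is es"
  then show "v \<in> set is" using count_powers_mset_notin by (metis not_in_iff)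
next
  fix v assume "v \<in> set is"
  then obtain k where k: "k < length is" "v = is ! k" by (auto simp: in_set_conv_nth)
  then have "es ! k \<noteq> 0" using assms by (metis nth_mem)
  then show "v \<in># powers_mset is es" using k assms by (simp add: count_powers_mset_nth flip: count_greater_zero_iff)
qed

lemma exponents_remove:
  assumes "count M v = r" "0 < r"
  shows "exponents M = add_mset r (exponents (M - replicate_mset r v))"
proof -
  let ?M = "M - replicate_mset r v"
  have count: "count ?M w = (if w = v then 0 else count M w)" for w using assms by auto
  have v: "v \<in># M" using assms by (simp flip: count_greater_zero_iff)
  have set: "set_mset ?M = set_mset M - {v}"
  proof (intro set_eqI)
    fix w show "w \<in># ?M \<longleftrightarrow> w \<in> set_mset M - {v}"
      using count[of w] by (auto simp flip: count_greater_zero_iff)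
  qed
  have "mset_set (set_mset M) = add_mset v (mset_set (set_mset M - {v}))"
    using v by (simp add: mset_set.remove)
  then show ?thesis
    using assms(1) by (auto simp: exponents_def set count intro!: image_mset_cong)
qed

text \<open>The value \<open>v\<close> of the first part must have multiplicity exactly
  \<open>r\<close> in \<open>M\<close>. Deleting its occurrences removes one entry \<open>r\<close>
  from \<open>exponents M\<close>, and the candidates for \<open>v\<close> are counted by the
  multiplicity of \<open>r\<close> there, as in \<open>mult_fact_Cons\<close>.\<close>

lemma card_lists_of_exponents:
  assumes "0 \<notin> set ls"
  shows "of_nat (card {c. length c = length ls \<and> distinct c \<and> powers_mset c ls = M}) =
    (if exponents M = mset ls then mult_fact ls else 0)"
  using assms
proof (induction ls arbitrary: M)
  case Nil
  have "{c. length c = length [] \<and> distinct c \<and> powers_mset c [] = M} = (if M = {#} then {[]} else {})"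
    by auto
  moreover have "exponents M = {#} \<longleftrightarrow> M = {#}" by (simp add: exponents_def mset_set_empty_iff)
  ultimately show ?case by (simp add: mult_fact_def)
next
  case (Cons r ls)
  let ?C = "\<lambda>ls M. {c. length c = length ls \<and> distinct c \<and> powers_mset c ls = M}"
  let ?V = "{v \<in> set_mset M. count M v = r}"
  have r: "0 < r" "0 \<notin> set ls" using Cons.prems by auto
  have fin: "finite (?C ls M)" for M :: "nat multiset"
  proof (rule finite_subset)
    show "?C ls M \<subseteq> {c. set c \<subseteq> set_mset M \<and> length c = length ls}"
      using set_powers_mset[of _ ls] r(2) by auto
  qed (simp add: finite_lists_length_eq)
  have decomp: "?C (r # ls) M = (\<Union>v\<in>?V. (#) v ` ?C ls (M - replicate_mset r v))"
  proof (intro equalityI subsetI)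
    fix c assume "c \<in> ?C (r # ls) M"
    then obtain v c' where c: "c = v # c'" "length c' = length ls" "distinct c'" "v \<notin> set c'"
      "M = replicate_mset r v + powers_mset c' ls" by (cases c) auto
    then have "count M v = r" by (simp add: count_powers_mset_notin)
    with r have "v \<in> ?V" by (simp flip: count_greater_zero_iff)
    moreover have "c \<in> (#) v ` ?C ls (M - replicate_mset r v)" using c by auto
    ultimately show "c \<in> (\<Union>v\<in>?V. (#) v ` ?C ls (M - replicate_mset r v))" by blast
  next
    fix c assume "c \<in> (\<Union>v\<in>?V. (#) v ` ?C ls (M - replicate_mset r v))"
    then obtain v c' where c: "c = v # c'" "count M v = r" "length c' = length ls" "distinct c'"
      "powers_mset c' ls = M - replicate_mset r v" by auto
    \<comment> \<open>Since all parts are positive, the entries of \<open>c'\<close> are exactly the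
      letters of the remainder. These no longer include \<open>v\<close>, so \<open>v # c'\<close>
      is distinct.\<close>
    have "set c' = set_mset (M - replicate_mset r v)"
      using set_powers_mset[of c' ls] c r(2) by simp
    moreover have "v \<notin># M - replicate_mset r v" using c(2) by (simp add: not_in_iff)
    moreover have "replicate_mset r v \<subseteq># M" using c(2) by (simp add: mset_subset_eq_count subseteq_mset_def)
    ultimately show "c \<in> ?C (r # ls) M" using c by auto
  qed
  have "card (?C (r # ls) M) = (\<Sum>v\<in>?V. card (?C ls (M - replicate_mset r v)))"
    unfolding decomp
    by (subst card_UN_disjoint) (auto simp: fin card_image)
  then have "of_nat (card (?C (r # ls) M)) =
      (\<Sum>v\<in>?V. if exponents (M - replicate_mset r v) = mset ls then mult_fact ls else 0)"
    using Cons.IH r(2) by simp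
  also have "\<dots> = (\<Sum>v\<in>?V. if exponents M = mset (r # ls) then mult_fact ls else 0)"
    by (intro sum.cong refl) (use r(1) exponents_remove in auto)
  also have "\<dots> = (if exponents M = mset (r # ls) then of_nat (card ?V) * mult_fact ls else 0)"
    by simp
  also have "\<dots> = (if exponents M = mset (r # ls) then mult_fact (r # ls) else 0)"
  proof (cases "exponents M = mset (r # ls)")
    case True
    have "card ?V = count (exponents M) r"
      by (simp add: exponents_def count_image_mset_eq_card_vimage)
    also have "\<dots> = Suc (count_list ls r)" by (simp add: True count_mset)
    finally show ?thesis using True by (simp add: mult_fact_Cons)
  qed simp
  finally show ?case .
qed

text \<open>Each fermionic value occurs as often as its part says, possibly not at all, and the
  other letters have the exponents \<open>N\<close>. \<open>Z\<close> is a multiset of pairs so that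
  \<open>alt_sum_swap_adjacent\<close> applies; \<open>0 \<notin># M\<close> expresses that indices
  are positive.\<close>

definition m_coeff :: "nat multiset \<Rightarrow> (nat \<times> nat) multiset \<Rightarrow> nat multiset \<Rightarrow> rat" where
  "m_coeff N Z M = (if (\<forall>(k, v)\<in>#Z. 1 \<le> v \<and> count M v = k) \<and> 0 \<notin># M \<and>
     exponents {#v \<in># M. v \<notin> snd ` set_mset Z#} = N then 1 else 0)"

definition m_series :: "nat list \<Rightarrow> nat list \<Rightarrow> cseries" where
  "m_series la ls = alt_sum (length la) (\<lambda>a. m_coeff (mset ls) (mset (zip la a)))"

text \<open>The possible values \<open>c\<close> of the nonfermionic blocks when \<open>a\<close>
  gives the values of the fermionic ones and \<open>M\<close> is the resulting monomial.\<close>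

definition block_values :: "nat list \<Rightarrow> nat list \<Rightarrow> nat list \<Rightarrow> nat multiset \<Rightarrow> nat list set" where
  "block_values la ls a M = {c. length c = length ls \<and> distinct (a @ c) \<and> (\<forall>v\<in>set (a @ c). 1 \<le> v) \<and>
     powers_mset (a @ c) (la @ ls) = M}"

text \<open>Once \<open>a\<close> is fixed, the multiplicities of its entries in \<open>M\<close>
  are forced. What remains is to distribute the letters outside \<open>a\<close>, which is counted
  by \<open>card_lists_of_exponents\<close>.\<close>

lemma card_block_values:
  assumes a: "length a = length la" "distinct a" and ls: "0 \<notin> set ls"
  shows "of_nat (card (block_values la ls a M)) = mult_fact ls * m_coeff (mset ls) (mset (zip la a)) M"
proof -
  let ?M = "{#v \<in># M. v \<notin> set a#}"
  let ?P = "(\<forall>k<length a. 1 \<le> a ! k \<and> count M (a ! k) = la ! k) \<and> 0 \<notin># M"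
  have coeff: "m_coeff (mset ls) (mset (zip la a)) M = (if ?P \<and> exponents ?M = mset ls then 1 else 0)"
  proof -
    have "snd ` set_mset (mset (zip la a)) = set a" using a(1) by (simp add: set_map[symmetric])
    moreover have "(\<forall>(k, v)\<in>#mset (zip la a). 1 \<le> v \<and> count M v = k) \<longleftrightarrow>
        (\<forall>k<length a. 1 \<le> a ! k \<and> count M (a ! k) = la ! k)"
      using a(1) by (auto simp: set_zip)
    ultimately show ?thesis unfolding m_coeff_def by simp
  qed
  have "c \<in> block_values la ls a M \<longleftrightarrow>
      ?P \<and> length c = length ls \<and> distinct c \<and> powers_mset c ls = ?M" for c
  proof
    assume "c \<in> block_values la ls a M"
    then have c: "length c = length ls" "distinct c" "set a \<inter> set c = {}" "\<forall>v\<in>set a \<union> set c. 1 \<le> v"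
      and M: "M = powers_mset a la + powers_mset c ls"
      using a by (auto simp: block_values_def powers_mset_append)
    have "count M (a ! k) = la ! k" if "k < length a" for k
    proof -
      have "a ! k \<notin> set c" using c(3) that nth_mem by blast
      with that show ?thesis using a by (simp add: M count_powers_mset_nth count_powers_mset_notin)
    qed
    moreover have "0 \<notin># M"
      using c(4) by (auto simp: M not_in_iff intro!: count_powers_mset_notin)
    moreover have "powers_mset c ls = ?M"
    proof (rule multiset_eqI)
      fix v show "count (powers_mset c ls) v = count ?M v"
        using c(3) by (cases "v \<in> set a") (auto simp: M count_powers_mset_notin disjoint_iff)
    qed
    ultimately show "?P \<and> length c = length ls \<and> distinct c \<and> powers_mset c ls = ?M" using c by auto
  next
    assume c: "?P \<and> length c = length ls \<and> distinct c \<and> powers_mset c ls = ?M"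
    then have set: "set c = set_mset ?M" using set_powers_mset[of c ls] ls by simp
    have "powers_mset a la = {#v \<in># M. v \<in> set a#}"
    proof (rule multiset_eqI)
      fix v show "count (powers_mset a la) v = count {#v \<in># M. v \<in> set a#} v"
      proof (cases "v \<in> set a")
        case True
        then obtain k where "k < length a" "v = a ! k" by (auto simp: in_set_conv_nth)
        then show ?thesis using c a by (simp add: count_powers_mset_nth)
      qed (simp add: count_powers_mset_notin)
    qed
    then have "powers_mset (a @ c) (la @ ls) = M"
      using c a by (simp add: powers_mset_append multiset_partition[symmetric])
    moreover have "\<forall>v\<in>set (a @ c). 1 \<le> v"
    proof
      fix v assume "v \<in> set (a @ c)"
      then show "1 \<le> v"
        using c set by (cases "v = 0") (auto simp: in_set_conv_nth[of _ a])
    qed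
    ultimately show "c \<in> block_values la ls a M"
      using c set a by (auto simp: block_values_def)
  qed
  then have "block_values la ls a M =
      (if ?P then {c. length c = length ls \<and> distinct c \<and> powers_mset c ls = ?M} else {})" by auto
  then show ?thesis unfolding coeff
    using card_lists_of_exponents[OF ls, of ?M] by auto
qed

text \<open>As the parts \<open>la\<close> are distinct, the elements of \<open>S\<close> are told
  apart by their exponents in \<open>M\<close>, so \<open>S\<close> and \<open>M\<close> determine
  \<open>a\<close>. Hence at most one member of the set \<open>m_terms\<close> has a nonzero
  coefficient there; different \<open>c\<close> for the same \<open>a\<close> give the same series,
  which counts once.\<close>

lemma c_m_eq:
  assumes la: "distinct la" and ls: "0 \<notin> set ls"
  shows "c_m (la, ls) = m_series la ls"
proof (intro ext)
  fix S M
  let ?term = "\<lambda>a c. c_prod (map c_theta a @ map2 c_x_power (a @ c) (la @ ls))"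
  let ?good = "\<lambda>a. a \<in> theta_lists S (length la) \<and> distinct a \<and> block_values la ls a M \<noteq> {}"
  have coeff: "m_coeff (mset ls) (mset (zip la a)) M \<noteq> 0 \<longleftrightarrow> block_values la ls a M \<noteq> {}"
    if "length a = length la" "distinct a" for a
  proof -
    have "finite (block_values la ls a M)"
    proof (rule finite_subset)
      show "block_values la ls a M \<subseteq> {c. set c \<subseteq> set_mset M \<and> length c = length ls}"
      proof
        fix c assume "c \<in> block_values la ls a M"
        then have "length c = length ls" "distinct c" "M = powers_mset a la + powers_mset c ls"
          using that by (auto simp: block_values_def powers_mset_append)
        then show "c \<in> {c. set c \<subseteq> set_mset M \<and> length c = length ls}"
          using set_powers_mset[of c ls] ls by auto
      qed
    qed (simp add: finite_lists_length_eq)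
    then show ?thesis
      using card_block_values[OF that ls, of M] mult_fact_neq_0[of ls]
      by (metis card_0_eq mult_eq_0_iff of_nat_eq_0_iff)
  qed
  have uniq: "a = a'" if "?good a" "?good a'" for a a'
  proof -
    have len: "length a = length la" "length a' = length la" "set a = set a'"
      using that by (auto simp: theta_lists_def)
    have cnt: "count M (x ! k) = la ! k" if good: "?good x" "k < length la" for x k
    proof -
      have x: "length x = length la" "distinct x" using that by (auto simp: theta_lists_def)
      obtain c where "c \<in> block_values la ls x M" using good(1) by blast
      then have "distinct (x @ c)" "length (x @ c) = length (la @ ls)" "M = powers_mset (x @ c) (la @ ls)"
        using x by (auto simp: block_values_def)
      then have "count M ((x @ c) ! k) = (la @ ls) ! k"
        using count_powers_mset_nth[of "x @ c" "la @ ls" k] that(2) by simp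
      then show ?thesis using that(2) x by (simp add: nth_append)
    qed
    show ?thesis
    proof (rule nth_equalityI)
      fix k assume k: "k < length a"
      then obtain l where l: "l < length la" "a ! k = a' ! l"
        using len by (metis in_set_conv_nth)
      then have "la ! k = la ! l" using cnt[OF that(1)] cnt[OF that(2)] k len by metis
      then have "k = l" using la l k len by (simp add: nth_eq_iff_index_eq)
      with l show "a ! k = a' ! k" by simp
    qed (simp add: len)
  qed
  have coeff_term: "?term a c S M = (if set a = S \<and> powers_mset (a @ c) (la @ ls) = M then list_sign a else 0)" for a c
    by (auto simp: c_term_eq scale_def monomial_def)
  \<comment> \<open>On the right \<open>c\<close> is gone: it enters a term only through
    \<open>M\<close>.\<close>
  have terms: "{t \<in> m_terms (la, ls). t S M \<noteq> 0} = (\<lambda>a. scale (list_sign a) (monomial S M)) ` {a. ?good a}"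
  proof (intro equalityI subsetI)
    fix t assume t: "t \<in> {t \<in> m_terms (la, ls). t S M \<noteq> 0}"
    then obtain "is" where "is": "t = c_prod (map c_theta (take (length la) is) @ map2 c_x_power is (la @ ls))"
      "length is = length (la @ ls)" "distinct is" "\<forall>i\<in>set is. 1 \<le> i"
      by (auto simp: m_terms_def)
    define a c where "a = take (length la) is" and "c = drop (length la) is"
    have ac: "is = a @ c" "length a = length la" "length c = length ls"
      using "is"(2) by (auto simp: a_def c_def)
    have t_eq: "t = ?term a c" using "is"(1) unfolding ac(1) a_def[symmetric] using ac by simp
    then have "set a = S" "powers_mset (a @ c) (la @ ls) = M"
      using t coeff_term[of a c] by (auto split: if_splits)
    moreover from this have "?good a"
      using ac "is" by (auto simp: theta_lists_def block_values_def)
    ultimately show "t \<in> (\<lambda>a. scale (list_sign a) (monomial S M)) ` {a. ?good a}"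
      using t_eq by (auto simp: c_term_eq)
  next
    fix t assume "t \<in> (\<lambda>a. scale (list_sign a) (monomial S M)) ` {a. ?good a}"
    then obtain a c where a: "?good a" "c \<in> block_values la ls a M" "t = scale (list_sign a) (monomial S M)"
      by blast
    then have c: "length c = length ls" "distinct (a @ c)" "\<forall>v\<in>set (a @ c). 1 \<le> v"
      "powers_mset (a @ c) (la @ ls) = M" "set a = S" "length a = length la"
      by (auto simp: block_values_def theta_lists_def)
    then have t: "t = ?term a c" unfolding a(3) c_term_eq by simp
    moreover have "a = take (length la) (a @ c)" "length (a @ c) = length (la @ ls)" using c by simp_all
    ultimately have "t \<in> m_terms (la, ls)"
      unfolding m_terms_def using c(2,3) by (simp only: prod.case mem_Collect_eq) metis
    moreover have "t S M \<noteq> 0" using a(1) unfolding a(3) by (simp add: scale_def monomial_def list_sign_neq_0)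
    ultimately show "t \<in> {t \<in> m_terms (la, ls). t S M \<noteq> 0}" by simp
  qed
  have "m_series la ls S M = (\<Sum>a\<in>{a. ?good a}. list_sign a)"
  proof -
    have "m_series la ls S M = (\<Sum>a\<in>{a. ?good a}. list_sign a * m_coeff (mset ls) (mset (zip la a)) M)"
      unfolding m_series_def alt_sum_def
    proof (rule sum.mono_neutral_right)
      show "\<forall>a\<in>theta_lists S (length la) - {a. ?good a}. list_sign a * m_coeff (mset ls) (mset (zip la a)) M = 0"
      proof
        fix a assume a: "a \<in> theta_lists S (length la) - {a. ?good a}"
        then have "length a = length la" by (simp add: theta_lists_def)
        then show "list_sign a * m_coeff (mset ls) (mset (zip la a)) M = 0"
          using a coeff[of a] list_sign_eq_0[of a] by auto
      qed
    qed auto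
    also have "\<dots> = (\<Sum>a\<in>{a. ?good a}. list_sign a)"
    proof (intro sum.cong refl)
      fix a assume "a \<in> {a. ?good a}"
      then have "m_coeff (mset ls) (mset (zip la a)) M \<noteq> 0" using coeff[of a] by (auto simp: theta_lists_def)
      then show "list_sign a * m_coeff (mset ls) (mset (zip la a)) M = list_sign a"
        by (simp add: m_coeff_def split: if_splits)
    qed
    finally show ?thesis .
  qed
  also have "\<dots> = c_m (la, ls) S M"
  proof (cases "\<exists>a. ?good a")
    case True
    then obtain a where a: "?good a" by blast
    then have "{a. ?good a} = {a}" using uniq by blast
    then show ?thesis
      unfolding c_m_def series_sum_def terms by (simp add: scale_def monomial_def)
  next
    case False
    then have "{a. ?good a} = {}" by blast
    then show ?thesis unfolding c_m_def series_sum_def terms by (simp only: image_empty sum.empty)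
  qed
  finally show "c_m (la, ls) S M = m_series la ls S M" ..
qed

section \<open>Blocks of a partial set supercomposition\<close>

locale supercomp =
  fixes n m :: nat and K :: "nat set list"
  assumes K: "K \<in> set_supercomps n m"
begin

text \<open>The part of a block that consists of positions of a word. It is empty exactly for a
  fermionic block equal to {0}.\<close>

definition pos :: "nat \<Rightarrow> nat set" where "pos i = K ! i - {0}"

lemma m_le: "m \<le> length K" and m_le_Suc: "m \<le> n + 1"
  using K by (simp_all add: set_supercomps_def)

lemma block_subset: "i < length K \<Longrightarrow> K ! i \<subseteq> {0..n}"
  using K by (auto simp: set_supercomps_def)

lemma finite_block: "i < length K \<Longrightarrow> finite (K ! i)"
  using block_subset finite_subset by blast

lemma block_nonempty: "i < length K \<Longrightarrow> K ! i \<noteq> {}"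
  using K by (auto simp: set_supercomps_def)

lemma pos_subset: "i < length K \<Longrightarrow> pos i \<subseteq> {1..n}"
  using block_subset[of i] by (force simp: pos_def)

lemma finite_pos [simp]: "i < length K \<Longrightarrow> finite (pos i)"
  using finite_block by (simp add: pos_def)

lemma zero_in_block: "i < length K \<Longrightarrow> 0 \<in> K ! i \<longleftrightarrow> i < m"
  using K by (auto simp: set_supercomps_def)

lemma pos_nonferm: "m \<le> i \<Longrightarrow> i < length K \<Longrightarrow> pos i = K ! i"
  using zero_in_block[of i] by (auto simp: pos_def)

lemma pos_disjoint: "i < length K \<Longrightarrow> j < length K \<Longrightarrow> i \<noteq> j \<Longrightarrow> pos i \<inter> pos j = {}"
proof -
  assume "i < length K" "j < length K" "i \<noteq> j"
  then have "K ! i \<inter> K ! j \<subseteq> {0}" using K unfolding set_supercomps_def mem_Collect_eq by blast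
  then show ?thesis by (auto simp: pos_def)
qed

lemma pos_unique: "i < length K \<Longrightarrow> j < length K \<Longrightarrow> x \<in> pos i \<Longrightarrow> x \<in> pos j \<Longrightarrow> i = j"
  using pos_disjoint by blast

lemma pos_cover: "(\<Union>i<length K. pos i) = {1..n}"
proof -
  have "(\<Union>B\<in>set K. B - {0}) = (\<Union>i<length K. pos i)"
    unfolding pos_def set_conv_nth by blast
  then show ?thesis using K by (simp add: set_supercomps_def)
qed

lemma in_some_pos:
  assumes "j \<in> {1..n}" obtains i where "i < length K" "j \<in> pos i"
  using assms pos_cover by (metis UN_E lessThan_iff)

lemma same_block_iff:
  assumes "i \<in> {1..n}" "j \<in> {1..n}"
  shows "same_block K i j \<longleftrightarrow> (\<exists>k<length K. i \<in> pos k \<and> j \<in> pos k)"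
proof -
  have "same_block K i j \<longleftrightarrow> (\<exists>k<length K. i \<in> K ! k \<and> j \<in> K ! k)"
    unfolding same_block_def by (metis in_set_conv_nth)
  then show ?thesis using assms by (simp add: pos_def)
qed

text \<open>Subtracting 1 discounts the element 0, which every fermionic block contains.\<close>

lemma ferm_sizes_eq: "ferm_sizes m K = map (\<lambda>i. card (pos i)) [0..<m]"
proof (rule nth_equalityI)
  show "length (ferm_sizes m K) = length (map (\<lambda>i. card (pos i)) [0..<m])"
    using m_le by (simp add: ferm_sizes_def)
  fix i assume "i < length (ferm_sizes m K)"
  then have i: "i < m" "i < length K" by (simp_all add: ferm_sizes_def)
  then show "ferm_sizes m K ! i = map (\<lambda>i. card (pos i)) [0..<m] ! i"
    using zero_in_block[of i] finite_block[of i] by (simp add: ferm_sizes_def pos_def)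
qed

lemma cards_eq: "map card (drop m K) = map (\<lambda>i. card (pos i)) [m..<length K]"
  using m_le by (intro nth_equalityI) (simp_all add: pos_nonferm)

lemma sizes_eq: "ferm_sizes m K @ map card (drop m K) = map (\<lambda>i. card (pos i)) [0..<length K]"
  unfolding ferm_sizes_eq cards_eq using m_le
  by (metis le0 map_append le_Suc_ex upt_add_eq_append)

lemma length_ferm_sizes [simp]: "length (ferm_sizes m K) = m"
  using m_le by (simp add: ferm_sizes_def)

lemma zero_notin_cards: "0 \<notin> set (map card (drop m K))"
proof
  assume "0 \<in> set (map card (drop m K))"
  then obtain i where "m \<le> i" "i < length K" "card (pos i) = 0" unfolding cards_eq by auto
  then show False using block_nonempty[of i] finite_block[of i] by (simp add: pos_nonferm)
qed

lemma set_letters: "i < length K \<Longrightarrow> set_mset (letters b (pos i)) = (\<lambda>j. b ! (j - 1)) ` pos i"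
  by (simp add: letters_def)

lemma set_word:
  assumes "length b = n"
  shows "set b = (\<Union>i<length K. set_mset (letters b (pos i)))"
proof -
  have "(\<Union>i<length K. set_mset (letters b (pos i))) = (\<lambda>j. b ! (j - 1)) ` {1..n}"
    unfolding pos_cover[symmetric] image_UN by (simp add: set_letters)
  also have "\<dots> = set b"
  proof -
    have "(\<lambda>j. b ! (j - 1)) ` {1..n} = (!) b ` (\<lambda>j. j - 1) ` {1..n}" by (simp add: image_image)
    also have "(\<lambda>j. j - 1) ` {1..n} = {..<n}"
    proof (intro equalityI subsetI)
      fix i assume "i \<in> {..<n}"
      then show "i \<in> (\<lambda>j. j - 1) ` {1..n}" by (intro image_eqI[of _ _ "Suc i"]) auto
    qed auto
    finally show ?thesis using assms by (auto simp: set_conv_nth)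
  qed
  finally show ?thesis ..
qed

text \<open>The interface for p, e and h: a weight that is a product over the blocks, where
  \<open>\<phi>\<close> also sees the \<theta>-index of its block, turns into a convolution that
  knows the blocks by size alone.\<close>

lemma sum_words_blocks:
  assumes a: "length a = m"
    and w: "\<And>b. length b = n \<Longrightarrow> w b =
      (\<Prod>i<m. \<phi> (a ! i) (letters b (pos i))) * (\<Prod>i\<in>{m..<length K}. \<psi> (letters b (pos i)))"
  shows "(\<Sum>b\<in>{b. length b = n \<and> mset b = M}. w b) =
    conv_list (map2 (\<lambda>k i M. arrangements k M * \<phi> i M) (ferm_sizes m K) a @
      map (\<lambda>k M. arrangements k M * \<psi> M) (map card (drop m K))) M"
proof -
  let ?Bs = "map pos [0..<length K]"
  let ?hs = "map \<phi> a @ replicate (length K - m) \<psi>"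
  have "w b = (\<Prod>(B, h)\<leftarrow>zip ?Bs ?hs. h (letters b B))" if "length b = n" for b
  proof -
    have "(\<Prod>(B, h)\<leftarrow>zip ?Bs ?hs. h (letters b B)) = (\<Prod>i\<in>{0..<length K}. (?hs ! i) (letters b (pos i)))"
      using a m_le by (subst prod.list_conv_set_nth) (auto intro!: prod.cong)
    also have "\<dots> = (\<Prod>i\<in>{0..<m}. (?hs ! i) (letters b (pos i))) * (\<Prod>i\<in>{m..<length K}. (?hs ! i) (letters b (pos i)))"
      using m_le by (subst prod.atLeastLessThan_concat) auto
    also have "\<dots> = w b"
      unfolding w[OF that] using a by (auto simp: nth_append lessThan_atLeast0 intro!: arg_cong2[of _ _ _ _ "(*)"] prod.cong)
    finally show ?thesis ..
  qed
  then have "(\<Sum>b\<in>{b. length b = n \<and> mset b = M}. w b) =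
      (\<Sum>b\<in>{b. length b = n \<and> mset b = M}. \<Prod>(B, h)\<leftarrow>zip ?Bs ?hs. h (letters b B))"
    by (intro sum.cong) auto
  also have "\<dots> = conv_list (map2 (\<lambda>B h M. arrangements (card B) M * h M) ?Bs ?hs) M"
  proof (rule sum_lists_blocks)
    show "sorted_wrt (\<lambda>A B. A \<inter> B = {}) ?Bs"
      by (simp add: sorted_wrt_iff_nth_less pos_disjoint)
    show "\<Union>(set ?Bs) = {1..n}" using pos_cover by (simp add: atLeast0LessThan)
  qed (use a m_le in simp)
  also have "map2 (\<lambda>B h M. arrangements (card B) M * h M) ?Bs ?hs =
      map2 (\<lambda>k i M. arrangements k M * \<phi> i M) (ferm_sizes m K) a @
      map (\<lambda>k M. arrangements k M * \<psi> M) (map card (drop m K))"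
    unfolding ferm_sizes_eq cards_eq using a m_le
    by (intro nth_equalityI) (auto simp: nth_append)
  finally show ?thesis .
qed

lemma mset_word:
  assumes "length b = n"
  shows "mset b = (\<Sum>i\<leftarrow>[0..<length K]. letters b (pos i))"
proof -
  have "mset_set (\<Union>i<k. pos i) = (\<Sum>i\<leftarrow>[0..<k]. mset_set (pos i))" if "k \<le> length K" for k
    using that
  proof (induction k)
    case (Suc k)
    have "pos i \<inter> pos k = {}" if "i < k" for i using pos_disjoint[of i k] Suc.prems that by simp
    then have "(\<Union>i<k. pos i) \<inter> pos k = {}" by blast
    then have "mset_set ((\<Union>i<k. pos i) \<union> pos k) = mset_set (\<Union>i<k. pos i) + mset_set (pos k)"
      using Suc.prems by (intro mset_set_Union) auto
    moreover have "(\<Union>i<Suc k. pos i) = (\<Union>i<k. pos i) \<union> pos k" by (auto simp: less_Suc_eq)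
    ultimately show ?case using Suc by simp
  qed simp
  from this[OF order_refl] have "mset_set {1..n} = (\<Sum>i\<leftarrow>[0..<length K]. mset_set (pos i))"
    unfolding pos_cover .
  moreover have "mset b = image_mset (\<lambda>j. b ! (j - 1)) (mset_set {1..n})"
  proof -
    have "image_mset (\<lambda>j. b ! (j - 1)) (mset_set (set [1..<Suc n])) = mset (map (\<lambda>j. b ! (j - 1)) [1..<Suc n])"
      by (simp only: mset_set_set[OF distinct_upt] mset_map)
    also have "map (\<lambda>j. b ! (j - 1)) [1..<Suc n] = b"
      using assms by (intro nth_equalityI) (simp_all del: upt_Suc)
    finally show ?thesis unfolding set_upt atLeastLessThanSuc_atLeastAtMost by (rule sym)
  qed
  ultimately have "mset b = image_mset (\<lambda>j. b ! (j - 1)) (\<Sum>i\<leftarrow>[0..<length K]. mset_set (pos i))" by simp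
  also have "\<dots> = (\<Sum>i\<leftarrow>[0..<length K]. letters b (pos i))"
  proof -
    have "image_mset f (\<Sum>i\<leftarrow>is. g i) = (\<Sum>i\<leftarrow>is. image_mset f (g i))"
      for f :: "nat \<Rightarrow> nat" and g :: "nat \<Rightarrow> nat multiset" and "is" :: "nat list"
      by (induction "is") simp_all
    then show ?thesis by (simp only: letters_def)
  qed
  finally show ?thesis .
qed

section \<open>The monomial case\<close>

text \<open>\<open>vs ! k\<close> is the letter on block \<open>k\<close>. With distinct positive
  values, these fillings are the words of m.\<close>

definition fits :: "nat list \<Rightarrow> nat list \<Rightarrow> bool" where
  "fits b vs \<longleftrightarrow> (\<forall>k<length K. \<forall>j\<in>pos k. b ! (j - 1) = vs ! k)"

lemma mset_fits:
  assumes "length b = n" "fits b vs" "length vs = length K"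
  shows "mset b = powers_mset vs (ferm_sizes m K @ map card (drop m K))"
proof -
  have "letters b (pos i) = replicate_mset (card (pos i)) (vs ! i)" if "i < length K" for i
  proof -
    have "letters b (pos i) = image_mset (\<lambda>j. vs ! i) (mset_set (pos i))"
      unfolding letters_def using assms(2) that by (intro image_mset_cong_set) (simp add: fits_def)
    then show ?thesis by (simp add: image_mset_const_eq)
  qed
  then have "mset b = (\<Sum>i\<leftarrow>[0..<length K]. replicate_mset (card (pos i)) (vs ! i))"
    unfolding mset_word[OF assms(1)] by (intro arg_cong[of _ _ sum_list] map_cong) auto
  also have "\<dots> = powers_mset vs (ferm_sizes m K @ map card (drop m K))"
    unfolding powers_mset_def sizes_eq
    by (intro arg_cong[of _ _ sum_list] nth_equalityI) (simp_all add: assms(3))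
  finally show ?thesis .
qed

text \<open>The letter of a nonfermionic block is read off at its minimum. Distinctness of
  \<open>a\<close> is assumed because two fermionic blocks equal to {0} impose no relation between
  their indices; lists \<open>a\<close> with repetitions have sign 0 anyway.\<close>

lemma m_words_fits:
  assumes ab: "(a, b) \<in> m_words n m K" and a: "distinct a"
  defines "c \<equiv> map (\<lambda>B. b ! (Min B - 1)) (drop m K)"
  shows "length c = length K - m" "fits b (a @ c)" "distinct (a @ c)" "\<forall>v\<in>set (a @ c). 1 \<le> v"
proof -
  have words: "(a, b) \<in> words n m" using ab unfolding m_words_def by blast
  then have len: "length a = m" "length b = n" and ge1: "\<forall>v\<in>set a \<union> set b. 1 \<le> v"
    by (simp_all add: words_def)
  have ferm: "a ! i = b ! (j - 1) \<longleftrightarrow> j \<in> pos i" if "i < m" "j \<in> {1..n}" for i j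
    using ab that unfolding m_words_def pos_def by blast
  have same: "b ! (i - 1) = b ! (j - 1) \<longleftrightarrow> same_block K i j" if "i \<in> {1..n}" "j \<in> {1..n}" for i j
    using ab that unfolding m_words_def by blast
  show lenc: "length c = length K - m" by (simp add: c_def)
  have min: "Min (K ! k) \<in> pos k" "Min (K ! k) \<in> {1..n}" "(a @ c) ! k = b ! (Min (K ! k) - 1)"
    if "m \<le> k" "k < length K" for k
  proof -
    show "Min (K ! k) \<in> pos k"
      using that finite_block block_nonempty by (simp add: pos_nonferm)
    then show "Min (K ! k) \<in> {1..n}" using pos_subset that by blast
    show "(a @ c) ! k = b ! (Min (K ! k) - 1)"
      using that len m_le by (simp add: nth_append c_def)
  qed
  show fits: "fits b (a @ c)"
    unfolding fits_def
  proof (intro allI impI ballI)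
    fix k j assume k: "k < length K" and j: "j \<in> pos k"
    then have jn: "j \<in> {1..n}" using pos_subset by blast
    show "b ! (j - 1) = (a @ c) ! k"
    proof (cases "k < m")
      case True
      then show ?thesis using ferm[of k j] j jn len by (simp add: nth_append)
    next
      case False
      then have "same_block K j (Min (K ! k))"
        using same_block_iff[OF jn min(2)[of k]] j k min(1)[of k] by (metis not_less)
      then show ?thesis using same[OF jn min(2)[of k]] min(3)[of k] False k by simp
    qed
  qed
  show "distinct (a @ c)"
    unfolding distinct_conv_nth
  proof (intro allI impI)
    have main: "(a @ c) ! k \<noteq> (a @ c) ! l" if "k < l" "l < length K" for k l
    proof (cases "l < m")
      case True
      then show ?thesis using a that len by (simp add: nth_append nth_eq_iff_index_eq)
    next
      case False
      then have l: "m \<le> l" "l < length K" using that by auto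
      have "k < length K" using that by simp
      show ?thesis
      proof (cases "k < m")
        case True
        have "Min (K ! l) \<notin> pos k"
          using pos_unique[of k l "Min (K ! l)"] min(1)[OF l] that \<open>k < length K\<close> by auto
        then show ?thesis
          using ferm[OF True min(2)[OF l]] min(3)[OF l] True len by (simp add: nth_append)
      next
        case False
        then have k: "m \<le> k" "k < length K" using \<open>k < length K\<close> by auto
        have "\<not> same_block K (Min (K ! k)) (Min (K ! l))"
        proof
          assume "same_block K (Min (K ! k)) (Min (K ! l))"
          then obtain q where "q < length K" "Min (K ! k) \<in> pos q" "Min (K ! l) \<in> pos q"
            using same_block_iff[OF min(2)[OF k] min(2)[OF l]] by blast
          then have "q = k" "q = l"
            using pos_unique[of q k] pos_unique[of q l] min(1)[OF k] min(1)[OF l] k l by simp_all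
          then show False using \<open>k < l\<close> by simp
        qed
        then show ?thesis using same[OF min(2)[OF k] min(2)[OF l]] min(3)[OF k] min(3)[OF l] by simp
      qed
    qed
    fix k l assume "k < length (a @ c)" "l < length (a @ c)" "k \<noteq> l"
    moreover have "length (a @ c) = length K" using len lenc m_le by simp
    ultimately show "(a @ c) ! k \<noteq> (a @ c) ! l" using main[of k l] main[of l k] by (metis linorder_neqE_nat)
  qed
  show "\<forall>v\<in>set (a @ c). 1 \<le> v"
  proof
    fix v assume "v \<in> set (a @ c)"
    then consider "v \<in> set a" | B where "B \<in> set (drop m K)" "v = b ! (Min B - 1)"
      by (auto simp: c_def)
    then show "1 \<le> v"
    proof cases
      case 1
      then show ?thesis using ge1 by simp
    next
      case 2
      then obtain i where i: "i < length (drop m K)" "B = drop m K ! i" by (metis in_set_conv_nth)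
      define k where "k = m + i"
      have "m \<le> k" "k < length K" "B = K ! k" using i m_le by (simp_all add: k_def)
      then have "Min B \<in> {1..n}" using min(2) by simp
      then have "v \<in> set b" using 2 len by auto
      then show ?thesis using ge1 by simp
    qed
  qed
qed

lemma fits_m_words:
  assumes len: "length a = m" "length b = n" "length c = length K - m"
    and dist: "distinct (a @ c)" and ge1: "\<forall>v\<in>set (a @ c). 1 \<le> v" and fits: "fits b (a @ c)"
  shows "(a, b) \<in> m_words n m K"
proof -
  have lenK: "length (a @ c) = length K" using len m_le by simp
  have eq: "b ! (j - 1) = (a @ c) ! k" if "k < length K" "j \<in> pos k" for j k
    using fits that by (simp add: fits_def)
  have inj: "(a @ c) ! k = (a @ c) ! l \<longleftrightarrow> k = l" if "k < length K" "l < length K" for k l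
    using dist that lenK by (simp add: nth_eq_iff_index_eq)
  have "a ! i = b ! (j - 1) \<longleftrightarrow> j \<in> K ! i - {0}" if i: "i < m" and j: "j \<in> {1..n}" for i j
  proof -
    obtain k where k: "k < length K" "j \<in> pos k" using in_some_pos[OF j] by blast
    have "a ! i = (a @ c) ! i" "i < length K" using i len m_le by (simp_all add: nth_append)
    then have "a ! i = b ! (j - 1) \<longleftrightarrow> i = k" using eq[OF k] inj[of i k] k by auto
    also have "\<dots> \<longleftrightarrow> j \<in> pos i" using pos_unique[of i k j] k \<open>i < length K\<close> by auto
    finally show ?thesis by (simp add: pos_def)
  qed
  moreover have "b ! (i - 1) = b ! (j - 1) \<longleftrightarrow> same_block K i j" if i: "i \<in> {1..n}" and j: "j \<in> {1..n}" for i j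
  proof -
    obtain k l where k: "k < length K" "i \<in> pos k" and l: "l < length K" "j \<in> pos l"
      using in_some_pos[OF i] in_some_pos[OF j] by metis
    have "b ! (i - 1) = b ! (j - 1) \<longleftrightarrow> k = l" using eq[OF k] eq[OF l] inj k l by simp
    also have "\<dots> \<longleftrightarrow> same_block K i j"
    proof
      assume "k = l"
      with k l show "same_block K i j" unfolding same_block_iff[OF i j] by blast
    next
      assume "same_block K i j"
      then obtain q where "q < length K" "i \<in> pos q" "j \<in> pos q" unfolding same_block_iff[OF i j] by blast
      with k l show "k = l" using pos_unique[of q k i] pos_unique[of q l j] by simp
    qed
    finally show ?thesis .
  qed
  moreover have "\<forall>v\<in>set b. 1 \<le> v"
  proof
    fix v assume "v \<in> set b"
    then obtain k j where "k < length K" "j \<in> pos k" "v = b ! (j - 1)"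
      unfolding set_word[OF len(2)] by (auto simp: set_letters)
    then have "v = (a @ c) ! k" "k < length (a @ c)" using eq lenK by simp_all
    then show "1 \<le> v" using ge1 nth_mem by metis
  qed
  ultimately show ?thesis using len ge1 by (auto simp: m_words_def words_def)
qed

lemma fits_word_exists: "\<exists>b. length b = n \<and> fits b vs"
proof -
  have "\<exists>k. k < length K \<and> Suc i \<in> pos k" if "i < n" for i
    using in_some_pos[of "Suc i"] that by auto
  then obtain blk where blk: "\<And>i. i < n \<Longrightarrow> blk i < length K \<and> Suc i \<in> pos (blk i)" by metis
  let ?b = "map (\<lambda>i. vs ! blk i) [0..<n]"
  have "?b ! (j - 1) = vs ! k" if k: "k < length K" "j \<in> pos k" for j k
  proof -
    have "j \<in> {1..n}" using pos_subset k by blast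
    then obtain i where i: "j = Suc i" "i < n" by (cases j) auto
    then have "blk i = k" using pos_unique[of "blk i" k j] blk[of i] k by simp
    with i show ?thesis by simp
  qed
  then have "length ?b = n \<and> fits ?b vs" by (simp add: fits_def)
  then show ?thesis ..
qed

lemma fits_word_unique:
  assumes "length b = n" "length b' = n" "fits b vs" "fits b' vs" shows "b = b'"
proof (rule nth_equalityI)
  fix i assume "i < length b"
  then have "Suc i \<in> {1..n}" using assms by simp
  then obtain k where "k < length K" "Suc i \<in> pos k" by (rule in_some_pos)
  then show "b ! i = b' ! i" using assms by (force simp: fits_def)
qed (simp add: assms)

text \<open>A word of m is a filling of the blocks. With \<open>a\<close> fixed, the freedom left is
  the list of values of the nonfermionic blocks, and \<open>wd\<close> turns such a list into its
  word.\<close>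

lemma card_m_words:
  assumes a: "length a = m" "distinct a"
  shows "card {b. mset b = M \<and> (a, b) \<in> m_words n m K} =
    card (block_values (ferm_sizes m K) (map card (drop m K)) a M)"
proof -
  let ?V = "block_values (ferm_sizes m K) (map card (drop m K)) a M"
  define wd where "wd c = (SOME b. length b = n \<and> fits b (a @ c))" for c
  have wd: "length (wd c) = n \<and> fits (wd c) (a @ c)" for c
    unfolding wd_def by (rule someI_ex) (rule fits_word_exists)
  note b = conjunct1[OF wd] conjunct2[OF wd]
  have V: "length c = length K - m" "distinct (a @ c)" "\<forall>v\<in>set (a @ c). 1 \<le> v" "length (a @ c) = length K"
    "powers_mset (a @ c) (ferm_sizes m K @ map card (drop m K)) = M" if "c \<in> ?V" for c
    using that a m_le by (auto simp: block_values_def)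
  have "bij_betw wd ?V {b. mset b = M \<and> (a, b) \<in> m_words n m K}"
  proof (rule bij_betw_imageI)
    show "inj_on wd ?V"
    proof (rule inj_onI)
      fix c c' assume c: "c \<in> ?V" "c' \<in> ?V" "wd c = wd c'"
      show "c = c'"
      proof (rule nth_equalityI)
        show "length c = length c'" using V(1) c by simp
        fix i assume "i < length c"
        then have i: "m + i < length K" using V(1)[OF c(1)] by simp
        \<comment> \<open>A nonfermionic block has a position, at which its value can be read back
          from the word.\<close>
        then obtain j where "j \<in> pos (m + i)" using block_nonempty[OF i] by (auto simp: pos_nonferm)
        then have "wd c ! (j - 1) = (a @ c) ! (m + i)" "wd c' ! (j - 1) = (a @ c') ! (m + i)"
          using b(2)[of c] b(2)[of c'] i by (simp_all add: fits_def)
        then have "(a @ c) ! (m + i) = (a @ c') ! (m + i)" using c(3) by simp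
        then show "c ! i = c' ! i" using a(1) by (simp add: nth_append)
      qed
    qed
    show "wd ` ?V = {b. mset b = M \<and> (a, b) \<in> m_words n m K}"
    proof (intro equalityI subsetI)
      fix x assume "x \<in> wd ` ?V"
      then obtain c where c: "c \<in> ?V" "x = wd c" by blast
      have "mset x = M" using mset_fits[OF b(1)[of c] b(2)[of c]] V[OF c(1)] c(2) by simp
      moreover have "(a, x) \<in> m_words n m K"
        unfolding c(2) by (rule fits_m_words[OF a(1) b(1) V(1-3)[OF c(1)] b(2)])
      ultimately show "x \<in> {b. mset b = M \<and> (a, b) \<in> m_words n m K}" by simp
    next
      fix x assume x: "x \<in> {b. mset b = M \<and> (a, b) \<in> m_words n m K}"
      define c where "c = map (\<lambda>B. x ! (Min B - 1)) (drop m K)"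
      have len: "length x = n" using x by (auto simp: m_words_def words_def)
      have c: "length c = length K - m" "fits x (a @ c)" "distinct (a @ c)" "\<forall>v\<in>set (a @ c). 1 \<le> v"
        unfolding c_def using m_words_fits[of a x] x a(2) by simp_all
      have "M = powers_mset (a @ c) (ferm_sizes m K @ map card (drop m K))"
        using mset_fits[OF len c(2)] x a c(1) m_le by simp
      then have "c \<in> ?V" using c by (simp add: block_values_def)
      moreover have "x = wd c" using fits_word_unique[OF len b(1) c(2) b(2)] .
      ultimately show "x \<in> wd ` ?V" by blast
    qed
  qed
  then show ?thesis by (rule bij_betw_same_card[symmetric])
qed

lemma rho_nc_m: "rho (nc_m n m K) = scale (mult_fact (map card (drop m K)))
    (m_series (ferm_sizes m K) (map card (drop m K)))"
proof -
  have "rho (nc_m n m K) = rho (series_sum (\<lambda>u. scale 1 (word_val u)) (m_words n m K))"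
    by (simp add: nc_m_def scale_def)
  also have "\<dots> = alt_sum m (\<lambda>a M. \<Sum>b\<in>{b. mset b = M}. if (a, b) \<in> m_words n m K then 1 else 0)"
    by (rule rho_weighted_words) (auto simp: m_words_def)
  also have "\<dots> = alt_sum m (\<lambda>a M. mult_fact (map card (drop m K)) *
      m_coeff (mset (map card (drop m K))) (mset (zip (ferm_sizes m K) a)) M)"
  proof (rule alt_sum_cong)
    fix a :: "nat list" and M assume a: "length a = m" "distinct a"
    have "(\<Sum>b\<in>{b. mset b = M}. if (a, b) \<in> m_words n m K then 1 else 0 :: rat) =
        of_nat (card {b. mset b = M \<and> (a, b) \<in> m_words n m K})"
      by (simp add: sum.If_cases finite_mset_eq Int_def)
    then show "(\<Sum>b\<in>{b. mset b = M}. if (a, b) \<in> m_words n m K then 1 else 0) =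
        mult_fact (map card (drop m K)) * m_coeff (mset (map card (drop m K))) (mset (zip (ferm_sizes m K) a)) M"
      using card_block_values[of a "ferm_sizes m K" "map card (drop m K)" M] a zero_notin_cards
      by (simp add: card_m_words)
  qed
  finally show ?thesis by (simp add: m_series_def alt_sum_scale)
qed

end

section \<open>Products of block series\<close>

text \<open>The form in which projections and products of generators are compared: one factor for
  each part, where \<open>F\<close> also depends on the index of its \<theta>.\<close>

definition block_series ::
  "(nat \<Rightarrow> nat \<Rightarrow> nat multiset \<Rightarrow> rat) \<Rightarrow> (nat \<Rightarrow> nat multiset \<Rightarrow> rat) \<Rightarrow> nat list \<Rightarrow> nat list \<Rightarrow> cseries" where
  "block_series F G la ls = alt_sum (length la) (\<lambda>a. conv_list (map2 F la a @ map G ls))"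

lemma block_series_c_prod:
  "block_series F G la ls = c_prod (map (\<lambda>k. odd_series (F k)) la @ map (\<lambda>k. even_series (G k)) ls)"
  using c_prod_odd_even[of "map F la" "map G ls"]
  by (simp add: block_series_def o_def zip_map1 case_prod_unfold)

lemma block_series_swap_adjacent:
  "block_series F G (p @ x # y # r) ls S M = - block_series F G (p @ y # x # r) ls S M"
proof -
  \<comment> \<open>\<open>conv_list\<close> depends only on the multiset of its factors, so any
    list with the multiset \<open>Z\<close> of pairs may represent it.\<close>
  define \<Psi> where "\<Psi> Z = conv_list (map (\<lambda>(k, i). F k i) (SOME xs. mset xs = Z) @ map G ls)" for Z
  have "block_series F G la ls = alt_sum (length la) (\<lambda>a. \<Psi> (mset (zip la a)))" for la
  proof -
    have "\<Psi> (mset (zip la a)) = conv_list (map2 F la a @ map G ls)" for a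
    proof -
      have "mset (SOME xs. mset xs = mset (zip la a)) = mset (zip la a)" by (rule someI) simp
      then show ?thesis unfolding \<Psi>_def by (intro conv_list_mset_cong) simp
    qed
    then show ?thesis by (simp add: block_series_def)
  qed
  then show ?thesis using alt_sum_swap_adjacent[of p x y r \<Psi> S M] by simp
qed

lemma block_series_mset_cong:
  assumes "mset ls = mset ls'" shows "block_series F G la ls = block_series F G la ls'"
proof -
  have "conv_list (map2 F la a @ map G ls) = conv_list (map2 F la a @ map G ls')" for a
    by (rule conv_list_mset_cong) (simp add: assms)
  then show ?thesis by (simp add: block_series_def)
qed

lemma scale_scale: "scale c (scale d f) = scale (c * d) f"
  by (simp add: scale_def mult.assoc)

text \<open>The scalar depends on the size but not on the index \<open>i\<close>, so the product of
  the scalars is the same for all \<open>a\<close> and leaves the signed sum.\<close>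

lemma block_series_scale:
  assumes F: "\<And>k i M. F k i M = w k * F' k i M" and G: "\<And>k M. k \<in> set ls \<Longrightarrow> G k M = w k * G' k M"
  shows "block_series F G la ls = scale (\<Prod>k\<leftarrow>la @ ls. w k) (block_series F' G' la ls)"
proof -
  have "conv_list (map2 F la a @ map G ls) =
      (\<lambda>M. (\<Prod>k\<leftarrow>la @ ls. w k) * conv_list (map2 F' la a @ map G' ls) M)" if "length a = length la" for a
  proof -
    have "map2 F la a @ map G ls = map2 (\<lambda>c f M. c * f M) (map w (la @ ls)) (map2 F' la a @ map G' ls)"
      using that by (intro nth_equalityI) (auto simp: nth_append F G fun_eq_iff)
    then show ?thesis
      using conv_list_scale[of "map w (la @ ls)" "map2 F' la a @ map G' ls"] that by simp
  qed
  then show ?thesis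
    unfolding block_series_def alt_sum_scale[symmetric] by (intro alt_sum_cong) simp
qed

lemma m_series_swap_adjacent: "m_series (p @ x # y # r) ls S M = - m_series (p @ y # x # r) ls S M"
  unfolding m_series_def by (rule alt_sum_swap_adjacent)

lemma m_series_mset_cong: "mset ls = mset ls' \<Longrightarrow> m_series la ls = m_series la ls'"
  by (simp add: m_series_def)

abbreviation arranged_series where
  "arranged_series \<phi> \<psi> \<equiv>
    block_series (\<lambda>k i M. arrangements k M * \<phi> i M) (\<lambda>k M. arrangements k M * \<psi> M)"

text \<open>\<open>w k\<close> is the ratio between the series of a block and its generator: 1 for
  p, k! for e and h. The assumptions on ordinary parts are confined to \<open>1 \<le> k\<close>,
  which suffices because nonfermionic blocks are nonempty.\<close>

lemma rho_multiplicative: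
  assumes K: "K \<in> set_supercomps n m"
    and X: "f = arranged_series \<phi> \<psi> (ferm_sizes m K) (map card (drop m K))"
    and F: "\<And>k i M. arrangements k M * \<phi> i M = w k * F k i M"
    and G: "\<And>k M. 1 \<le> k \<Longrightarrow> arrangements k M * \<psi> M = w k * G k M"
    and ba: "\<And>k. ba k = odd_series (F k)" and bs: "\<And>k. 1 \<le> k \<Longrightarrow> bs k = even_series (G k)"
  shows "f = scale ((-1) ^ eps m K * (\<Prod>k\<leftarrow>fst (shape m K) @ snd (shape m K). w k))
      (c_prod (map ba (fst (shape m K)) @ map bs (snd (shape m K))))"
    and "i < m \<Longrightarrow> j < m \<Longrightarrow> i \<noteq> j \<Longrightarrow> card (K ! i) = card (K ! j) \<Longrightarrow> f = zero_series"
proof -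
  interpret supercomp n m K by (unfold_locales) (rule K)
  let ?T = "arranged_series \<phi> \<psi>"
  have 1: "1 \<le> k" if "k \<in> set (snd (shape m K))" for k
  proof (rule ccontr)
    assume "\<not> 1 \<le> k"
    then have "k = 0" by simp
    with that have "0 \<in> set (map card (drop m K))" by (simp only: shape_def snd_conv set_rev set_sort)
    then show False using zero_notin_cards by blast
  qed
  have T: "?T la (snd (shape m K)) = scale (\<Prod>k\<leftarrow>la @ snd (shape m K). w k)
      (c_prod (map ba la @ map bs (snd (shape m K))))" for la
  proof -
    have "map bs (snd (shape m K)) = map (\<lambda>k. even_series (G k)) (snd (shape m K))"
      "map ba la = map (\<lambda>k. odd_series (F k)) la" using ba bs 1 by simp_all
    then have "c_prod (map ba la @ map bs (snd (shape m K))) = block_series F G la (snd (shape m K))"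
      by (simp only: block_series_c_prod)
    moreover have "?T la (snd (shape m K)) =
        scale (\<Prod>k\<leftarrow>la @ snd (shape m K). w k) (block_series F G la (snd (shape m K)))"
      by (rule block_series_scale) (use F G 1 in simp_all)
    ultimately show ?thesis by simp
  qed
  have A: "?T (ferm_sizes m K) (map card (drop m K)) =
      scale ((-1) ^ eps m K) (?T (fst (shape m K)) (snd (shape m K)))"
    by (rule alternating_series_shape(1)[of ?T, OF block_series_swap_adjacent block_series_mset_cong m_le])
  show "f = scale ((-1) ^ eps m K * (\<Prod>k\<leftarrow>fst (shape m K) @ snd (shape m K). w k))
      (c_prod (map ba (fst (shape m K)) @ map bs (snd (shape m K))))"
    by (simp only: X A T scale_scale)
  show "i < m \<Longrightarrow> j < m \<Longrightarrow> i \<noteq> j \<Longrightarrow> card (K ! i) = card (K ! j) \<Longrightarrow> f = zero_series"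
    unfolding X by (rule alternating_series_shape(2)[of ?T, OF block_series_swap_adjacent block_series_mset_cong m_le])
qed

section \<open>Coefficients of the generators\<close>

lemma theta_lists_0: "theta_lists S 0 = (if S = {} then {[]} else {})"
  by (auto simp: theta_lists_def)

lemma alt_sum_0: "alt_sum 0 \<Phi> = even_series (\<Phi> [])"
  by (intro ext) (simp add: alt_sum_def theta_lists_0 even_series_def)

lemma theta_lists_1: "a \<in> theta_lists S 1 \<longleftrightarrow> (\<exists>i. a = [i] \<and> S = {i})"
  by (cases a) (auto simp: theta_lists_def)

lemma alt_sum_1: "alt_sum 1 \<Phi> = odd_series (\<lambda>i. \<Phi> [i])"
proof (intro ext)
  fix S M
  show "alt_sum 1 \<Phi> S M = odd_series (\<lambda>i. \<Phi> [i]) S M"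
  proof (cases "is_singleton S")
    case True
    then obtain i where S: "S = {i}" by (rule is_singletonE)
    have "theta_lists S 1 = {[i]}" unfolding set_eq_iff theta_lists_1 S by auto
    then show ?thesis using S by (simp add: alt_sum_def odd_series_def)
  next
    case False
    then have "theta_lists S 1 = {}" unfolding set_eq_iff theta_lists_1 is_singleton_def by blast
    then show ?thesis using False by (simp add: alt_sum_def odd_series_def)
  qed
qed

text \<open>Here and in the next five definitions the arguments are the \<theta>-index of the block,
  if it is fermionic, and the multiset of letters at its positions. Membership in
  \<open>words\<close> has to factor as well, so positivity of the indices is distributed over the
  blocks.\<close>

definition p_fermi :: "nat \<Rightarrow> nat multiset \<Rightarrow> rat" where
  "p_fermi i M = of_bool (1 \<le> i \<and> set_mset M \<subseteq> {i})"

definition p_bose :: "nat multiset \<Rightarrow> rat" where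
  "p_bose M = of_bool (\<exists>i\<ge>1. set_mset M \<subseteq> {i})"

definition e_fermi :: "nat \<Rightarrow> nat multiset \<Rightarrow> rat" where
  "e_fermi i M = of_bool (1 \<le> i \<and> i \<notin># M \<and> 0 \<notin># M \<and> (\<forall>v. count M v \<le> 1))"

definition e_bose :: "nat multiset \<Rightarrow> rat" where
  "e_bose M = of_bool (0 \<notin># M \<and> (\<forall>v. count M v \<le> 1))"

text \<open>A fermionic block meets the corresponding fermionic block of the type of the word in 0
  and in \<open>count M i\<close> positions. The identity (r+1)! = (r+1) r! separates the factor
  that is due to 0.\<close>

definition h_fermi :: "nat \<Rightarrow> nat multiset \<Rightarrow> rat" where
  "h_fermi i M = of_bool (1 \<le> i \<and> 0 \<notin># M) * of_nat (count M i + 1) * (\<Prod>v\<in>set_mset M. fact (count M v))"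

definition h_bose :: "nat multiset \<Rightarrow> rat" where
  "h_bose M = of_bool (0 \<notin># M) * (\<Prod>v\<in>set_mset M. fact (count M v))"

lemma arrangements_const:
  assumes "set_mset M \<subseteq> {i}" shows "arrangements k M = of_bool (size M = k)"
proof -
  obtain j where M: "M = replicate_mset j i" using set_mset_subset_singletonD[OF assms] by blast
  have P: "(\<Prod>v\<in>set_mset M. fact (count M v) :: rat) = fact j"
    unfolding M by (cases j) simp_all
  have "arrangements k M * fact j = of_bool (size M = k) * fact j"
    using arrangements_eq[of k M] unfolding P by (auto simp: M)
  then show ?thesis by simp
qed

lemma arrangements_distinct:
  assumes "\<forall>v. count M v \<le> 1" shows "arrangements k M = fact k * of_bool (size M = k)"
proof -
  have "(\<Prod>v\<in>set_mset M. fact (count M v) :: rat) = 1"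
  proof (rule prod.neutral, rule ballI)
    fix v
    have "count M v = 0 \<or> count M v = 1" using assms[rule_format, of v] by auto
    then show "fact (count M v) = (1 :: rat)" by auto
  qed
  with arrangements_eq[of k M] show ?thesis by simp
qed

lemma set_mset_subset_singleton_iff:
  "set_mset M \<subseteq> {i} \<and> size M = k \<longleftrightarrow> M = replicate_mset k i"
  by (auto dest: set_mset_subset_singletonD split: if_splits)

lemma arrangements_p:
  "arrangements k M * p_fermi i M = of_bool (1 \<le> i \<and> M = replicate_mset k i)"
  "arrangements k M * p_bose M = of_bool (\<exists>i\<ge>1. M = replicate_mset k i)"
proof -
  show "arrangements k M * p_fermi i M = of_bool (1 \<le> i \<and> M = replicate_mset k i)"
    unfolding set_mset_subset_singleton_iff[symmetric] p_fermi_def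
    by (cases "set_mset M \<subseteq> {i}") (auto simp: arrangements_const)
  show "arrangements k M * p_bose M = of_bool (\<exists>i\<ge>1. M = replicate_mset k i)"
  proof (cases "\<exists>i\<ge>1. set_mset M \<subseteq> {i}")
    case True
    then obtain i where i: "1 \<le> i" "set_mset M \<subseteq> {i}" by blast
    have "(\<exists>i\<ge>1. M = replicate_mset k i) \<longleftrightarrow> size M = k"
      using i True unfolding set_mset_subset_singleton_iff[symmetric] by blast
    then show ?thesis using True i(2) by (simp add: p_bose_def arrangements_const)
  next
    case False
    then show ?thesis unfolding set_mset_subset_singleton_iff[symmetric] by (auto simp: p_bose_def)
  qed
qed

lemma p_a_eq: "p_a k = odd_series (\<lambda>i M. of_bool (1 \<le> i \<and> M = replicate_mset k i))"
proof (intro ext)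
  fix S :: "nat set" and M :: "nat multiset"
  have gen: "c_mult (c_theta i) (c_x_power i k) = monomial {i} (replicate_mset k i)" for i
    by (simp add: c_mult_def c_theta_def c_x_power_eq series_mult_monomial[OF finite_plus_eq] scale_def)
  let ?I = "{i. 1 \<le> i \<and> S = {i} \<and> M = replicate_mset k i}"
  have "p_a k S M = (\<Sum>i\<in>?I. 1)"
    unfolding p_a_def series_sum_def gen monomial_def by (intro sum.cong) auto
  also have "\<dots> = odd_series (\<lambda>i M. of_bool (1 \<le> i \<and> M = replicate_mset k i)) S M"
  proof (cases "is_singleton S")
    case True
    then obtain i where S: "S = {i}" by (rule is_singletonE)
    have "?I = (if 1 \<le> i \<and> M = replicate_mset k i then {i} else {})" by (auto simp: S)
    then show ?thesis by (simp add: S odd_series_def)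
  next
    case False
    then have "?I = {}" by auto
    then show ?thesis using False by (simp only: sum.empty odd_series_def if_False)
  qed
  finally show "p_a k S M = odd_series (\<lambda>i M. of_bool (1 \<le> i \<and> M = replicate_mset k i)) S M" .
qed

text \<open>For k = 0 all summands would be the same monomial 1, infinitely often; for
  \<open>1 \<le> k\<close> the monomial determines \<open>i\<close>.\<close>

lemma p_s_eq:
  assumes "1 \<le> k" shows "p_s k = even_series (\<lambda>M. of_bool (\<exists>i\<ge>1. M = replicate_mset k i))"
proof (intro ext)
  fix S :: "nat set" and M :: "nat multiset"
  let ?I = "{i. 1 \<le> i \<and> S = {} \<and> M = replicate_mset k i}"
  have "p_s k S M = (\<Sum>i\<in>?I. 1)"
    unfolding p_s_def series_sum_def c_x_power_eq monomial_def by (intro sum.cong) auto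
  also have "\<dots> = even_series (\<lambda>M. of_bool (\<exists>i\<ge>1. M = replicate_mset k i)) S M"
  proof (cases "S = {} \<and> (\<exists>i\<ge>1. M = replicate_mset k i)")
    case True
    then obtain i where "S = {}" "1 \<le> i" "M = replicate_mset k i" by blast
    moreover from this have "?I = {i}"
      using assms by (auto simp: replicate_mset_eq_iff)
    ultimately show ?thesis by (auto simp: even_series_def)
  next
    case False
    then have none: "?I = {}" by auto
    show ?thesis unfolding none using False by (auto simp: even_series_def)
  qed
  finally show "p_s k S M = even_series (\<lambda>M. of_bool (\<exists>i\<ge>1. M = replicate_mset k i)) S M" .
qed

lemma sum_mset_exponents: "sum_mset (exponents M) = size M"
  by (simp add: exponents_def size_multiset_overloaded_eq sum_unfold_sum_mset)

lemma exponents_eq_replicate: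
  "exponents M = replicate_mset k 1 \<longleftrightarrow> (\<forall>v. count M v \<le> 1) \<and> size M = k"
proof
  assume ex: "exponents M = replicate_mset k 1"
  have "count M v = 1" if "v \<in># M" for v
  proof -
    have "count M v \<in># exponents M" using that by (simp add: exponents_def)
    then show ?thesis using ex by (auto split: if_splits)
  qed
  moreover have "size M = k" using sum_mset_exponents[of M] unfolding ex by simp
  ultimately show "(\<forall>v. count M v \<le> 1) \<and> size M = k" by (metis le_refl not_in_iff zero_le)
next
  assume M: "(\<forall>v. count M v \<le> 1) \<and> size M = k"
  have "count M v = 1" if "v \<in># M" for v
    using M that by (metis One_nat_def Suc_leI count_greater_zero_iff le_antisym)
  then have "exponents M = image_mset (\<lambda>v. 1) (mset_set (set_mset M))"
    by (auto simp: exponents_def intro!: image_mset_cong)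
  then have "exponents M = replicate_mset (card (set_mset M)) 1" by (simp add: image_mset_const_eq)
  moreover from this have "card (set_mset M) = k" using sum_mset_exponents[of M] M by simp
  ultimately show "exponents M = replicate_mset k 1" by simp
qed

lemma filter_mset_neq_id: "i \<notin># M \<Longrightarrow> {#v \<in># M. v \<noteq> i#} = M"
  by (rule multiset_eqI) (auto simp: not_in_iff)

lemma m_coeff_single:
  "m_coeff N {#(p, i)#} M = of_bool (1 \<le> i \<and> count M i = p \<and> 0 \<notin># M \<and> exponents {#v \<in># M. v \<noteq> i#} = N)"
  by (simp add: m_coeff_def)

lemma m_coeff_empty: "m_coeff N {#} M = of_bool (0 \<notin># M \<and> exponents M = N)"
  by (simp add: m_coeff_def)

lemma m_series_single: "m_series [p] ls = odd_series (\<lambda>i. m_coeff (mset ls) {#(p, i)#})"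
  using alt_sum_1[of "\<lambda>a. m_coeff (mset ls) (mset (zip [p] a))"] by (simp add: m_series_def)

lemma m_series_Nil: "m_series [] ls = even_series (m_coeff (mset ls) {#})"
  using alt_sum_0[of "\<lambda>a. m_coeff (mset ls) (mset (zip [] a))"] by (simp add: m_series_def)

text \<open>The fermionic part 0 gives x_i the exponent 0 next to \<theta>_i, which is
  \<open>i \<notin># M\<close>; the ordinary parts 1 make \<open>M\<close> free of
  repetitions.\<close>

lemma e_a_eq: "e_a k = odd_series (\<lambda>i M. of_bool (size M = k) * e_fermi i M)"
proof -
  have "m_coeff (mset (replicate k 1)) {#(0, i)#} M = of_bool (size M = k) * e_fermi i M" for i M
    by (cases "i \<in># M")
      (auto simp: m_coeff_single e_fermi_def filter_mset_neq_id exponents_eq_replicate[unfolded One_nat_def] not_in_iff)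
  then have "(\<lambda>i. m_coeff (mset (replicate k 1)) {#(0, i)#}) = (\<lambda>i M. of_bool (size M = k) * e_fermi i M)"
    by (intro ext)
  moreover have "e_a k = odd_series (\<lambda>i. m_coeff (mset (replicate k 1)) {#(0, i)#})"
    unfolding e_a_def m_series_single[symmetric] by (rule c_m_eq) simp_all
  ultimately show ?thesis by (simp only:)
qed

lemma e_s_eq: "e_s k = even_series (\<lambda>M. of_bool (size M = k) * e_bose M)"
proof -
  have "m_coeff (mset (replicate k 1)) {#} M = of_bool (size M = k) * e_bose M" for M
    by (auto simp: m_coeff_empty e_bose_def exponents_eq_replicate[unfolded One_nat_def])
  then have "m_coeff (mset (replicate k 1)) {#} = (\<lambda>M. of_bool (size M = k) * e_bose M)"
    by (intro ext)
  moreover have "e_s k = even_series (m_coeff (mset (replicate k 1)) {#})"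
    unfolding e_s_def m_series_Nil[symmetric] by (rule c_m_eq) simp_all
  ultimately show ?thesis by (simp only:)
qed

lemma arrangements_e:
  "arrangements k M * e_fermi i M = fact k * (of_bool (size M = k) * e_fermi i M)"
  "arrangements k M * e_bose M = fact k * (of_bool (size M = k) * e_bose M)"
  by (cases "\<forall>v. count M v \<le> 1"; simp add: e_fermi_def e_bose_def arrangements_distinct)+

text \<open>The factorials of the multiplicities in the weight cancel the denominator of the number
  of arrangements, so k! remains, together with the factor due to 0 in the fermionic case.\<close>

lemma arrangements_h:
  "arrangements k M * h_fermi i M =
    fact k * (of_bool (1 \<le> i \<and> 0 \<notin># M \<and> size M = k) * of_nat (count M i + 1))"
  "arrangements k M * h_bose M = fact k * of_bool (0 \<notin># M \<and> size M = k)"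
proof -
  let ?P = "\<Prod>v\<in>set_mset M. fact (count M v) :: rat"
  have "arrangements k M * h_fermi i M = of_bool (1 \<le> i \<and> 0 \<notin># M) * of_nat (count M i + 1) * (arrangements k M * ?P)"
    by (simp add: h_fermi_def)
  then show "arrangements k M * h_fermi i M =
    fact k * (of_bool (1 \<le> i \<and> 0 \<notin># M \<and> size M = k) * of_nat (count M i + 1))"
    unfolding arrangements_eq by simp
  have "arrangements k M * h_bose M = of_bool (0 \<notin># M) * (arrangements k M * ?P)"
    by (simp add: h_bose_def)
  then show "arrangements k M * h_bose M = fact k * of_bool (0 \<notin># M \<and> size M = k)"
    unfolding arrangements_eq by simp
qed

section \<open>Expansion of the complete generators\<close>

definition decreasing_exponents :: "nat multiset \<Rightarrow> nat list" where
  "decreasing_exponents M = rev (sorted_list_of_multiset (exponents M))"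

lemma mset_decreasing_exponents [simp]: "mset (decreasing_exponents M) = exponents M"
  by (simp add: decreasing_exponents_def)

lemma decreasing_exponents_unique:
  assumes "sorted_wrt (\<ge>) ls" "mset ls = exponents M" shows "ls = decreasing_exponents M"
proof -
  have "sorted (rev ls)" using assms(1) by (simp add: sorted_wrt_rev)
  then have "sorted_list_of_multiset (mset (rev ls)) = rev ls"
    by (simp only: sorted_list_of_multiset_mset sorted_sort_id)
  then show ?thesis using assms(2) by (simp add: decreasing_exponents_def)
qed

lemma decreasing_exponents_props:
  "sorted_wrt (\<ge>) (decreasing_exponents M)" "sum_list (decreasing_exponents M) = size M"
  "\<forall>k\<in>set (decreasing_exponents M). 1 \<le> k"
proof -
  show "sorted_wrt (\<ge>) (decreasing_exponents M)"
    by (simp add: decreasing_exponents_def sorted_wrt_rev)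
  show "sum_list (decreasing_exponents M) = size M"
    by (metis mset_decreasing_exponents sum_mset_exponents sum_mset_sum_list)
  have "set (decreasing_exponents M) = set_mset (exponents M)"
    by (metis mset_decreasing_exponents set_mset_mset)
  then show "\<forall>k\<in>set (decreasing_exponents M). 1 \<le> k"
    by (auto simp: exponents_def Suc_le_eq)
qed

lemma c_m_superpart: "(la, ls) \<in> superparts k d \<Longrightarrow> c_m (la, ls) = m_series la ls"
proof (rule c_m_eq)
  assume *: "(la, ls) \<in> superparts k d"
  then have "sorted_wrt (>) la" by (simp add: superparts_def)
  then show "distinct la" by (auto simp: sorted_wrt_iff_nth_less distinct_conv_nth) (metis linorder_neqE_nat less_irrefl)
  show "0 \<notin> set ls" using * by (auto simp: superparts_def)
qed

text \<open>At \<theta>_i and \<open>M\<close> at most one superpartition contributes: its fermionic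
  part is the exponent of x_i, and its other parts are the exponents of the remaining letters. So
  the coefficient \<Omega>_1 + 1 becomes \<open>count M i + 1\<close>.\<close>

lemma h_a_eq: "h_a k = odd_series (\<lambda>i M. of_bool (1 \<le> i \<and> 0 \<notin># M \<and> size M = k) * of_nat (count M i + 1))"
proof (intro ext)
  fix S :: "nat set" and M :: "nat multiset"
  let ?F = "\<lambda>\<Omega>. scale (of_nat (hd (fst \<Omega>) + 1)) (c_m \<Omega>) S M"
  have F: "?F \<Omega> = (if is_singleton S then of_nat (p + 1) * m_coeff (mset ls) {#(p, the_elem S)#} M else 0)"
    if "\<Omega> \<in> superparts k 1" "\<Omega> = ([p], ls)" for \<Omega> p ls
    using that c_m_superpart[of "[p]" ls k 1] by (simp add: scale_def m_series_single odd_series_def)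
  have sp: "\<exists>p ls. \<Omega> = ([p], ls)" if "\<Omega> \<in> superparts k 1" for \<Omega>
    using that by (auto simp: superparts_def length_Suc_conv)
  show "h_a k S M = odd_series (\<lambda>i M. of_bool (1 \<le> i \<and> 0 \<notin># M \<and> size M = k) * of_nat (count M i + 1)) S M"
  proof (cases "is_singleton S")
    case False
    have "?F \<Omega> = 0" if \<Omega>: "\<Omega> \<in> superparts k 1" for \<Omega>
    proof -
      obtain p ls where "\<Omega> = ([p], ls)" using sp[OF \<Omega>] by blast
      from F[OF \<Omega> this] False show ?thesis by (simp only: if_False)
    qed
    then have none: "{\<Omega> \<in> superparts k 1. ?F \<Omega> \<noteq> 0} = {}" by blast
    show ?thesis using False unfolding h_a_def series_sum_def none by (simp only: sum.empty odd_series_def if_False)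
  next
    case True
    then obtain i where S: "S = {i}" by (rule is_singletonE)
    let ?M = "{#v \<in># M. v \<noteq> i#}"
    let ?\<Omega> = "([count M i], decreasing_exponents ?M)"
    have size: "count M i + size ?M = size M"
    proof -
      have "size M = size {#v \<in># M. v = i#} + size ?M"
        by (simp only: size_union[symmetric] multiset_partition[symmetric])
      then show ?thesis by (simp add: filter_eq_replicate_mset)
    qed
    have eq: "\<Omega> = ?\<Omega> \<and> 1 \<le> i \<and> 0 \<notin># M \<and> size M = k" if \<Omega>: "\<Omega> \<in> superparts k 1" "?F \<Omega> \<noteq> 0" for \<Omega>
    proof -
      obtain p ls where ls: "\<Omega> = ([p], ls)" using sp \<Omega>(1) by blast
      have "sorted_wrt (\<ge>) ls" "p + sum_list ls = k" using \<Omega>(1) by (simp_all add: ls superparts_def)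
      moreover have "1 \<le> i" "count M i = p" "0 \<notin># M" "exponents ?M = mset ls"
        using F[OF \<Omega>(1) ls] \<Omega>(2) by (simp_all add: S m_coeff_single)
      ultimately show ?thesis
        using decreasing_exponents_unique[of ls ?M] size decreasing_exponents_props(2)[of ?M] by (simp add: ls)
    qed
    have val: "?\<Omega> \<in> superparts k 1 \<and> ?F ?\<Omega> = of_nat (count M i + 1)" if "1 \<le> i \<and> 0 \<notin># M \<and> size M = k"
    proof -
      have "?\<Omega> \<in> superparts k 1"
        using that size decreasing_exponents_props[of ?M] by (simp add: superparts_def)
      then show ?thesis using F[OF _ refl, of "count M i" "decreasing_exponents ?M"] that
        by (simp add: S m_coeff_single)
    qed
    show ?thesis
    proof (cases "1 \<le> i \<and> 0 \<notin># M \<and> size M = k")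
      case True
      have "?F ?\<Omega> \<noteq> 0" using val[OF True] by (simp only: of_nat_eq_0_iff)
      then have one: "{\<Omega> \<in> superparts k 1. ?F \<Omega> \<noteq> 0} = {?\<Omega>}" using eq val[OF True] by blast
      have "h_a k S M = ?F ?\<Omega>" unfolding h_a_def series_sum_def one by simp
      then show ?thesis using val[OF True] True by (simp add: S odd_series_def)
    next
      case False
      then have none: "{\<Omega> \<in> superparts k 1. ?F \<Omega> \<noteq> 0} = {}" using eq by blast
      have "h_a k S M = 0" unfolding h_a_def series_sum_def none by simp
      then show ?thesis using False by (auto simp: S odd_series_def)
    qed
  qed
qed

lemma h_s_eq: "h_s k = even_series (\<lambda>M. of_bool (0 \<notin># M \<and> size M = k))"
proof (intro ext)
  fix S :: "nat set" and M :: "nat multiset"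
  have F: "c_m \<Omega> S M = (if S = {} then m_coeff (mset ls) {#} M else 0)"
    if "\<Omega> \<in> superparts k 0" "\<Omega> = ([], ls)" for \<Omega> ls
    using that c_m_superpart[of "[]" ls k 0] by (simp add: m_series_Nil even_series_def)
  have sp: "\<exists>ls. \<Omega> = ([], ls)" if "\<Omega> \<in> superparts k 0" for \<Omega>
    using that by (auto simp: superparts_def)
  let ?\<Omega> = "([], decreasing_exponents M)"
  have eq: "\<Omega> = ?\<Omega> \<and> S = {} \<and> 0 \<notin># M \<and> size M = k" if \<Omega>: "\<Omega> \<in> superparts k 0" "c_m \<Omega> S M \<noteq> 0" for \<Omega>
  proof -
    obtain ls where ls: "\<Omega> = ([], ls)" using sp \<Omega>(1) by blast
    have "sorted_wrt (\<ge>) ls" "sum_list ls = k" using \<Omega>(1) by (simp_all add: ls superparts_def)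
    moreover have "S = {}" "0 \<notin># M" "exponents M = mset ls"
      using F[OF \<Omega>(1) ls] \<Omega>(2) by (auto simp: m_coeff_empty split: if_splits)
    ultimately show ?thesis
      using decreasing_exponents_unique[of ls M] decreasing_exponents_props(2)[of M] by (simp add: ls)
  qed
  have val: "?\<Omega> \<in> superparts k 0 \<and> c_m ?\<Omega> S M = 1" if "S = {} \<and> 0 \<notin># M \<and> size M = k"
  proof -
    have "?\<Omega> \<in> superparts k 0"
      using that decreasing_exponents_props[of M] by (simp add: superparts_def)
    then show ?thesis using F[OF _ refl, of "decreasing_exponents M"] that by (simp add: m_coeff_empty)
  qed
  show "h_s k S M = even_series (\<lambda>M. of_bool (0 \<notin># M \<and> size M = k)) S M"
  proof (cases "S = {} \<and> 0 \<notin># M \<and> size M = k")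
    case True
    have "c_m ?\<Omega> S M \<noteq> 0" using val[OF True] by simp
    then have one: "{\<Omega> \<in> superparts k 0. c_m \<Omega> S M \<noteq> 0} = {?\<Omega>}" using eq val[OF True] by blast
    have "h_s k S M = c_m ?\<Omega> S M" unfolding h_s_def series_sum_def one by simp
    then show ?thesis using val[OF True] True by (simp add: even_series_def)
  next
    case False
    then have none: "{\<Omega> \<in> superparts k 0. c_m \<Omega> S M \<noteq> 0} = {}" using eq by blast
    have "h_s k S M = 0" unfolding h_s_def series_sum_def none by simp
    then show ?thesis using False by (auto simp: even_series_def)
  qed
qed

lemma prod_of_bool: "finite A \<Longrightarrow> (\<Prod>i\<in>A. of_bool (P i)) = (of_bool (\<forall>i\<in>A. P i) :: rat)"
  by (induction A rule: finite_induct) auto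

section \<open>Factorization of the words of p and e over the blocks\<close>

context supercomp
begin

text \<open>The factorization of the membership test is asked for distinct \<open>a\<close>, since
  the other lists carry the sign 0.\<close>

lemma rho_blockwise:
  assumes X: "X \<subseteq> words n m"
    and w: "\<And>a b. length a = m \<Longrightarrow> distinct a \<Longrightarrow> length b = n \<Longrightarrow> (if (a, b) \<in> X then 1 else 0) =
      (\<Prod>i<m. \<phi> (a ! i) (letters b (pos i))) * (\<Prod>i\<in>{m..<length K}. \<psi> (letters b (pos i)))"
  shows "rho (series_sum word_val X) =
    arranged_series \<phi> \<psi> (ferm_sizes m K) (map card (drop m K))"
proof -
  have "rho (series_sum word_val X) = rho (series_sum (\<lambda>u. scale 1 (word_val u)) X)"
    by (simp add: scale_def)
  also have "\<dots> = alt_sum m (\<lambda>a M. \<Sum>b\<in>{b. mset b = M}. if (a, b) \<in> X then 1 else 0)"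
    by (rule rho_weighted_words[OF X])
  also have "\<dots> = alt_sum m (\<lambda>a. conv_list (map2 (\<lambda>k i M. arrangements k M * \<phi> i M) (ferm_sizes m K) a @
      map (\<lambda>k M. arrangements k M * \<psi> M) (map card (drop m K))))"
  proof (rule alt_sum_cong)
    fix a :: "nat list" and M assume a: "length a = m" "distinct a"
    have "(\<Sum>b\<in>{b. mset b = M}. if (a, b) \<in> X then 1 else 0) =
        (\<Sum>b\<in>{b. length b = n \<and> mset b = M}. if (a, b) \<in> X then 1 else (0 :: rat))"
      using X by (intro sum.mono_neutral_right) (auto simp: finite_mset_eq words_def)
    also have "\<dots> = conv_list (map2 (\<lambda>k i M. arrangements k M * \<phi> i M) (ferm_sizes m K) a @
        map (\<lambda>k M. arrangements k M * \<psi> M) (map card (drop m K))) M"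
      by (rule sum_words_blocks[OF a(1)]) (rule w[OF a])
    finally show "(\<Sum>b\<in>{b. mset b = M}. if (a, b) \<in> X then 1 else 0) =
      conv_list (map2 (\<lambda>k i M. arrangements k M * \<phi> i M) (ferm_sizes m K) a @
        map (\<lambda>k M. arrangements k M * \<psi> M) (map card (drop m K))) M" .
  qed
  finally show ?thesis by (simp only: block_series_def length_ferm_sizes)
qed

lemma nth_in_letters: "i < length K \<Longrightarrow> j \<in> pos i \<Longrightarrow> b ! (j - 1) \<in># letters b (pos i)"
  unfolding set_letters by (rule imageI)

text \<open>On a fermionic block every letter is \<open>a ! i\<close>, so positivity of that index
  covers the block; on a nonfermionic block the common letter \<open>v\<close> has to be positive
  itself.\<close>

lemma p_words_iff:
  assumes len: "length a = m" "length b = n"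
  shows "(a, b) \<in> p_words n m K \<longleftrightarrow>
    (\<forall>i<m. 1 \<le> a ! i \<and> set_mset (letters b (pos i)) \<subseteq> {a ! i}) \<and>
    (\<forall>i\<in>{m..<length K}. \<exists>v\<ge>1. set_mset (letters b (pos i)) \<subseteq> {v})" (is "?L \<longleftrightarrow> ?A \<and> ?B")
proof
  assume L: ?L
  then have ge1: "\<forall>v\<in>set a \<union> set b. 1 \<le> v"
    and ferm: "\<forall>i<m. \<forall>j\<in>pos i. a ! i = b ! (j - 1)"
    and same: "\<forall>i\<in>{1..n}. \<forall>j\<in>{1..n}. same_block K i j \<longrightarrow> b ! (i - 1) = b ! (j - 1)"
    unfolding p_words_def words_def pos_def by blast+
  have ?A
  proof (intro allI impI conjI)
    fix i assume i: "i < m"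
    have "a ! i \<in> set a" using i len by simp
    then show "1 \<le> a ! i" using ge1 by blast
    show "set_mset (letters b (pos i)) \<subseteq> {a ! i}"
    proof
      fix v assume "v \<in># letters b (pos i)"
      then obtain j where j: "j \<in> pos i" "v = b ! (j - 1)" using i m_le by (auto simp: set_letters)
      then have "a ! i = b ! (j - 1)" using ferm i by blast
      then show "v \<in> {a ! i}" using j(2) by simp
    qed
  qed
  moreover have ?B
  proof
    fix i assume "i \<in> {m..<length K}"
    then have i: "m \<le> i" "i < length K" by auto
    \<comment> \<open>The witness \<open>v\<close> is the letter at an arbitrary position, which
      exists because a nonfermionic block is nonempty.\<close>
    then obtain j where j: "j \<in> pos i" using block_nonempty[OF i(2)] unfolding pos_nonferm[OF i] by blast
    then have jn: "j \<in> {1..n}" using pos_subset i by blast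
    have "set_mset (letters b (pos i)) \<subseteq> {b ! (j - 1)}"
    proof
      fix v assume "v \<in># letters b (pos i)"
      then obtain l where l: "l \<in> pos i" "v = b ! (l - 1)" using i by (auto simp: set_letters)
      then have ln: "l \<in> {1..n}" using pos_subset i by blast
      have "same_block K l j" unfolding same_block_iff[OF ln jn] using i l j by blast
      then show "v \<in> {b ! (j - 1)}" using same ln jn l by blast
    qed
    moreover have "1 \<le> b ! (j - 1)"
    proof -
      have "j - 1 < length b" using jn len by auto
      then show ?thesis using ge1 nth_mem by blast
    qed
    ultimately show "\<exists>v\<ge>1. set_mset (letters b (pos i)) \<subseteq> {v}" by blast
  qed
  ultimately show "?A \<and> ?B" ..
next
  assume R: "?A \<and> ?B"
  have const: "\<exists>v\<ge>1. set_mset (letters b (pos i)) \<subseteq> {v}" if "i < length K" for i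
  proof (cases "i < m")
    case True
    with R have "1 \<le> a ! i \<and> set_mset (letters b (pos i)) \<subseteq> {a ! i}" by simp
    then show ?thesis by blast
  next
    case False
    with R that show ?thesis by simp
  qed
  have "1 \<le> v" if v: "v \<in> set a \<union> set b" for v
  proof (cases "v \<in> set a")
    case True
    then obtain i where "i < m" "v = a ! i" using len by (auto simp: in_set_conv_nth)
    then show ?thesis using R by simp
  next
    case False
    then obtain i where "i < length K" "v \<in># letters b (pos i)" using v unfolding set_word[OF len(2)] by blast
    moreover from this obtain w where "1 \<le> w" "set_mset (letters b (pos i)) \<subseteq> {w}" using const[of i] by blast
    ultimately have "v = w" by blast
    with \<open>1 \<le> w\<close> show ?thesis by simp
  qed
  then have w: "(a, b) \<in> words n m" using len unfolding words_def by blast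
  have ferm: "a ! i = b ! (j - 1)" if "i < m" "j \<in> K ! i - {0}" for i j
  proof -
    have i: "i < length K" using that m_le by simp
    have "j \<in> pos i" using that(2) unfolding pos_def .
    then have mem: "b ! (j - 1) \<in># letters b (pos i)" by (rule nth_in_letters[OF i])
    have "set_mset (letters b (pos i)) \<subseteq> {a ! i}" using conjunct1[OF R, rule_format, OF that(1)] by (rule conjunct2)
    from subsetD[OF this mem] show ?thesis by simp
  qed
  have same: "b ! (i - 1) = b ! (j - 1)" if ij: "i \<in> {1..n}" "j \<in> {1..n}" "same_block K i j" for i j
  proof -
    obtain k where k: "k < length K" "i \<in> pos k" "j \<in> pos k" using ij same_block_iff[OF ij(1,2)] by blast
    obtain v where v: "set_mset (letters b (pos k)) \<subseteq> {v}" using const[OF k(1)] by blast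
    from subsetD[OF v nth_in_letters[OF k(1,2)]] subsetD[OF v nth_in_letters[OF k(1,3)]]
    show ?thesis by simp
  qed
  show ?L
    unfolding p_words_def mem_Collect_eq prod.case
  proof (intro conjI allI ballI impI)
    show "(a, b) \<in> words n m" by (rule w)
  qed (rule ferm same; assumption)+
qed

lemma rho_nc_p: "rho (nc_p n m K) =
    arranged_series p_fermi p_bose (ferm_sizes m K) (map card (drop m K))"
  unfolding nc_p_def
proof (rule rho_blockwise)
  fix a b :: "nat list" assume len: "length a = m" "length b = n"
  have "(\<Prod>i<m. p_fermi (a ! i) (letters b (pos i))) * (\<Prod>i\<in>{m..<length K}. p_bose (letters b (pos i))) =
      of_bool ((a, b) \<in> p_words n m K)"
    unfolding p_fermi_def p_bose_def p_words_iff[OF len]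
    by (simp only: prod_of_bool finite_lessThan finite_atLeastLessThan Ball_def lessThan_iff flip: of_bool_conj)
  then show "(if (a, b) \<in> p_words n m K then 1 else 0) =
      (\<Prod>i<m. p_fermi (a ! i) (letters b (pos i))) * (\<Prod>i\<in>{m..<length K}. p_bose (letters b (pos i)))"
    by (simp only: of_bool_def)
qed (auto simp: p_words_def)

lemma count_letters: "i < length K \<Longrightarrow> count (letters b (pos i)) v = card {j \<in> pos i. b ! (j - 1) = v}"
  by (simp add: letters_def count_image_mset_eq_card_vimage)

lemma count_letters_le_1:
  assumes "i < length K"
  shows "(\<forall>v. count (letters b (pos i)) v \<le> 1) \<longleftrightarrow> inj_on (\<lambda>j. b ! (j - 1)) (pos i)"
proof -
  have "count (letters b (pos i)) v \<le> 1 \<longleftrightarrow>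
      (\<forall>j\<in>pos i. \<forall>l\<in>pos i. b ! (j - 1) = v \<longrightarrow> b ! (l - 1) = v \<longrightarrow> j = l)" for v
    using assms by (simp add: count_letters card_le_Suc0_iff_eq) blast
  then show ?thesis unfolding inj_on_def by blast
qed

text \<open>Different letters at the positions of a block mean multiplicities at most 1. Positivity
  of \<open>b\<close> is spread over all blocks as absence of the letter 0, also over the fermionic
  ones, whose letters now differ from \<open>a ! i\<close>.\<close>

lemma e_words_iff:
  assumes len: "length a = m" "length b = n"
  shows "(a, b) \<in> e_words n m K \<longleftrightarrow>
    (\<forall>i<m. 1 \<le> a ! i \<and> a ! i \<notin># letters b (pos i) \<and> 0 \<notin># letters b (pos i) \<and>
      (\<forall>v. count (letters b (pos i)) v \<le> 1)) \<and>
    (\<forall>i\<in>{m..<length K}. 0 \<notin># letters b (pos i) \<and> (\<forall>v. count (letters b (pos i)) v \<le> 1))"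
    (is "?L \<longleftrightarrow> ?A \<and> ?B")
proof -
  have words: "(a, b) \<in> words n m \<longleftrightarrow> (\<forall>i<m. 1 \<le> a ! i) \<and> (\<forall>i<length K. 0 \<notin># letters b (pos i))"
  proof -
    have "(\<forall>v\<in>set a. 1 \<le> v) \<longleftrightarrow> (\<forall>i<m. 1 \<le> a ! i)" using len by (simp add: all_set_conv_all_nth)
    moreover have "(\<forall>v\<in>set b. 1 \<le> v) \<longleftrightarrow> (\<forall>i<length K. 0 \<notin># letters b (pos i))"
    proof -
      have "(\<forall>v\<in>set b. 1 \<le> v) \<longleftrightarrow> 0 \<notin> set b" by (metis less_one not_less)
      then show ?thesis unfolding set_word[OF len(2)] by blast
    qed
    moreover have "(a, b) \<in> words n m \<longleftrightarrow> (\<forall>v\<in>set a. 1 \<le> v) \<and> (\<forall>v\<in>set b. 1 \<le> v)"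
      using len unfolding words_def by blast
    ultimately show ?thesis by (simp only:)
  qed
  have ferm: "(\<forall>j\<in>K ! i - {0}. a ! i \<noteq> b ! (j - 1)) \<longleftrightarrow> a ! i \<notin># letters b (pos i)" if "i < m" for i
  proof -
    have "i < length K" using that m_le by simp
    then show ?thesis by (force simp: set_letters pos_def[symmetric] simp del: One_nat_def)
  qed
  have same: "(\<forall>i\<in>{1..n}. \<forall>j\<in>{1..n}. i \<noteq> j \<and> same_block K i j \<longrightarrow> b ! (i - 1) \<noteq> b ! (j - 1)) \<longleftrightarrow>
      (\<forall>k<length K. \<forall>v. count (letters b (pos k)) v \<le> 1)" (is "?P \<longleftrightarrow> ?Q")
  proof
    assume P: ?P
    show ?Q
    proof (intro allI impI)
      fix k v assume k: "k < length K"
      have "inj_on (\<lambda>j. b ! (j - 1)) (pos k)"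
      proof (rule inj_onI, rule ccontr)
        fix i j assume ij: "i \<in> pos k" "j \<in> pos k" "b ! (i - 1) = b ! (j - 1)" "i \<noteq> j"
        then have n: "i \<in> {1..n}" "j \<in> {1..n}" using pos_subset[OF k] by blast+
        then have "same_block K i j" using ij k same_block_iff[OF n] by blast
        then show False using P n ij by blast
      qed
      then show "count (letters b (pos k)) v \<le> 1" using count_letters_le_1[OF k] by blast
    qed
  next
    assume Q: ?Q
    show ?P
    proof (intro ballI impI)
      fix i j assume n: "i \<in> {1..n}" "j \<in> {1..n}" and ij: "i \<noteq> j \<and> same_block K i j"
      then obtain k where k: "k < length K" "i \<in> pos k" "j \<in> pos k" using same_block_iff[OF n] by blast
      then have "inj_on (\<lambda>j. b ! (j - 1)) (pos k)" using Q count_letters_le_1[OF k(1)] by blast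
      then show "b ! (i - 1) \<noteq> b ! (j - 1)" using k ij unfolding inj_on_def by blast
    qed
  qed
  have "?L \<longleftrightarrow> (a, b) \<in> words n m \<and> (\<forall>i<m. \<forall>j\<in>K ! i - {0}. a ! i \<noteq> b ! (j - 1)) \<and>
      (\<forall>i\<in>{1..n}. \<forall>j\<in>{1..n}. i \<noteq> j \<and> same_block K i j \<longrightarrow> b ! (i - 1) \<noteq> b ! (j - 1))"
    unfolding e_words_def by blast
  also have "\<dots> \<longleftrightarrow> (\<forall>i<m. 1 \<le> a ! i) \<and> (\<forall>i<m. a ! i \<notin># letters b (pos i)) \<and>
      (\<forall>k<length K. 0 \<notin># letters b (pos k) \<and> (\<forall>v. count (letters b (pos k)) v \<le> 1))"
    unfolding words same using ferm by blast
  also have "\<dots> \<longleftrightarrow> ?A \<and> ?B"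
  proof -
    have "(\<forall>k<length K. R k) \<longleftrightarrow> (\<forall>k<m. R k) \<and> (\<forall>k\<in>{m..<length K}. R k)" for R
    proof -
      have "{..<length K} = {..<m} \<union> {m..<length K}" using m_le by auto
      then show ?thesis by (metis Un_iff lessThan_iff)
    qed
    from this[of "\<lambda>k. 0 \<notin># letters b (pos k) \<and> (\<forall>v. count (letters b (pos k)) v \<le> 1)"]
    show ?thesis by blast
  qed
  finally show ?thesis .
qed

lemma rho_nc_e: "rho (nc_e n m K) =
    arranged_series e_fermi e_bose (ferm_sizes m K) (map card (drop m K))"
  unfolding nc_e_def
proof (rule rho_blockwise)
  fix a b :: "nat list" assume len: "length a = m" "length b = n"
  have "(\<Prod>i<m. e_fermi (a ! i) (letters b (pos i))) * (\<Prod>i\<in>{m..<length K}. e_bose (letters b (pos i))) =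
      of_bool ((a, b) \<in> e_words n m K)"
    unfolding e_fermi_def e_bose_def e_words_iff[OF len]
    by (simp only: prod_of_bool finite_lessThan finite_atLeastLessThan Ball_def lessThan_iff flip: of_bool_conj)
  then show "(if (a, b) \<in> e_words n m K then 1 else 0) =
      (\<Prod>i<m. e_fermi (a ! i) (letters b (pos i))) * (\<Prod>i\<in>{m..<length K}. e_bose (letters b (pos i)))"
    by (simp only: of_bool_def)
qed (auto simp: e_words_def)

end

section \<open>The meet of two supercompositions\<close>

text \<open>The minima are sorted instead of the blocks; injectivity of \<open>Min\<close> allows
  passing back from a minimum to its block.\<close>

lemma min_sorted_list_exists:
  assumes fin: "finite P" and inj: "inj_on Min (P :: nat set set)"
  shows "\<exists>Bs. set Bs = P \<and> distinct Bs \<and> sorted_wrt (\<lambda>A B. Min A < Min B) Bs"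
proof -
  let ?g = "inv_into P Min"
  let ?ms = "sorted_list_of_set (Min ` P)"
  let ?Bs = "map ?g ?ms"
  have g: "?g (Min B) = B" if "B \<in> P" for B using inj that by (rule inv_into_f_f)
  have set_ms: "set ?ms = Min ` P" using fin by simp
  have ming: "Min (?g x) = x" if "x \<in> set ?ms" for x
    using that unfolding set_ms by (rule f_inv_into_f)
  have "set ?Bs = P" unfolding set_map set_ms image_image using g by simp
  moreover have "sorted_wrt (\<lambda>A B. Min A < Min B) ?Bs"
  proof -
    have "sorted_wrt (<) ?ms" by simp
    then have "sorted_wrt (\<lambda>x y. Min (?g x) < Min (?g y)) ?ms"
      by (rule sorted_wrt_mono_rel[rotated]) (simp only: ming)
    then show ?thesis by (simp only: sorted_wrt_map)
  qed
  moreover have "distinct ?Bs"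
    unfolding distinct_map
  proof (rule conjI)
    show "inj_on ?g (set ?ms)" using ming by (metis inj_on_inverseI)
  qed simp
  ultimately show ?thesis by blast
qed

lemma inj_on_Min:
  fixes P :: "nat set set"
  assumes "\<And>B. B \<in> P \<Longrightarrow> finite B \<and> B \<noteq> {}" and "\<And>B C. B \<in> P \<Longrightarrow> C \<in> P \<Longrightarrow> B \<inter> C \<noteq> {} \<Longrightarrow> B = C"
  shows "inj_on Min P"
proof (rule inj_onI)
  fix B C assume BC: "B \<in> P" "C \<in> P" "Min B = Min C"
  then have "Min B \<in> B" "Min C \<in> C" using assms(1) Min_in by blast+
  then have "B \<inter> C \<noteq> {}" using BC(3) by (metis IntI empty_iff)
  then show "B = C" using assms(2) BC by blast
qed

text \<open>Serves two constructions, the meet and the type of a word. In both the fermionic blocks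
  come as a list, but the others only as a set, which still has to be ordered by minima.\<close>

lemma supercomp_exists:
  assumes "m \<le> n + 1" and Fs: "length Fs = m" "\<And>i. i < m \<Longrightarrow> 0 \<in> Fs ! i \<and> Fs ! i \<subseteq> {0..n}"
    and P: "finite P" "\<And>B. B \<in> P \<Longrightarrow> B \<noteq> {} \<and> B \<subseteq> {1..n}"
    and FF: "\<And>i j. i < m \<Longrightarrow> j < m \<Longrightarrow> i \<noteq> j \<Longrightarrow> Fs ! i \<inter> Fs ! j \<subseteq> {0}"
    and FP: "\<And>i B. i < m \<Longrightarrow> B \<in> P \<Longrightarrow> Fs ! i \<inter> B = {}"
    and PP: "\<And>B C. B \<in> P \<Longrightarrow> C \<in> P \<Longrightarrow> B \<inter> C \<noteq> {} \<Longrightarrow> B = C"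
    and cover: "\<And>x. x \<in> {1..n} \<Longrightarrow> (\<exists>i<m. x \<in> Fs ! i) \<or> (\<exists>B\<in>P. x \<in> B)"
  shows "\<exists>L\<in>set_supercomps n m. take m L = Fs \<and> set (drop m L) = P \<and> distinct (drop m L)"
proof -
  have "finite B \<and> B \<noteq> {}" if "B \<in> P" for B
    using P(2)[OF that] finite_subset[of B "{1..n}"] by blast
  then have "inj_on Min P" by (rule inj_on_Min[OF _ PP])
  from min_sorted_list_exists[OF P(1) this]
  obtain Bs where Bs: "set Bs = P" "distinct Bs" "sorted_wrt (\<lambda>A B. Min A < Min B) Bs" by blast
  let ?L = "Fs @ Bs"
  have nth: "?L ! i = (if i < m then Fs ! i else Bs ! (i - m))" for i using Fs(1) by (simp add: nth_append)
  have BsP: "Bs ! (i - m) \<in> P" if "\<not> i < m" "i < length ?L" for i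
  proof -
    have "i - m < length Bs" using that Fs(1) by simp
    then show ?thesis using Bs(1) nth_mem by blast
  qed
  have mem: "B \<in> set ?L \<longleftrightarrow> (\<exists>i<m. B = Fs ! i) \<or> B \<in> P" for B
    unfolding set_append Un_iff Bs(1) using Fs(1) by (metis in_set_conv_nth)
  have "?L \<in> set_supercomps n m"
    unfolding set_supercomps_def mem_Collect_eq
  proof (intro conjI ballI allI impI)
    show "m \<le> n + 1" by fact
    show "m \<le> length ?L" using Fs(1) by simp
  next
    fix B assume "B \<in> set ?L"
    then consider i where "i < m" "B = Fs ! i" | "B \<in> P" unfolding mem by blast
    then have "B \<noteq> {} \<and> B \<subseteq> {0..n}"
    proof cases
      case 1
      then show ?thesis using Fs(2)[of i] by blast
    next
      case 2
      have "{1..n} \<subseteq> {0..n}" by auto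
      then show ?thesis using P(2)[OF 2] by blast
    qed
    then show "B \<noteq> {}" "B \<subseteq> {0..n}" by blast+
  next
    show "(\<Union>B\<in>set ?L. B - {0}) = {1..n}"
    proof (intro equalityI subsetI)
      fix x assume "x \<in> (\<Union>B\<in>set ?L. B - {0})"
      then obtain B where B: "B \<in> set ?L" "x \<in> B" "x \<noteq> 0" by blast
      from B(1) have "x \<in> {0..n}"
        unfolding mem using Fs(2) P(2) B(2) by fastforce
      then show "x \<in> {1..n}" using B(3) by simp
    next
      fix x assume x: "x \<in> {1..n}"
      then obtain B where "B \<in> set ?L" "x \<in> B" using cover[OF x] unfolding mem by blast
      then show "x \<in> (\<Union>B\<in>set ?L. B - {0})" using x by auto
    qed
  next
    fix i j assume ij: "i < length ?L" "j < length ?L" "i \<noteq> j"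
    show "?L ! i \<inter> ?L ! j \<subseteq> {0}"
    proof (cases "i < m"; cases "j < m")
      assume "i < m" "j < m"
      then show ?thesis using FF ij(3) by (simp add: nth)
    next
      assume "i < m" "\<not> j < m"
      then show ?thesis using FP[OF _ BsP] ij by (simp add: nth)
    next
      assume "\<not> i < m" "j < m"
      then show ?thesis using FP[OF _ BsP, of j i] ij by (simp add: nth Int_commute)
    next
      assume n: "\<not> i < m" "\<not> j < m"
      have "i - m \<noteq> j - m" "i - m < length Bs" "j - m < length Bs" using n ij Fs(1) by auto
      then have "Bs ! (i - m) \<noteq> Bs ! (j - m)" using Bs(2) by (simp add: nth_eq_iff_index_eq)
      then have "Bs ! (i - m) \<inter> Bs ! (j - m) = {}" using PP[OF BsP BsP] n ij by blast
      then show ?thesis using n by (simp add: nth)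
    qed
  next
    fix i assume i: "i < length ?L"
    show "0 \<in> ?L ! i \<longleftrightarrow> i < m"
    proof (cases "i < m")
      case True
      then show ?thesis using Fs(2)[of i] by (simp add: nth)
    next
      case False
      then have "Bs ! (i - m) \<subseteq> {1..n}" using P(2)[OF BsP] i by blast
      then have "0 \<notin> Bs ! (i - m)" by auto
      then show ?thesis using False by (simp add: nth)
    qed
  next
    fix i j assume ij: "m \<le> i \<and> i < j \<and> j < length ?L"
    then have "i - m < j - m" "j - m < length Bs" using Fs(1) by auto
    then have "Min (Bs ! (i - m)) < Min (Bs ! (j - m))" by (rule sorted_wrt_nth_less[OF Bs(3)])
    then show "Min (?L ! i) < Min (?L ! j)" using ij by (simp add: nth)
  qed
  moreover have "take m ?L = Fs" "drop m ?L = Bs" using Fs(1) by simp_all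
  ultimately show ?thesis using Bs by metis
qed

section \<open>Refinement as containment of blocks, and the meet\<close>

context supercomp
begin

lemma block_unique:
  assumes "B \<in> set K" "C \<in> set K" "x \<in> B" "x \<in> C" "x \<noteq> 0"
  shows "B = C"
proof -
  obtain i j where ij: "i < length K" "B = K ! i" "j < length K" "C = K ! j"
    using assms(1,2) by (metis in_set_conv_nth)
  then have "i = j" using pos_unique[of i j x] assms by (simp add: pos_def)
  with ij show ?thesis by simp
qed

lemma ferm_in_set: "i < m \<Longrightarrow> K ! i \<in> set K"
  using m_le by simp

lemma nonferm_set:
  assumes "B \<in> set (drop m K)"
  shows "B \<in> set K" "0 \<notin> B" "B \<noteq> {}" "B \<subseteq> {1..n}" "finite B"
proof -
  obtain i where i: "i < length (drop m K)" "B = drop m K ! i" using assms by (metis in_set_conv_nth)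
  then have k: "m \<le> m + i" "m + i < length K" "B = K ! (m + i)" using m_le by simp_all
  show "B \<in> set K" using assms by (rule in_set_dropD)
  show "0 \<notin> B" using zero_in_block[OF k(2)] k(3) by simp
  show "B \<noteq> {}" using block_nonempty[OF k(2)] k(3) by simp
  show "B \<subseteq> {1..n}" using pos_subset[OF k(2)] unfolding pos_nonferm[OF k(1,2)] k(3) .
  show "finite B" using finite_block[OF k(2)] k(3) by simp
qed

lemma block_cases:
  assumes "B \<in> set K"
  obtains i where "i < m" "B = K ! i" | "B \<in> set (drop m K)"
proof -
  obtain i where i: "i < length K" "B = K ! i" using assms by (metis in_set_conv_nth)
  show thesis
  proof (cases "i < m")
    case True
    then show ?thesis using that(1) i by blast
  next
    case False
    then have "i - m < length (drop m K)" "drop m K ! (i - m) = B" using i m_le by simp_all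
    then have "B \<in> set (drop m K)" using nth_mem by blast
    then show ?thesis by (rule that(2))
  qed
qed

lemma in_some_block:
  assumes "x \<in> {1..n}" obtains B where "B \<in> set K" "x \<in> B"
proof -
  obtain i where "i < length K" "x \<in> pos i" using assms by (rule in_some_pos)
  then show thesis using that[of "K ! i"] by (simp add: pos_def)
qed

lemma ferm_subset: "i < m \<Longrightarrow> K ! i \<subseteq> {0..n}" and ferm_zero: "i < m \<Longrightarrow> 0 \<in> K ! i"
  using block_subset[of i] zero_in_block[of i] m_le by simp_all

lemma ferm_unique: "i < m \<Longrightarrow> j < m \<Longrightarrow> x \<in> K ! i \<Longrightarrow> x \<in> K ! j \<Longrightarrow> x \<noteq> 0 \<Longrightarrow> i = j"
  using pos_unique[of i j x] m_le by (simp add: pos_def)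

lemma ferm_neq_nonferm:
  assumes "i < m" "B \<in> set (drop m K)" shows "K ! i \<noteq> B"
  using ferm_zero[OF assms(1)] nonferm_set(2)[OF assms(2)] by blast

text \<open>Disjoint nonempty blocks have different minima, so the set of nonfermionic blocks
  determines their order.\<close>

lemma supercomp_eqI:
  assumes L: "L \<in> set_supercomps n m" and ferm: "take m K = take m L" and nonferm: "set (drop m K) = set (drop m L)"
  shows "K = L"
proof -
  interpret L: supercomp n m L by (unfold_locales) (rule L)
  have sorted: "sorted_wrt (<) (map Min (drop m K'))" if "K' \<in> set_supercomps n m" for K'
  proof -
    have *: "\<forall>i j. m \<le> i \<and> i < j \<and> j < length K' \<longrightarrow> Min (K' ! i) < Min (K' ! j)" and le: "m \<le> length K'"
      using that unfolding set_supercomps_def by blast+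
    show ?thesis
      unfolding sorted_wrt_iff_nth_less
    proof (intro allI impI)
      fix i j assume "i < j" "j < length (map Min (drop m K'))"
      then show "map Min (drop m K') ! i < map Min (drop m K') ! j"
        using *[rule_format, of "m + i" "m + j"] le by simp
    qed
  qed
  have "map Min (drop m K) = map Min (drop m L)"
    by (rule strict_sorted_equal[OF sorted[OF L] sorted[OF K]]) (simp only: set_map nonferm)
  moreover have "inj_on Min (set (drop m K))"
  proof (rule inj_on_Min)
    fix B C assume "B \<in> set (drop m K)" "C \<in> set (drop m K)" "B \<inter> C \<noteq> {}"
    then show "B = C" using block_unique nonferm_set(1,2) by (metis Int_emptyI)
  qed (use nonferm_set in blast)
  ultimately have "drop m K = drop m L"
    using nonferm by (metis Un_absorb inj_on_map_eq_map map_inj_on)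
  with ferm show ?thesis by (metis append_take_drop_id)
qed

text \<open>With \<open>refinesI\<close> this trades unions of blocks for containment, which suits
  intersections. \<open>B\<close> shares an element with some block of \<open>K'\<close>; that block
  is assembled from blocks of \<open>K\<close>, and by disjointness the one with the shared element
  is \<open>B\<close>.\<close>

lemma refinesD:
  assumes K': "K' \<in> set_supercomps n m" and r: "Defs.refines m K K'"
  shows "i < m \<Longrightarrow> K ! i \<subseteq> K' ! i" and "B \<in> set (drop m K) \<Longrightarrow> \<exists>C\<in>set K'. B \<subseteq> C"
proof -
  interpret K': supercomp n m K' by (unfold_locales) (rule K')
  have ferm: "\<exists>N\<subseteq>set (drop m K). K' ! i = K ! i \<union> \<Union>N" if "i < m" for i
    by (rule conjunct1[OF r[unfolded Defs.refines_def], rule_format, OF that])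
  have nonferm: "\<exists>N\<subseteq>set (drop m K). C = \<Union>N" if "C \<in> set (drop m K')" for C
    by (rule bspec[OF conjunct2[OF r[unfolded Defs.refines_def]] that])
  show "K ! i \<subseteq> K' ! i" if "i < m"
  proof -
    from ferm[OF that] obtain N where "K' ! i = K ! i \<union> \<Union>N" by blast
    then show ?thesis by simp
  qed
  assume B: "B \<in> set (drop m K)"
  note B' = nonferm_set[OF B]
  obtain x where x: "x \<in> B" using B'(3) by blast
  have xn: "x \<in> {1..n}" using B'(4) x by (rule subsetD)
  then have x0: "x \<noteq> 0" by simp
  obtain C where C: "C \<in> set K'" "x \<in> C" using xn by (rule K'.in_some_block)
  have sub: "B \<subseteq> C" if N: "N \<subseteq> set (drop m K)" "x \<in> \<Union>N" "\<Union>N \<subseteq> C" for N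
  proof -
    obtain D where D: "D \<in> N" "x \<in> D" using N(2) by blast
    have "D \<in> set K" using subsetD[OF N(1) D(1)] by (rule nonferm_set(1))
    then have "B = D" by (rule block_unique[OF B'(1) _ x D(2) x0])
    then show ?thesis using D(1) N(3) by auto
  qed
  from C(1) have "B \<subseteq> C"
  proof (cases rule: K'.block_cases)
    case (1 i)
    obtain N where N: "N \<subseteq> set (drop m K)" "K' ! i = K ! i \<union> \<Union>N" using ferm[OF 1(1)] by blast
    \<comment> \<open>So \<open>x\<close> comes from the nonfermionic constituents \<open>N\<close>;
      otherwise \<open>B\<close> would be the fermionic block \<open>K ! i\<close>.\<close>
    have "x \<notin> K ! i"
    proof
      assume "x \<in> K ! i"
      then have "K ! i = B" by (rule block_unique[OF ferm_in_set[OF 1(1)] B'(1) _ x x0])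
      then show False using ferm_neq_nonferm[OF 1(1) B] by simp
    qed
    then have "x \<in> \<Union>N" "\<Union>N \<subseteq> C" using N(2) 1(2) C(2) by simp_all
    then show ?thesis by (rule sub[OF N(1)])
  next
    case 2
    obtain N where N: "N \<subseteq> set (drop m K)" "C = \<Union>N" using nonferm[OF 2] by blast
    have "x \<in> \<Union>N" "\<Union>N \<subseteq> C" using N(2) C(2) by simp_all
    then show ?thesis by (rule sub[OF N(1)])
  qed
  then show "\<exists>C\<in>set K'. B \<subseteq> C" using C(1) by blast
qed

text \<open>The collections to exhibit are the largest possible: all nonfermionic blocks of
  \<open>K\<close> inside the given block of \<open>K'\<close>. They fill it because the blocks of
  \<open>K\<close> cover all positions; \<open>key\<close> locates the block of \<open>K\<close>
  around each nonzero \<open>x\<close>.\<close>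

lemma refinesI:
  assumes K': "K' \<in> set_supercomps n m" and ferm: "\<And>i. i < m \<Longrightarrow> K ! i \<subseteq> K' ! i"
    and nonferm: "\<And>B. B \<in> set (drop m K) \<Longrightarrow> \<exists>C\<in>set K'. B \<subseteq> C"
  shows "Defs.refines m K K'"
proof -
  interpret K': supercomp n m K' by (unfold_locales) (rule K')
  have key: "(\<exists>i<m. x \<in> K ! i \<and> C = K' ! i) \<or> (\<exists>B\<in>set (drop m K). x \<in> B \<and> B \<subseteq> C)"
    if C: "C \<in> set K'" and x: "x \<in> C" "x \<noteq> 0" for C x
  proof -
    obtain k where k: "k < length K'" "C = K' ! k" using C by (metis in_set_conv_nth)
    then have "x \<in> K'.pos k" using x by (simp add: K'.pos_def)
    then have "x \<in> {1..n}" using K'.pos_subset[OF k(1)] by (rule rev_subsetD)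
    then obtain B where B: "B \<in> set K" "x \<in> B" by (rule in_some_block)
    from B(1) show ?thesis
    proof (cases rule: block_cases)
      case (1 i)
      then have xi: "x \<in> K ! i" using B(2) by simp
      then have "x \<in> K' ! i" using ferm[OF 1(1)] by blast
      then have "C = K' ! i" by (rule K'.block_unique[OF C K'.ferm_in_set[OF 1(1)] x(1) _ x(2)])
      with 1(1) xi have "i < m \<and> x \<in> K ! i \<and> C = K' ! i" by simp
      then show ?thesis by (intro disjI1 exI[of _ i])
    next
      case 2
      then obtain C' where C': "C' \<in> set K'" "B \<subseteq> C'" using nonferm by blast
      have "x \<in> C'" using B(2) C'(2) by blast
      then have "C = C'" by (rule K'.block_unique[OF C C'(1) x(1) _ x(2)])
      then have "B \<subseteq> C" using C'(2) by simp
      then show ?thesis using 2 B(2) by blast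
    qed
  qed
  show ?thesis
    unfolding Defs.refines_def
  proof (intro conjI allI impI ballI)
    fix i assume i: "i < m"
    let ?N = "{B \<in> set (drop m K). B \<subseteq> K' ! i}"
    have "K' ! i = K ! i \<union> \<Union>?N"
    proof (intro equalityI subsetI)
      fix x assume x: "x \<in> K' ! i"
      show "x \<in> K ! i \<union> \<Union>?N"
      proof (cases "x = 0")
        case True
        then show ?thesis using ferm_zero[OF i] by blast
      next
        case False
        have ji: "j = i" if "j < m" "x \<in> K ! j" for j
        proof (rule K'.ferm_unique[OF that(1) i _ x False])
          show "x \<in> K' ! j" using ferm[OF that(1)] that(2) by (rule subsetD)
        qed
        from key[OF K'.ferm_in_set[OF i] x False] show ?thesis
        proof (elim disjE exE conjE bexE)
          fix j assume "j < m" "x \<in> K ! j"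
          with ji[OF this] show ?thesis by simp
        next
          fix B assume "B \<in> set (drop m K)" "x \<in> B" "B \<subseteq> K' ! i"
          then show ?thesis by blast
        qed
      qed
    next
      fix x assume "x \<in> K ! i \<union> \<Union>?N"
      then show "x \<in> K' ! i" using ferm[OF i] by blast
    qed
    then show "\<exists>N\<subseteq>set (drop m K). K' ! i = K ! i \<union> \<Union>N"
      by (intro exI[of _ ?N] conjI) simp_all
  next
    fix C assume C: "C \<in> set (drop m K')"
    let ?N = "{B \<in> set (drop m K). B \<subseteq> C}"
    have "C = \<Union>?N"
    proof (intro equalityI subsetI)
      fix x assume x: "x \<in> C"
      then have "x \<noteq> 0" using K'.nonferm_set(2)[OF C] by metis
      from key[OF K'.nonferm_set(1)[OF C] x this] show "x \<in> \<Union>?N"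
      proof (elim disjE exE conjE bexE)
        fix j assume "j < m" "C = K' ! j"
        then show ?thesis using K'.ferm_neq_nonferm[of j C] C by simp
      next
        fix B assume "B \<in> set (drop m K)" "x \<in> B" "B \<subseteq> C"
        then show ?thesis by blast
      qed
    qed blast
    then show "\<exists>N\<subseteq>set (drop m K). C = \<Union>N"
      by (intro exI[of _ ?N] conjI) simp_all
  qed
qed

lemma refines_nonferm_subset:
  assumes K': "K' \<in> set_supercomps n m" and r: "Defs.refines m K K'" "Defs.refines m K' K"
  shows "set (drop m K) \<subseteq> set (drop m K')"
proof
  interpret K': supercomp n m K' by (unfold_locales) (rule K')
  fix B assume B: "B \<in> set (drop m K)"
  note B' = nonferm_set[OF B]
  obtain x where x: "x \<in> B" using B'(3) by blast
  then have x0: "x \<noteq> 0" using B'(2) by metis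
  obtain C where C: "C \<in> set K'" "B \<subseteq> C" using refinesD(2)[OF K' r(1) B] by blast
  from C(1) show "B \<in> set (drop m K')"
  proof (cases rule: K'.block_cases)
    case (1 i)
    then have "x \<in> K ! i" using C(2) x K'.refinesD(1)[OF K r(2) 1(1)] by blast
    then have "K ! i = B" using block_unique[OF ferm_in_set[OF 1(1)] B'(1) _ x x0] by blast
    then show ?thesis using ferm_neq_nonferm[OF 1(1) B] by blast
  next
    case 2
    then obtain D where D: "D \<in> set K" "C \<subseteq> D" using K'.refinesD(2)[OF K r(2)] by blast
    then have "B = D" using block_unique[OF B'(1) D(1) x _ x0] C(2) x by blast
    then have "B = C" using C(2) D(2) by blast
    then show ?thesis using 2 by blast
  qed
qed

text \<open>Makes the greatest lower bound unique, so that the \<open>THE\<close> in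
  \<open>meet\<close> can be evaluated.\<close>

lemma refines_antisym:
  assumes K': "K' \<in> set_supercomps n m" and r: "Defs.refines m K K'" "Defs.refines m K' K"
  shows "K = K'"
proof (rule supercomp_eqI[OF K'])
  interpret K': supercomp n m K' by (unfold_locales) (rule K')
  show "take m K = take m K'"
  proof (rule nth_equalityI)
    fix i assume "i < length (take m K)"
    then have i: "i < m" by simp
    then show "take m K ! i = take m K' ! i"
      using refinesD(1)[OF K' r(1) i] K'.refinesD(1)[OF K r(2) i] by simp
  qed (use m_le K'.m_le in simp)
  show "set (drop m K) = set (drop m K')"
    using refines_nonferm_subset[OF K' r] K'.refines_nonferm_subset[OF K r(2,1)] by blast
qed

text \<open>The meet has the fermionic blocks \<open>K ! i \<inter> L ! i\<close>, and its
  nonfermionic blocks are the nonempty intersections of all other pairs of position sets; fermionic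
  blocks with different indices also meet in a nonfermionic one. As 0! = 1, the product can run over
  all pairs, and the summand 1 on the diagonal counts the element 0.\<close>

lemma tuple_fact_meet:
  assumes L: "L \<in> set_supercomps n m"
  shows "tuple_fact (meet n m K L) =
    (\<Prod>i<length K. \<Prod>j<length L. fact (card (pos i \<inter> supercomp.pos L j) + of_bool (i = j \<and> i < m)))"
proof -
  interpret L: supercomp n m L by (unfold_locales) (rule L)
  define I where "I = {(i, j). i < length K \<and> j < length L \<and> \<not> (i = j \<and> i < m)}"
  define g where "g = (\<lambda>(i, j). pos i \<inter> L.pos j)"
  define Fs where "Fs = map (\<lambda>i. K ! i \<inter> L ! i) [0..<m]"
  define P where "P = g ` {p \<in> I. g p \<noteq> {}}"
  have finI: "finite I"
    by (rule finite_subset[of _ "{..<length K} \<times> {..<length L}"]) (auto simp: I_def)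
  have Fs: "length Fs = m" "i < m \<Longrightarrow> Fs ! i = K ! i \<inter> L ! i" for i by (simp_all add: Fs_def)
  have g_eq: "p = q" if "p \<in> I" "q \<in> I" "x \<in> g p" "x \<in> g q" for p q x
  proof -
    obtain i j k l where pq: "p = (i, j)" "q = (k, l)" by (cases p, cases q)
    have "i = k" "j = l"
      using that pos_unique[of i k x] L.pos_unique[of j l x] unfolding pq I_def g_def by simp_all
    then show ?thesis using pq by simp
  qed
  have inP: "\<exists>i j. i < length K \<and> j < length L \<and> \<not> (i = j \<and> i < m) \<and> B = pos i \<inter> L.pos j \<and> B \<noteq> {}"
    if BP: "B \<in> P" for B
  proof -
    obtain p where p: "p \<in> I" "B = g p" "B \<noteq> {}" using BP unfolding P_def by blast
    then show ?thesis by (cases p) (auto simp: I_def g_def)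
  qed
  have Pin: "pos i \<inter> L.pos j \<in> P"
    if "i < length K" "j < length L" "\<not> (i = j \<and> i < m)" "x \<in> pos i" "x \<in> L.pos j" for i j x
  proof -
    have "(i, j) \<in> {p \<in> I. g p \<noteq> {}}" using that unfolding I_def g_def by blast
    from imageI[OF this, of g] show ?thesis unfolding P_def g_def by simp
  qed
  have "\<exists>N\<in>set_supercomps n m. take m N = Fs \<and> set (drop m N) = P \<and> distinct (drop m N)"
  proof (rule supercomp_exists[OF m_le_Suc Fs(1)])
    fix i assume i: "i < m"
    show "0 \<in> Fs ! i \<and> Fs ! i \<subseteq> {0..n}"
      unfolding Fs(2)[OF i] using ferm_zero[OF i] L.ferm_zero[OF i] ferm_subset[OF i] by blast
  next
    show "finite P" unfolding P_def using finI by simp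
  next
    fix B assume "B \<in> P"
    then obtain i where i: "i < length K" "B \<subseteq> pos i" "B \<noteq> {}" using inP[of B] by auto
    then show "B \<noteq> {} \<and> B \<subseteq> {1..n}" using pos_subset[OF i(1)] by auto
  next
    fix i j assume ij: "i < m" "j < m" "i \<noteq> j"
    show "Fs ! i \<inter> Fs ! j \<subseteq> {0}"
    proof (rule subsetI, rule ccontr)
      fix x assume "x \<in> Fs ! i \<inter> Fs ! j" "x \<notin> {0}"
      then have "x \<in> K ! i" "x \<in> K ! j" "x \<noteq> 0" using Fs(2) ij by simp_all
      then have "i = j" by (rule ferm_unique[OF ij(1,2)])
      then show False using ij(3) by simp
    qed
  next
    fix k B assume k: "k < m" and "B \<in> P"
    then obtain i j where ij: "i < length K" "j < length L" "\<not> (i = j \<and> i < m)" "B = pos i \<inter> L.pos j"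
      using inP[of B] by auto
    show "Fs ! k \<inter> B = {}"
    proof (rule ccontr)
      assume "Fs ! k \<inter> B \<noteq> {}"
      then obtain x where x: "x \<in> K ! k" "x \<in> L ! k" "x \<in> pos i" "x \<in> L.pos j"
        unfolding Fs(2)[OF k] ij(4) by blast
      have "x \<noteq> 0" using x(3) unfolding pos_def by simp
      then have xk: "x \<in> pos k" "x \<in> L.pos k" using x(1,2) unfolding pos_def L.pos_def by simp_all
      have "k < length K" "k < length L" using k m_le L.m_le by simp_all
      then have "i = k" "j = k"
        using pos_unique[of i k x] L.pos_unique[of j k x] ij(1,2) x(3,4) xk by simp_all
      then show False using ij(3) k by simp
    qed
  next
    fix B C assume "B \<in> P" "C \<in> P" "B \<inter> C \<noteq> {}"
    obtain p where p: "p \<in> I" "B = g p" using \<open>B \<in> P\<close> unfolding P_def by blast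
    obtain q where q: "q \<in> I" "C = g q" using \<open>C \<in> P\<close> unfolding P_def by blast
    obtain x where "x \<in> B" "x \<in> C" using \<open>B \<inter> C \<noteq> {}\<close> by blast
    then have "p = q" unfolding p(2) q(2) by (rule g_eq[OF p(1) q(1)])
    then show "B = C" using p q by simp
  next
    fix x assume x: "x \<in> {1..n}"
    obtain i where i: "i < length K" "x \<in> pos i" using x by (rule in_some_pos)
    obtain j where j: "j < length L" "x \<in> L.pos j" using x by (rule L.in_some_pos)
    show "(\<exists>i<m. x \<in> Fs ! i) \<or> (\<exists>B\<in>P. x \<in> B)"
    proof (cases "i = j \<and> i < m")
      case True
      then have "x \<in> Fs ! i" using i j Fs(2)[of i] unfolding pos_def L.pos_def by simp
      then show ?thesis using True by blast
    next
      case False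
      have "pos i \<inter> L.pos j \<in> P" by (rule Pin[OF i(1) j(1) False i(2) j(2)])
      moreover have "x \<in> pos i \<inter> L.pos j" using i(2) j(2) by simp
      ultimately show ?thesis by blast
    qed
  qed
  then obtain N where N: "N \<in> set_supercomps n m" "take m N = Fs" "set (drop m N) = P" "distinct (drop m N)"
    by blast
  interpret N: supercomp n m N by (unfold_locales) (rule N(1))
  have N_ferm: "N ! i = K ! i \<inter> L ! i" if "i < m" for i
    using N(2) that Fs(2)[OF that] by (metis nth_take)
  have NK: "Defs.refines m N K"
  proof (rule N.refinesI[OF K])
    fix B assume "B \<in> set (drop m N)"
    then obtain i where i: "i < length K" "B \<subseteq> pos i" using inP[of B] unfolding N(3) by auto
    then have "B \<subseteq> K ! i" unfolding pos_def by blast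
    with nth_mem[OF i(1)] show "\<exists>C\<in>set K. B \<subseteq> C" by blast
  qed (simp add: N_ferm)
  have NL: "Defs.refines m N L"
  proof (rule N.refinesI[OF L])
    fix B assume "B \<in> set (drop m N)"
    then obtain j where j: "j < length L" "B \<subseteq> L.pos j" using inP[of B] unfolding N(3) by auto
    then have "B \<subseteq> L ! j" unfolding L.pos_def by blast
    with nth_mem[OF j(1)] show "\<exists>C\<in>set L. B \<subseteq> C" by blast
  qed (simp add: N_ferm)
  \<comment> \<open>A nonfermionic block of \<open>N'\<close> lies in one block of \<open>K\<close>
    and one of \<open>L\<close>. It omits 0, so it lies in \<open>pos i \<inter> L.pos j\<close>, or
    in the fermionic block \<open>N ! i\<close> if \<open>i = j < m\<close>.\<close>
  have greatest: "Defs.refines m N' N" if N': "N' \<in> set_supercomps n m" "Defs.refines m N' K" "Defs.refines m N' L" for N'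
  proof -
    interpret N': supercomp n m N' by (unfold_locales) (rule N'(1))
    show ?thesis
    proof (rule N'.refinesI[OF N(1)])
      fix i assume i: "i < m"
      show "N' ! i \<subseteq> N ! i"
        unfolding N_ferm[OF i] using N'.refinesD(1)[OF K N'(2) i] N'.refinesD(1)[OF L N'(3) i] by blast
    next
      fix B assume B: "B \<in> set (drop m N')"
      note B' = N'.nonferm_set[OF B]
      obtain x where x: "x \<in> B" using B'(3) by blast
      obtain C D where CD: "C \<in> set K" "B \<subseteq> C" "D \<in> set L" "B \<subseteq> D"
        using N'.refinesD(2)[OF K N'(2) B] N'.refinesD(2)[OF L N'(3) B] by blast
      then obtain i j where ij: "i < length K" "C = K ! i" "j < length L" "D = L ! j"
        by (metis in_set_conv_nth)
      have sub: "B \<subseteq> pos i" "B \<subseteq> L.pos j"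
        using CD(2,4) B'(2) unfolding pos_def L.pos_def ij(2,4) by auto
      show "\<exists>C\<in>set N. B \<subseteq> C"
      proof (cases "i = j \<and> i < m")
        case True
        then have "B \<subseteq> N ! i" using N_ferm CD ij by simp
        then show ?thesis using N.ferm_in_set True by blast
      next
        case False
        have "pos i \<inter> L.pos j \<in> P"
          by (rule Pin[OF ij(1,3) False subsetD[OF sub(1) x] subsetD[OF sub(2) x]])
        then have "pos i \<inter> L.pos j \<in> set N" using N.nonferm_set(1) N(3) by blast
        then show ?thesis using sub by blast
      qed
    qed
  qed
  have "meet n m K L = N"
    unfolding meet_def
  proof (rule the_equality)
    show "N \<in> set_supercomps n m \<and> Defs.refines m N K \<and> Defs.refines m N L \<and>
        (\<forall>N'\<in>set_supercomps n m. Defs.refines m N' K \<and> Defs.refines m N' L \<longrightarrow> Defs.refines m N' N)"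
      using N(1) NK NL greatest by blast
  next
    fix N' assume N': "N' \<in> set_supercomps n m \<and> Defs.refines m N' K \<and> Defs.refines m N' L \<and>
        (\<forall>N''\<in>set_supercomps n m. Defs.refines m N'' K \<and> Defs.refines m N'' L \<longrightarrow> Defs.refines m N'' N')"
    then have "Defs.refines m N' N" by (intro greatest) simp_all
    moreover have "Defs.refines m N N'" using N' N(1) NK NL by blast
    ultimately have "N = N'" using N.refines_antisym[of N'] N' by simp
    then show "N' = N" ..
  qed
  moreover have "tuple_fact N = (\<Prod>i<m. fact (card (K ! i \<inter> L ! i))) * (\<Prod>B\<in>P. fact (card B))"
  proof -
    have "tuple_fact N = (\<Prod>B\<leftarrow>take m N @ drop m N. fact (card B))" by (simp only: tuple_fact_def append_take_drop_id)
    also have "\<dots> = (\<Prod>B\<leftarrow>take m N. fact (card B)) * (\<Prod>B\<leftarrow>drop m N. fact (card B))"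
      by (simp only: map_append prod_list.append)
    also have "(\<Prod>B\<leftarrow>drop m N. fact (card B) :: rat) = (\<Prod>B\<in>P. fact (card B))"
      unfolding N(3)[symmetric] by (rule prod.distinct_set_conv_list[OF N(4), symmetric])
    also have "(\<Prod>B\<leftarrow>take m N. fact (card B) :: rat) = (\<Prod>i<m. fact (card (K ! i \<inter> L ! i)))"
      unfolding N(2) Fs_def by (simp add: prod.list_conv_set_nth lessThan_atLeast0)
    finally show ?thesis .
  qed
  \<comment> \<open>Passing from blocks back to pairs: \<open>g\<close> is injective on the pairs
    with nonempty intersection, and the other pairs contribute 0! = 1.\<close>
  moreover have "(\<Prod>B\<in>P. fact (card B) :: rat) = (\<Prod>p\<in>I. fact (card (g p)))"
  proof -
    have "inj_on g {p \<in> I. g p \<noteq> {}}"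
    proof (rule inj_onI)
      fix p q assume pq: "p \<in> {p \<in> I. g p \<noteq> {}}" "q \<in> {p \<in> I. g p \<noteq> {}}" "g p = g q"
      then obtain x where "x \<in> g p" by blast
      then show "p = q" using g_eq[of p q x] pq by simp
    qed
    then have "(\<Prod>B\<in>P. fact (card B) :: rat) = (\<Prod>p\<in>{p \<in> I. g p \<noteq> {}}. fact (card (g p)))"
      unfolding P_def by (simp add: prod.reindex)
    also have "\<dots> = (\<Prod>p\<in>I. fact (card (g p)))"
      using finI by (intro prod.mono_neutral_left) auto
    finally show ?thesis .
  qed
  moreover have "(\<Prod>i<m. fact (card (K ! i \<inter> L ! i)) :: rat) = (\<Prod>i<m. fact (card (g (i, i)) + 1))"
  proof (rule prod.cong[OF refl])
    fix i assume "i \<in> {..<m}"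
    then have i: "i < m" by simp
    have "K ! i \<inter> L ! i = insert 0 (g (i, i))"
      using ferm_zero[OF i] L.ferm_zero[OF i] unfolding g_def pos_def L.pos_def by auto
    moreover have "0 \<notin> g (i, i)" "finite (g (i, i))"
      using i m_le unfolding g_def by (simp_all add: pos_def finite_block)
    ultimately show "fact (card (K ! i \<inter> L ! i)) = (fact (card (g (i, i)) + 1) :: rat)" by simp
  qed
  moreover have "(\<Prod>i<length K. \<Prod>j<length L. fact (card (pos i \<inter> L.pos j) + of_bool (i = j \<and> i < m))) =
      (\<Prod>i<m. fact (card (g (i, i)) + 1)) * (\<Prod>p\<in>I. fact (card (g p)) :: rat)"
  proof -
    let ?f = "\<lambda>(i, j). fact (card (g (i, j)) + of_bool (i = j \<and> i < m)) :: rat"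
    let ?D = "(\<lambda>i. (i, i)) ` {..<m}"
    have split: "{..<length K} \<times> {..<length L} = ?D \<union> I" "?D \<inter> I = {}"
      using m_le L.m_le by (auto simp: I_def)
    have "(\<Prod>i<length K. \<Prod>j<length L. fact (card (pos i \<inter> L.pos j) + of_bool (i = j \<and> i < m))) =
        prod ?f ({..<length K} \<times> {..<length L})"
      by (simp add: prod.cartesian_product g_def)
    also have "\<dots> = prod ?f ?D * prod ?f I"
      unfolding split(1) using finI split(2) by (intro prod.union_disjoint) auto
    also have "prod ?f ?D = (\<Prod>i<m. fact (card (g (i, i)) + 1))"
      by (subst prod.reindex) (auto simp: inj_on_def)
    also have "prod ?f I = (\<Prod>p\<in>I. fact (card (g p)))"
      by (intro prod.cong refl) (auto simp: I_def)
    finally show ?thesis .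
  qed
  ultimately show ?thesis by simp
qed

end

section \<open>The complete functions\<close>

definition positions :: "nat list \<Rightarrow> nat \<Rightarrow> nat set" where
  "positions b v = {j \<in> {1..length b}. b ! (j - 1) = v}"

lemma positions_nonempty: "v \<in> set b \<Longrightarrow> positions b v \<noteq> {}"
proof -
  assume "v \<in> set b"
  then obtain i where "i < length b" "b ! i = v" by (auto simp: in_set_conv_nth)
  then have "Suc i \<in> positions b v" by (simp add: positions_def)
  then show ?thesis by blast
qed

lemma nth_pred_in_set: "j \<in> {1..length b} \<Longrightarrow> b ! (j - 1) \<in> set b"
  by (auto intro: nth_mem)

text \<open>The positions of the letter \<open>a ! i\<close> together with 0 form the fermionic
  blocks, and the positions of each letter outside \<open>a\<close> form a nonfermionic one.
  Distinctness of \<open>a\<close> keeps the fermionic blocks disjoint outside 0.\<close>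

lemma word_supercomp_exists:
  assumes m: "m \<le> n + 1" and words: "(a, b) \<in> words n m" and a: "distinct a"
  shows "\<exists>L\<in>set_supercomps n m. (a, b) \<in> m_words n m L"
proof -
  have len: "length a = m" "length b = n" using words by (simp_all add: words_def)
  define Fs where "Fs = map (\<lambda>v. insert 0 (positions b v)) a"
  define P where "P = positions b ` (set b - set a)"
  have Fs: "length Fs = m" "i < m \<Longrightarrow> Fs ! i = insert 0 (positions b (a ! i))" for i
    using len by (simp_all add: Fs_def)
  have pos: "positions b v \<subseteq> {1..n}" for v using len by (auto simp: positions_def)
  have eq: "v = w" if "x \<in> positions b v" "x \<in> positions b w" for x v w
    using that by (simp add: positions_def)
  have "\<exists>L\<in>set_supercomps n m. take m L = Fs \<and> set (drop m L) = P \<and> distinct (drop m L)"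
  proof (rule supercomp_exists[OF m Fs(1)])
    fix i assume "i < m"
    have "{1..n} \<subseteq> {0..n}" by auto
    then show "0 \<in> Fs ! i \<and> Fs ! i \<subseteq> {0..n}" using Fs(2)[OF \<open>i < m\<close>] pos[of "a ! i"] by auto
  next
    show "finite P" by (simp add: P_def)
  next
    fix B assume "B \<in> P"
    then obtain v where "v \<in> set b" "B = positions b v" unfolding P_def by blast
    then show "B \<noteq> {} \<and> B \<subseteq> {1..n}" using pos positions_nonempty by simp
  next
    fix i j assume ij: "i < m" "j < m" "i \<noteq> j"
    then have "a ! i \<noteq> a ! j" using a len by (simp add: nth_eq_iff_index_eq)
    then have "positions b (a ! i) \<inter> positions b (a ! j) = {}" using eq by blast
    then show "Fs ! i \<inter> Fs ! j \<subseteq> {0}" using Fs(2)[OF ij(1)] Fs(2)[OF ij(2)] by auto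
  next
    fix i B assume i: "i < m" and "B \<in> P"
    then obtain v where v: "v \<notin> set a" "B = positions b v" unfolding P_def by blast
    have "a ! i \<in> set a" using i len by simp
    then have "positions b (a ! i) \<inter> positions b v = {}" using eq v(1) by blast
    moreover have "0 \<notin> B" using pos[of v] v(2) by auto
    ultimately show "Fs ! i \<inter> B = {}" using Fs(2)[OF i] v(2) by auto
  next
    fix B C assume "B \<in> P" "C \<in> P" "B \<inter> C \<noteq> {}"
    then obtain v w where vw: "B = positions b v" "C = positions b w" unfolding P_def by blast
    with \<open>B \<inter> C \<noteq> {}\<close> have "v = w" using eq by blast
    then show "B = C" using vw by simp
  next
    fix x assume x: "x \<in> {1..n}"
    let ?v = "b ! (x - 1)"
    have mem: "x \<in> positions b ?v" using x len by (simp add: positions_def)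
    show "(\<exists>i<m. x \<in> Fs ! i) \<or> (\<exists>B\<in>P. x \<in> B)"
    proof (cases "?v \<in> set a")
      case True
      then obtain i where "i < m" "a ! i = ?v" using len by (auto simp: in_set_conv_nth)
      then have "x \<in> Fs ! i" using mem Fs(2)[of i] by simp
      with \<open>i < m\<close> show ?thesis by blast
    next
      case False
      then have "positions b ?v \<in> P" using nth_pred_in_set[of x b] x len by (simp add: P_def)
      with mem show ?thesis by blast
    qed
  qed
  then obtain L where L: "L \<in> set_supercomps n m" "take m L = Fs" "set (drop m L) = P" by blast
  interpret L: supercomp n m L by (unfold_locales) (rule L(1))
  have L_ferm: "L ! i = insert 0 (positions b (a ! i))" if "i < m" for i
    using L(2) Fs(2)[OF that] that by (metis nth_take)
  have "(a, b) \<in> m_words n m L"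
    unfolding m_words_def mem_Collect_eq prod.case
  proof (intro conjI allI impI ballI)
    show "(a, b) \<in> words n m" by (rule words)
  next
    fix i j assume i: "i < m" and j: "j \<in> {1..n}"
    show "a ! i = b ! (j - 1) \<longleftrightarrow> j \<in> L ! i - {0}"
      unfolding L_ferm[OF i] using j len by (auto simp: positions_def)
  next
    fix i j assume ij: "i \<in> {1..n}" "j \<in> {1..n}"
    have same: "i \<in> positions b v \<and> j \<in> positions b v \<longleftrightarrow> b ! (i - 1) = v \<and> b ! (j - 1) = v" for v
      using ij len by (simp add: positions_def)
    show "b ! (i - 1) = b ! (j - 1) \<longleftrightarrow> same_block L i j"
    proof
      assume eq': "b ! (i - 1) = b ! (j - 1)"
      let ?v = "b ! (i - 1)"
      have ijv: "i \<in> positions b ?v \<and> j \<in> positions b ?v" using same eq' by simp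
      show "same_block L i j"
      proof (cases "?v \<in> set a")
        case True
        then obtain k where k: "k < m" "a ! k = ?v" using len by (auto simp: in_set_conv_nth)
        then have "i \<in> L ! k \<and> j \<in> L ! k" using ijv L_ferm[OF k(1)] by simp
        then show ?thesis unfolding same_block_def using L.ferm_in_set[OF k(1)] by blast
      next
        case False
        then have "positions b ?v \<in> set (drop m L)"
          unfolding L(3) P_def using nth_pred_in_set[of i b] ij len by simp
        then have "positions b ?v \<in> set L" by (rule in_set_dropD)
        then show ?thesis unfolding same_block_def using ijv by blast
      qed
    next
      assume "same_block L i j"
      then obtain B where B: "B \<in> set L" "i \<in> B" "j \<in> B" unfolding same_block_def by blast
      have "\<exists>v. i \<in> positions b v \<and> j \<in> positions b v"
        using B(1)
      proof (cases rule: L.block_cases)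
        case (1 k)
        then have "i \<in> positions b (a ! k) \<and> j \<in> positions b (a ! k)"
          using B(2,3) L_ferm[OF 1(1)] ij by auto
        then show ?thesis by blast
      next
        case 2
        then obtain v where "B = positions b v" unfolding L(3) P_def by blast
        then show ?thesis using B(2,3) by blast
      qed
      then show "b ! (i - 1) = b ! (j - 1)" unfolding same by auto
    qed
  qed
  with L(1) show ?thesis by blast
qed

section \<open>The type of a word and the weights of h\<close>

context supercomp
begin

text \<open>\<open>vs\<close> lists one value for each block, including the fermionic blocks equal
  to {0}, whose value does not occur in \<open>b\<close>.\<close>

lemma m_words_positions:
  assumes ab: "(a, b) \<in> m_words n m K" and a: "distinct a"
  obtains vs where "length vs = length K" "take m vs = a" "distinct vs" "set b \<subseteq> set vs"
    "\<And>k. k < length K \<Longrightarrow> pos k = positions b (vs ! k)" "set (drop m vs) = set b - set a"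
proof -
  have words: "(a, b) \<in> words n m" using ab unfolding m_words_def by blast
  then have len: "length a = m" "length b = n" by (simp_all add: words_def)
  define c where "c = map (\<lambda>B. b ! (Min B - 1)) (drop m K)"
  note c = m_words_fits[OF ab a, folded c_def]
  let ?vs = "a @ c"
  have lenv: "length ?vs = length K" using len c(1) m_le by simp
  have fit: "b ! (j - 1) = ?vs ! k" if "k < length K" "j \<in> pos k" for j k
    using c(2) that unfolding fits_def by blast
  have pos_eq: "pos k = positions b (?vs ! k)" if k: "k < length K" for k
  proof (intro equalityI subsetI)
    fix j assume j: "j \<in> pos k"
    then have "j \<in> {1..n}" using pos_subset[OF k] by blast
    then show "j \<in> positions b (?vs ! k)" using fit[OF k j] len by (simp add: positions_def)
  next
    fix j assume "j \<in> positions b (?vs ! k)"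
    then have j: "j \<in> {1..n}" "b ! (j - 1) = ?vs ! k" using len by (simp_all add: positions_def)
    obtain l where l: "l < length K" "j \<in> pos l" using j(1) by (rule in_some_pos)
    then have "?vs ! l = ?vs ! k" using fit[OF l] j(2) by simp
    then have "l = k" using c(3) l(1) k lenv by (simp only: nth_eq_iff_index_eq)
    with l(2) show "j \<in> pos k" by simp
  qed
  have sub: "set b \<subseteq> set ?vs"
  proof
    fix v assume "v \<in> set b"
    then obtain k where k: "k < length K" "v \<in># letters b (pos k)" unfolding set_word[OF len(2)] by blast
    then obtain j where "j \<in> pos k" "v = b ! (j - 1)" unfolding set_letters[OF k(1)] by blast
    then have "v = ?vs ! k" using fit[OF k(1)] by simp
    then show "v \<in> set ?vs" using k(1) lenv nth_mem[of k ?vs] by simp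
  qed
  have "set c = set b - set a"
  proof (intro equalityI subsetI)
    fix v assume v: "v \<in> set c"
    then obtain k where k: "k < length c" "v = c ! k" by (auto simp: in_set_conv_nth)
    then have mk: "m + k < length K" "?vs ! (m + k) = v" using lenv len by (simp_all add: nth_append)
    have "pos (m + k) \<noteq> {}" using block_nonempty[OF mk(1)] pos_nonferm[OF _ mk(1)] by simp
    then obtain j where j: "j \<in> pos (m + k)" by blast
    then have "j \<in> {1..length b}" using pos_subset[OF mk(1)] len by blast
    then have "b ! (j - 1) \<in> set b" by (rule nth_pred_in_set)
    then have "v \<in> set b" using fit[OF mk(1) j] mk(2) by simp
    moreover have "v \<notin> set a" using c(3) v by auto
    ultimately show "v \<in> set b - set a" by simp
  next
    fix v assume "v \<in> set b - set a"
    then show "v \<in> set c" using sub by auto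
  qed
  then have "set (drop m ?vs) = set b - set a" using len by simp
  moreover have "take m ?vs = a" using len by simp
  ultimately show thesis using that[OF lenv _ c(3) sub pos_eq] by blast
qed

text \<open>The blocks can be recovered from the word as the position sets of its letters; this lets
  the \<open>THE\<close> in \<open>word_type\<close> be evaluated.\<close>

lemma m_words_unique:
  assumes L: "L \<in> set_supercomps n m" and a: "distinct a"
    and ab: "(a, b) \<in> m_words n m K" "(a, b) \<in> m_words n m L"
  shows "K = L"
proof (rule supercomp_eqI[OF L])
  interpret L: supercomp n m L by (unfold_locales) (rule L)
  have char: "take m K' = map (\<lambda>v. insert 0 (positions b v)) a \<and> set (drop m K') = positions b ` (set b - set a)"
    if K': "K' \<in> set_supercomps n m" "(a, b) \<in> m_words n m K'" for K'
  proof -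
    interpret K': supercomp n m K' by (unfold_locales) (rule K'(1))
    obtain vs where vs: "length vs = length K'" "take m vs = a" "distinct vs" "set b \<subseteq> set vs"
      "\<And>k. k < length K' \<Longrightarrow> K'.pos k = positions b (vs ! k)" "set (drop m vs) = set b - set a"
      using K'.m_words_positions[OF K'(2) a] by blast
    have len: "length a = m" using vs(1,2) K'.m_le by auto
    have "take m K' = map (\<lambda>v. insert 0 (positions b v)) a"
    proof (rule nth_equalityI)
      show "length (take m K') = length (map (\<lambda>v. insert 0 (positions b v)) a)" using len K'.m_le by simp
      fix i assume "i < length (take m K')"
      then have i: "i < m" "i < length K'" by simp_all
      have "a ! i = vs ! i" using vs(2) i by (metis nth_take)
      then have "K' ! i = insert 0 (positions b (a ! i))"
        using vs(5)[OF i(2)] K'.ferm_zero[OF i(1)] unfolding K'.pos_def by auto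
      then show "take m K' ! i = map (\<lambda>v. insert 0 (positions b v)) a ! i" using i len by simp
    qed
    moreover have "drop m K' = map (positions b) (drop m vs)"
    proof (rule nth_equalityI)
      show "length (drop m K') = length (map (positions b) (drop m vs))" using vs(1) by simp
      fix i assume "i < length (drop m K')"
      then have i: "m \<le> m + i" "m + i < length K'" by simp_all
      then show "drop m K' ! i = map (positions b) (drop m vs) ! i"
        using vs(5)[OF i(2)] K'.pos_nonferm[OF i] vs(1) K'.m_le by simp
    qed
    ultimately show ?thesis using vs(6) by simp
  qed
  show "take m K = take m L" "set (drop m K) = set (drop m L)"
    using char[OF K ab(1)] char[OF L ab(2)] by simp_all
qed

definition h_weight :: "nat list \<Rightarrow> nat list \<Rightarrow> rat" where
  "h_weight a b =
    (\<Prod>i<m. h_fermi (a ! i) (letters b (pos i))) * (\<Prod>i\<in>{m..<length K}. h_bose (letters b (pos i)))"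

text \<open>Block \<open>i\<close> of \<open>K\<close> meets block \<open>j\<close> of the type in
  those of its positions that carry the letter \<open>vs ! j\<close>, so every cardinality in
  \<open>tuple_fact_meet\<close> is a multiplicity in \<open>letters b (pos i)\<close>. Hence the
  weight splits over the blocks of \<open>K\<close>.\<close>

lemma tuple_fact_word_type:
  assumes words: "(a, b) \<in> words n m" and a: "distinct a"
  shows "tuple_fact (meet n m K (word_type n m (a, b))) = h_weight a b"
proof -
  have len: "length a = m" "length b = n" and ge1: "\<forall>v\<in>set a. 1 \<le> v" "\<forall>v\<in>set b. 1 \<le> v"
    using words by (simp_all add: words_def)
  obtain L where L: "L \<in> set_supercomps n m" "(a, b) \<in> m_words n m L"
    using word_supercomp_exists[OF m_le_Suc words a] by blast
  interpret L: supercomp n m L by (unfold_locales) (rule L(1))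
  have "word_type n m (a, b) = L"
    unfolding word_type_def
  proof (rule the_equality)
    show "L \<in> set_supercomps n m \<and> (a, b) \<in> m_words n m L" using L by simp
    show "L' = L" if "L' \<in> set_supercomps n m \<and> (a, b) \<in> m_words n m L'" for L'
      using L.m_words_unique[of L' a b] that a L(2) by simp
  qed
  moreover obtain vs where vs: "length vs = length L" "take m vs = a" "distinct vs" "set b \<subseteq> set vs"
    "\<And>k. k < length L \<Longrightarrow> L.pos k = positions b (vs ! k)"
    using L.m_words_positions[OF L(2) a] by blast
  have inner: "(\<Prod>j<length L. fact (card (pos i \<inter> L.pos j) + of_bool (i = j \<and> i < m))) =
      (if i < m then h_fermi (a ! i) (letters b (pos i)) else h_bose (letters b (pos i)))"
    if i: "i < length K" for i
  proof -
    let ?C = "letters b (pos i)"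
    have Cb: "set_mset ?C \<subseteq> set b" unfolding set_word[OF len(2)] using i by blast
    have 0: "0 \<notin># ?C" using Cb ge1(2) by auto
    have card: "card (pos i \<inter> L.pos j) = count ?C (vs ! j)" if j: "j < length L" for j
    proof -
      have "pos i \<inter> L.pos j = {x \<in> pos i. b ! (x - 1) = vs ! j}"
        unfolding vs(5)[OF j] positions_def len(2) using pos_subset[OF i] by blast
      then show ?thesis by (simp add: count_letters[OF i])
    qed
    \<comment> \<open>\<open>vs\<close> is distinct and contains every letter; values that do not
      occur in this block contribute 0! = 1.\<close>
    have base: "(\<Prod>j<length L. fact (count ?C (vs ! j)) :: rat) = (\<Prod>v\<in>set_mset ?C. fact (count ?C v))"
    proof -
      have "(\<Prod>j<length L. fact (count ?C (vs ! j)) :: rat) = (\<Prod>v\<leftarrow>vs. fact (count ?C v))"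
        by (simp add: prod.list_conv_set_nth vs(1) lessThan_atLeast0)
      also have "\<dots> = (\<Prod>v\<in>set vs. fact (count ?C v))"
        by (rule prod.distinct_set_conv_list[OF vs(3), symmetric])
      also have "\<dots> = (\<Prod>v\<in>set_mset ?C. fact (count ?C v))"
        using Cb vs(4) by (intro prod.mono_neutral_right) (auto simp: not_in_iff)
      finally show ?thesis .
    qed
    have "(\<Prod>j<length L. fact (card (pos i \<inter> L.pos j) + of_bool (i = j \<and> i < m)) :: rat) =
        (\<Prod>j<length L. fact (count ?C (vs ! j) + of_bool (i = j \<and> i < m)))"
      by (intro prod.cong refl) (simp add: card)
    also have "\<dots> = (if i < m then of_nat (count ?C (a ! i) + 1) else 1) * (\<Prod>j<length L. fact (count ?C (vs ! j)))"
    proof (cases "i < m")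
      case True
      then have iL: "i \<in> {..<length L}" using L.m_le by simp
      \<comment> \<open>The diagonal factor belongs to the letter \<open>a ! i\<close>, because
        \<open>vs\<close> begins with \<open>a\<close>.\<close>
      have ai: "vs ! i = a ! i" using vs(2) True by (metis nth_take)
      have "(\<Prod>j<length L. fact (count ?C (vs ! j) + of_bool (i = j \<and> i < m)) :: rat) =
          fact (count ?C (a ! i) + 1) * (\<Prod>j\<in>{..<length L} - {i}. fact (count ?C (vs ! j) + of_bool (i = j \<and> i < m)))"
        by (subst prod.remove[OF _ iL]) (simp_all add: ai True)
      also have "(\<Prod>j\<in>{..<length L} - {i}. fact (count ?C (vs ! j) + of_bool (i = j \<and> i < m)) :: rat) =
          (\<Prod>j\<in>{..<length L} - {i}. fact (count ?C (vs ! j)))"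
        by (intro prod.cong refl) auto
      also have "fact (count ?C (a ! i) + 1) * \<dots> = of_nat (count ?C (a ! i) + 1) *
          (fact (count ?C (vs ! i)) * (\<Prod>j\<in>{..<length L} - {i}. fact (count ?C (vs ! j))))"
        by (simp add: ai algebra_simps)
      also have "fact (count ?C (vs ! i)) * (\<Prod>j\<in>{..<length L} - {i}. fact (count ?C (vs ! j)) :: rat) =
          (\<Prod>j<length L. fact (count ?C (vs ! j)))"
        by (rule prod.remove[OF _ iL, symmetric]) simp
      finally show ?thesis using True by simp
    qed simp
    also have "\<dots> = (if i < m then h_fermi (a ! i) ?C else h_bose ?C)"
    proof (cases "i < m")
      case True
      then have "a ! i \<in> set a" using len by simp
      then have "1 \<le> a ! i" using ge1(1) by blast
      then show ?thesis unfolding base using True 0 by (simp add: h_fermi_def)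
    next
      case False
      then show ?thesis unfolding base using 0 by (simp add: h_bose_def)
    qed
    finally show ?thesis .
  qed
  have split: "{..<length K} = {..<m} \<union> {m..<length K}" "{..<m} \<inter> {m..<length K} = {}" using m_le by auto
  have "tuple_fact (meet n m K L) =
      (\<Prod>i<length K. if i < m then h_fermi (a ! i) (letters b (pos i)) else h_bose (letters b (pos i)))"
    unfolding tuple_fact_meet[OF L(1)] by (intro prod.cong refl) (simp only: inner lessThan_iff)
  also have "\<dots> = h_weight a b"
    unfolding split(1) h_weight_def by (subst prod.union_disjoint) (use split(2) in \<open>auto intro!: arg_cong2[of _ _ _ _ "(*)"] prod.cong\<close>)
  finally show ?thesis using \<open>word_type n m (a, b) = L\<close> by simp
qed

text \<open>\<open>tuple_fact_word_type\<close> covers only words with positive indices, while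
  \<open>sum_words_blocks\<close> runs over all lists; on the others the weight has to vanish by
  itself.\<close>

lemma h_weight_eq_0:
  assumes len: "length a = m" "length b = n" and not: "(a, b) \<notin> words n m"
  shows "h_weight a b = 0"
proof -
  have "\<not> (\<forall>v\<in>set a. 1 \<le> v) \<or> \<not> (\<forall>v\<in>set b. 1 \<le> v)" using not len unfolding words_def by blast
  then consider i where "i < m" "a ! i = 0" | "0 \<in> set b"
    using len by (metis in_set_conv_nth less_one not_less)
  then show ?thesis
  proof cases
    case (1 i)
    then have "h_fermi (a ! i) (letters b (pos i)) = 0" by (simp add: h_fermi_def)
    then have "(\<Prod>i<m. h_fermi (a ! i) (letters b (pos i))) = 0" using 1(1) by (intro prod_zero) auto
    then show ?thesis by (simp add: h_weight_def)
  next
    case 2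
    then obtain i where i: "i < length K" "0 \<in># letters b (pos i)" unfolding set_word[OF len(2)] by blast
    show ?thesis
    proof (cases "i < m")
      case True
      have "h_fermi (a ! i) (letters b (pos i)) = 0" using i(2) by (simp add: h_fermi_def)
      then have "(\<Prod>i<m. h_fermi (a ! i) (letters b (pos i))) = 0" using True by (intro prod_zero) auto
      then show ?thesis by (simp add: h_weight_def)
    next
      case False
      have "h_bose (letters b (pos i)) = 0" using i(2) by (simp add: h_bose_def)
      then have "(\<Prod>i\<in>{m..<length K}. h_bose (letters b (pos i))) = 0"
        using False i(1) by (intro prod_zero) auto
      then show ?thesis by (simp add: h_weight_def)
    qed
  qed
qed

text \<open>A \<theta>-index absent from \<open>b\<close> has multiplicity 0 in every block, so its
  fermionic factor is the same for all positive absent indices.\<close>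

lemma h_weight_transpose:
  assumes len: "length a = m" "length b = n" and uv: "u \<notin> set b" "v \<notin> set b" "1 \<le> u" "1 \<le> v"
  shows "h_weight (map (transpose u v) a) b = h_weight a b"
proof -
  have "h_fermi (map (transpose u v) a ! i) (letters b (pos i)) = h_fermi (a ! i) (letters b (pos i))" if "i < m" for i
  proof -
    have "i < length K" using that m_le by simp
    then have "set_mset (letters b (pos i)) \<subseteq> set b" unfolding set_word[OF len(2)] by blast
    then have "u \<notin># letters b (pos i)" "v \<notin># letters b (pos i)" using uv(1,2) by blast+
    then have count: "count (letters b (pos i)) u = 0" "count (letters b (pos i)) v = 0"
      unfolding not_in_iff .
    have "map (transpose u v) a ! i = transpose u v (a ! i)" using that len by simp
    then show ?thesis
      using count uv(3,4) by (cases "a ! i = u"; cases "a ! i = v") (simp_all add: h_fermi_def)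
  qed
  then show ?thesis unfolding h_weight_def by simp
qed

text \<open>
  In the product of the blocks there are also words in which two indices \<open>u\<close>, \<open>v\<close> of the
  \<open>\<theta>\<close>-variables do not occur among the indices of the \<open>x\<close>-variables. Exchanging \<open>u\<close> and \<open>v\<close>
  preserves the weight and reverses the sign, so these words cancel.
\<close>

lemma rho_nc_h: "rho (nc_h n m K) =
    arranged_series h_fermi h_bose (ferm_sizes m K) (map card (drop m K))"
proof (intro ext)
  fix S :: "nat set" and M :: "nat multiset"
  let ?c = "\<lambda>u. tuple_fact (meet n m K (word_type n m u))"
  let ?W = "\<lambda>a. \<Sum>b\<in>{b. length b = n \<and> mset b = M}. h_weight a b"
  have lhs: "rho (nc_h n m K) S M =
      (\<Sum>a\<in>theta_lists S m. list_sign a * (\<Sum>b\<in>{b. mset b = M}. if (a, b) \<in> h_words n m then ?c (a, b) else 0))"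
  proof -
    have "h_words n m \<subseteq> words n m" unfolding h_words_def by blast
    from rho_weighted_words[OF this, of ?c] show ?thesis by (simp only: nc_h_def alt_sum_def)
  qed
  have rhs: "arranged_series h_fermi h_bose (ferm_sizes m K) (map card (drop m K)) S M = (\<Sum>a\<in>theta_lists S m. list_sign a * ?W a)"
    unfolding block_series_def length_ferm_sizes alt_sum_def
  proof (intro sum.cong refl)
    fix a assume "a \<in> theta_lists S m"
    then have "length a = m" by (simp add: theta_lists_def)
    then have "?W a = conv_list (map2 (\<lambda>k i M. arrangements k M * h_fermi i M) (ferm_sizes m K) a @
        map (\<lambda>k M. arrangements k M * h_bose M) (map card (drop m K))) M"
      by (rule sum_words_blocks) (rule h_weight_def)
    then show "list_sign a * conv_list (map2 (\<lambda>k i M. arrangements k M * h_fermi i M) (ferm_sizes m K) a @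
        map (\<lambda>k M. arrangements k M * h_bose M) (map card (drop m K))) M = list_sign a * ?W a" by simp
  qed
  have setb: "set b = set_mset M" if "mset b = M" for b using that by auto
  show "rho (nc_h n m K) S M = arranged_series h_fermi h_bose (ferm_sizes m K) (map card (drop m K)) S M"
  proof (cases "card (S - set_mset M) \<le> 1")
    \<comment> \<open>At most one \<theta>-index is missing from \<open>M\<close>, so every word
      with distinct \<open>a\<close> over \<open>S\<close> and \<open>M\<close> belongs to
      \<open>h_words\<close>, and both sides agree term by term.\<close>
    case True
    show ?thesis
      unfolding lhs rhs
    proof (intro sum.cong refl)
      fix a assume "a \<in> theta_lists S m"
      then have a: "length a = m" "set a = S" by (simp_all add: theta_lists_def)
      show "list_sign a * (\<Sum>b\<in>{b. mset b = M}. if (a, b) \<in> h_words n m then ?c (a, b) else 0) = list_sign a * ?W a"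
      proof (cases "distinct a")
        case False
        then show ?thesis by (simp add: list_sign_eq_0)
      next
        case dist: True
        have h: "(a, b) \<in> h_words n m \<longleftrightarrow> (a, b) \<in> words n m" if "mset b = M" for b
        proof -
          have "card (set a - set b) \<le> 1" using True a(2) setb[OF that] by simp
          then show ?thesis unfolding h_words_def using dist by blast
        qed
        have "?W a = (\<Sum>b\<in>{b. mset b = M}. if (a, b) \<in> h_words n m then ?c (a, b) else 0)"
        proof (rule sum.mono_neutral_cong_left)
          show "finite {b. mset b = M}" by (rule finite_mset_eq)
          show "\<forall>b\<in>{b. mset b = M} - {b. length b = n \<and> mset b = M}.
              (if (a, b) \<in> h_words n m then ?c (a, b) else 0) = 0"
            by (auto simp: h_words_def words_def)
          show "h_weight a b = (if (a, b) \<in> h_words n m then ?c (a, b) else 0)"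
            if "b \<in> {b. length b = n \<and> mset b = M}" for b
          proof (cases "(a, b) \<in> words n m")
            case True
            then show ?thesis using h[of b] that tuple_fact_word_type[OF True dist] by simp
          next
            case False
            then show ?thesis using h[of b] that h_weight_eq_0[OF a(1) _ False] by simp
          qed
        qed blast
        then show ?thesis by simp
      qed
    qed
  next
    case False
    have "rho (nc_h n m K) S M = 0"
      unfolding lhs
    proof (intro sum.neutral ballI)
      fix a assume "a \<in> theta_lists S m"
      then have a: "set a = S" by (simp add: theta_lists_def)
      have "(a, b) \<notin> h_words n m" if "mset b = M" for b
        unfolding h_words_def using False a setb[OF that] by auto
      then have "(\<Sum>b\<in>{b. mset b = M}. if (a, b) \<in> h_words n m then ?c (a, b) else 0) = 0"
        by (intro sum.neutral) simp
      then show "list_sign a * (\<Sum>b\<in>{b. mset b = M}. if (a, b) \<in> h_words n m then ?c (a, b) else 0) = 0" by simp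
    qed
    moreover have "(\<Sum>a\<in>theta_lists S m. list_sign a * ?W a) = 0"
    proof (cases "0 \<in> S")
      \<comment> \<open>The exchange used in the other case needs positive indices. If 0 is in
        \<open>S\<close>, every single weight is 0.\<close>
      case True
      show ?thesis
      proof (intro sum.neutral ballI)
        fix a assume "a \<in> theta_lists S m"
        then have a: "length a = m" "0 \<in> set a" using True by (simp_all add: theta_lists_def)
        have "h_weight a b = 0" if "length b = n" for b
        proof (rule h_weight_eq_0[OF a(1) that])
          show "(a, b) \<notin> words n m" using a(2) unfolding words_def by auto
        qed
        then have "?W a = 0" by (intro sum.neutral ballI) (elim CollectE conjE)
        then show "list_sign a * ?W a = 0" by (simp only: mult_zero_right)
      qed
    next
      case S0: False
      have fin: "finite (S - set_mset M)"
      proof (rule ccontr)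
        assume "infinite (S - set_mset M)"
        then have "card (S - set_mset M) = 0" by (rule card.infinite)
        with False show False by simp
      qed
      have "\<not> (\<forall>u\<in>S - set_mset M. \<forall>v\<in>S - set_mset M. u = v)"
        using False unfolding One_nat_def card_le_Suc0_iff_eq[OF fin] .
      then obtain u v where uv: "u \<in> S - set_mset M" "v \<in> S - set_mset M" "u \<noteq> v" by blast
      have "u \<noteq> 0" "v \<noteq> 0" using uv(1,2) S0 by (metis DiffD1)+
      then have ge1: "1 \<le> u" "1 \<le> v" by simp_all
      let ?t = "map (transpose u v)"
      have tt: "?t (?t a) = a" for a
        by (simp only: map_map transpose_comp_involutory list.map_id)
      have "transpose u v ` S = S" by (rule transpose_image_eq) (use uv in blast)
      then have t: "?t a \<in> theta_lists S m" if "a \<in> theta_lists S m" for a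
        using that unfolding theta_lists_def mem_Collect_eq set_map length_map by metis
      have "(\<Sum>a\<in>theta_lists S m. list_sign a * ?W a) = (\<Sum>a\<in>theta_lists S m. - (list_sign a * ?W a))"
      proof (rule sum.reindex_bij_witness[where i = ?t and j = ?t])
        fix a assume a: "a \<in> theta_lists S m"
        then have a': "length a = m" "set a = S" by (simp_all add: theta_lists_def)
        have "?W (?t a) = ?W a"
        proof (intro sum.cong refl)
          fix b assume "b \<in> {b. length b = n \<and> mset b = M}"
          then have b: "length b = n" "set b = set_mset M" using setb by simp_all
          show "h_weight (?t a) b = h_weight a b"
            by (rule h_weight_transpose[OF a'(1) b(1) _ _ ge1]) (use uv b(2) in blast)+
        qed
        moreover have "list_sign (?t a) = - list_sign a"
          by (rule list_sign_map_transpose) (use uv a'(2) in blast)+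
        ultimately show "- (list_sign (?t a) * ?W (?t a)) = list_sign a * ?W a"
          by (simp only: mult_minus_left minus_minus)
      qed (rule tt t; assumption?)+
      then show ?thesis unfolding sum_negf by (simp only: equal_neg_zero)
    qed
    ultimately show ?thesis unfolding rhs by simp
  qed
qed

end

section \<open>Assembly of the four projections and of the vanishing statement\<close>

lemma rho_set_supercomp:
  assumes K: "K \<in> set_supercomps n m"
  shows "(\<forall>i<m. \<forall>j<m. i \<noteq> j \<longrightarrow> card (K ! i) \<noteq> card (K ! j)) \<Longrightarrow>
      rho (nc_m n m K) = scale ((-1) ^ eps m K * mult_fact (snd (shape m K))) (c_m (shape m K))"
    and "rho (nc_p n m K) = scale ((-1) ^ eps m K) (c_p (shape m K))"
    and "rho (nc_e n m K) = scale ((-1) ^ eps m K * superpart_fact (shape m K)) (c_e (shape m K))"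
    and "rho (nc_h n m K) = scale ((-1) ^ eps m K * superpart_fact (shape m K)) (c_h (shape m K))"
    and "i < m \<Longrightarrow> j < m \<Longrightarrow> i \<noteq> j \<Longrightarrow> card (K ! i) = card (K ! j) \<Longrightarrow>
      rho (nc_m n m K) = zero_series \<and> rho (nc_p n m K) = zero_series \<and>
      rho (nc_e n m K) = zero_series \<and> rho (nc_h n m K) = zero_series"
proof -
  interpret supercomp n m K by (unfold_locales) (rule K)
  obtain la ls where sh: "shape m K = (la, ls)" by (cases "shape m K")
  have m_shape: "m_series (ferm_sizes m K) (map card (drop m K)) =
      scale ((-1) ^ eps m K) (m_series (fst (shape m K)) (snd (shape m K)))"
    "i < m \<Longrightarrow> j < m \<Longrightarrow> i \<noteq> j \<Longrightarrow> card (K ! i) = card (K ! j) \<Longrightarrow>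
      m_series (ferm_sizes m K) (map card (drop m K)) = zero_series"
    by (rule alternating_series_shape[of m_series, OF m_series_swap_adjacent m_series_mset_cong m_le];
        assumption)+
  have fact_w: "(\<Prod>k\<leftarrow>fst (shape m K) @ snd (shape m K). fact k) = superpart_fact (shape m K)"
    by (simp add: sh superpart_fact_def)
  have one_w: "(\<Prod>k\<leftarrow>xs. 1 :: rat) = 1" for xs :: "nat list" by (induction xs) simp_all
  \<comment> \<open>For p a block has a single arrangement, so its scalar is the constant 1, which
    \<open>mult_1\<close> removes from the instance.\<close>
  note p = rho_multiplicative[OF K rho_nc_p, of "\<lambda>_. 1" "\<lambda>k i M. of_bool (1 \<le> i \<and> M = replicate_mset k i)"
      "\<lambda>k M. of_bool (\<exists>i\<ge>1. M = replicate_mset k i)" p_a p_s,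
      unfolded mult_1, OF arrangements_p(1) arrangements_p(2) p_a_eq p_s_eq]
  note e = rho_multiplicative[OF K rho_nc_e arrangements_e e_a_eq e_s_eq]
  note h = rho_multiplicative[OF K rho_nc_h arrangements_h h_a_eq h_s_eq]
  show "rho (nc_p n m K) = scale ((-1) ^ eps m K) (c_p (shape m K))"
    using p(1) by (simp only: one_w mult_1_right) (simp add: sh c_p_def)
  show "rho (nc_e n m K) = scale ((-1) ^ eps m K * superpart_fact (shape m K)) (c_e (shape m K))"
    using e(1) unfolding fact_w by (simp add: sh c_e_def)
  show "rho (nc_h n m K) = scale ((-1) ^ eps m K * superpart_fact (shape m K)) (c_h (shape m K))"
    using h(1) unfolding fact_w by (simp add: sh c_h_def)
  show "rho (nc_m n m K) = scale ((-1) ^ eps m K * mult_fact (snd (shape m K))) (c_m (shape m K))"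
    if ne: "\<forall>i<m. \<forall>j<m. i \<noteq> j \<longrightarrow> card (K ! i) \<noteq> card (K ! j)"
  proof -
    have "distinct (ferm_sizes m K)"
      unfolding distinct_conv_nth length_ferm_sizes
    proof (intro allI impI)
      fix i j assume ij: "i < m" "j < m" "i \<noteq> j"
      \<comment> \<open>Truncated subtraction of 1 is injective on positive cardinalities, so
        different block sizes give different parts, as \<open>c_m_eq\<close> requires.\<close>
      have "1 \<le> card (K ! k) \<and> ferm_sizes m K ! k = card (K ! k) - 1" if "k < m" for k
      proof -
        have k: "k < length K" using that m_le by simp
        then have "card (K ! k) \<noteq> 0" using block_nonempty[OF k] finite_block[OF k] by simp
        then show ?thesis using that k by (simp add: ferm_sizes_def)
      qed
      from this[OF ij(1)] this[OF ij(2)] show "ferm_sizes m K ! i \<noteq> ferm_sizes m K ! j"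
        using ne ij by (metis le_add_diff_inverse)
    qed
    then have la: "distinct la" using sh unfolding shape_def by (metis distinct_rev distinct_sort prod.inject)
    have ls: "mset ls = mset (map card (drop m K))" using sh by (auto simp: shape_def)
    then have "0 \<notin> set ls" using zero_notin_cards by (metis set_mset_mset)
    with la have "c_m (shape m K) = m_series la ls" unfolding sh by (rule c_m_eq)
    moreover have "mult_fact (map card (drop m K)) = mult_fact ls" using ls by (metis mult_fact_mset)
    moreover have "m_series (ferm_sizes m K) (map card (drop m K)) = scale ((-1) ^ eps m K) (m_series la ls)"
      using m_shape(1) by (simp add: sh)
    ultimately show ?thesis
      by (simp only: rho_nc_m scale_scale sh snd_conv mult.commute)
  qed
  show "rho (nc_m n m K) = zero_series \<and> rho (nc_p n m K) = zero_series \<and>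
      rho (nc_e n m K) = zero_series \<and> rho (nc_h n m K) = zero_series"
    if ij: "i < m" "j < m" "i \<noteq> j" "card (K ! i) = card (K ! j)"
  proof (intro conjI)
    show "rho (nc_m n m K) = zero_series"
      unfolding rho_nc_m m_shape(2)[OF ij] by (simp add: scale_def zero_series_def)
    show "rho (nc_p n m K) = zero_series" by (rule p(2)[OF _ ij])
    show "rho (nc_e n m K) = zero_series" by (rule e(2)[OF ij])
    show "rho (nc_h n m K) = zero_series" by (rule h(2)[OF ij])
  qed
qed

theorem proposition5p5:
  fixes n m :: nat
  shows
    "(\<forall>I\<in>set_superparts n m.
        (\<forall>i<m. \<forall>j<m. i \<noteq> j \<longrightarrow> card (I ! i) \<noteq> card (I ! j)) \<longrightarrow>
        rho (nc_m n m I) = scale ((-1) ^ eps m I * mult_fact (snd (shape m I))) (c_m (shape m I)) \<and>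
        rho (nc_p n m I) = scale ((-1) ^ eps m I) (c_p (shape m I)) \<and>
        rho (nc_e n m I) = scale ((-1) ^ eps m I * superpart_fact (shape m I)) (c_e (shape m I)) \<and>
        rho (nc_h n m I) = scale ((-1) ^ eps m I * superpart_fact (shape m I)) (c_h (shape m I))) \<and>
     (\<forall>J\<in>set_superparts n m.
        (\<exists>i<m. \<exists>j<m. i \<noteq> j \<and> card (J ! i) = card (J ! j)) \<longrightarrow>
        rho (nc_m n m J) = zero_series \<and> rho (nc_p n m J) = zero_series \<and>
        rho (nc_e n m J) = zero_series \<and> rho (nc_h n m J) = zero_series)"
proof (intro conjI ballI impI)
  fix I assume "I \<in> set_superparts n m"
  then have I: "I \<in> set_supercomps n m" by (simp add: set_superparts_def)
  note rho = rho_set_supercomp[OF I]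
  {
    assume "\<forall>i<m. \<forall>j<m. i \<noteq> j \<longrightarrow> card (I ! i) \<noteq> card (I ! j)"
    from rho(1)[OF this]
    show "rho (nc_m n m I) = scale ((-1) ^ eps m I * mult_fact (snd (shape m I))) (c_m (shape m I))" .
    show "rho (nc_p n m I) = scale ((-1) ^ eps m I) (c_p (shape m I))"
      "rho (nc_e n m I) = scale ((-1) ^ eps m I * superpart_fact (shape m I)) (c_e (shape m I))"
      "rho (nc_h n m I) = scale ((-1) ^ eps m I * superpart_fact (shape m I)) (c_h (shape m I))"
      by (fact rho)+
  next
    assume "\<exists>i<m. \<exists>j<m. i \<noteq> j \<and> card (I ! i) = card (I ! j)"
    then obtain i j where "i < m" "j < m" "i \<noteq> j" "card (I ! i) = card (I ! j)" by blast
    from rho(5)[OF this]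
    show "rho (nc_m n m I) = zero_series" "rho (nc_p n m I) = zero_series"
      "rho (nc_e n m I) = zero_series" "rho (nc_h n m I) = zero_series" by blast+
  }
qed

end
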